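(* Consider Local Exact-Diffusion (LED), and suppose the network, noise, smoothness and ($\mu$-strong) convexity assumptions stated in the context hold; let $x^\star$ be a minimizer of $f$. Then, for sufficiently small constant stepsize $\alpha$ and for $\beta=1/\tau$, the following hold. (a) If $\mu=0$ (convex case), then $$\frac1R\sum_{r=0}^{R-1}\mathcal E_r\le O\left(\frac{\|\bar x^0-x^\star\|^2}{\alpha\tau R}+\frac{\alpha^2\tau^2L^2\varsigma_0^2}{(1-\lambda)^2R}\right)+O\left(\frac{\alpha\sigma^2}{N}+\frac{\alpha^2\tau L\sigma^2}{1-\lambda}\right),$$ where the first $O(\cdot)$ is the deterministic part, the second the stochastic part, $\mathcal E_r=\mathbb E[f(\bar x^r)-f(x^\star)]$, $\bar x^0=\frac1N\sum_{i=1}^N x_i^0$, and $\varsigma_0^2=\frac1N\sum_{i=1}^N\|\nabla f_i(\bar x^0)-\nabla f(\bar x^0)\|^2$. (b) If $\mu>0$ (strongly convex case), then $$\mathbb E\|\bar x^r-x^\star\|^2\le\Big(1-\frac{\alpha\tau\mu}{4}\Big)^r a_0+O\left(\frac{\alpha\sigma^2}{\mu N}+\frac{\alpha^2\tau L\sigma^2}{\mu(1-\lambda)}\right),$$ where the first term is the deterministic part, the second the stochastic part, and $a_0$ is a constant that depends on the initialization.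
   Context: Setting. There are $N$ nodes connected by an undirected network; $\mathcal N_i$ is the set of neighbors of node $i$, including $i$. Node $i$ has $f_i:\mathbb R^m\to\mathbb R$, $f_i(x)=\mathbb E[F_i(x;\xi_i)]$, and $f=\frac1N\sum_{i=1}^N f_i$. LED. Parameters: an integer $\tau\ge1$ (number of local steps), stepsizes $\alpha,\beta>0$, and an $N\times N$ weight matrix $W=[w_{ij}]$ with $w_{ij}\ge 0$ and $w_{ij}=0$ for $j\notin\mathcal N_i$. Given $x_i^0\in\mathbb R^m$, set $y_i^0=x_i^0-\sum_{j\in\mathcal N_i}w_{ij}x_j^0$ for all $i$ (or $y_i^0=0$ for all $i$). For $r=0,1,2,\dots$, each node $i$ sets $\phi_{i,0}^r=x_i^r$ and performs $$\phi_{i,t+1}^r=\phi_{i,t}^r-\alpha\nabla F_i(\phi_{i,t}^r;\xi_{i,t}^r)-\beta y_i^r\quad(t=0,\dots,\tau-1),$$ $$x_i^{r+1}=\sum_{j\in\mathcal N_i} w_{ij}\phi_{j,\tau}^r,\qquad y_i^{r+1}=y_i^r+\phi_{i,\tau}^r-x_i^{r+1}.$$ Write $\bar x^r=\frac1N\sum_{i=1}^N x_i^r$. Network assumption. $W$ is symmetric, doubly stochastic, primitive and positive definite. The mixing rate is $\lambda=\|W-\frac1N\mathbf 1\mathbf 1^T\|<1$ (spectral norm), i.e. the second largest eigenvalue of $W$. Noise assumption. For some $\sigma^2\ge0$ and all $i,r,t$, conditionally on all iterates generated so far, $\nabla F_i(\phi_{i,t}^r;\xi_{i,t}^r)$ has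 mean $\nabla f_i(\phi_{i,t}^r)$ and $\mathbb E\|\nabla F_i(\phi_{i,t}^r;\xi_{i,t}^r)-\nabla f_i(\phi_{i,t}^r)\|^2\le\sigma^2$; moreover the random data $\xi_{i,t}^r$ are independent of each other for all $i$ and $t$. Smoothness assumption. Each $f_i$ satisfies $\|\nabla f_i(y)-\nabla f_i(z)\|\le L\|y-z\|$ for all $y,z\in\mathbb R^m$, for some $L>0$; and $f$ is bounded below, $f(x)\ge f^\star>-\infty$ for every $x$, where $f^\star$ is the optimal value of $f$. Convexity assumption. Each $f_i$ is $\mu$-strongly convex for some $0\le\mu\le L$ (when $\mu=0$, the functions are simply convex).
   Formalization: Part (a) is proved for a common starting point, x_i^0 = x_j^0 for all i, j; without it the bound fails, e.g. with identical costs, no noise and mean start equal to the minimizer but unequal nodes, the right side is 0 while the left side is positive at R = 2. *)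

theory Defs
  imports "HOL-Probability.Probability" "Jordan_Normal_Form.Matrix"
begin

text \<open>
  Nodes are the natural numbers below \<open>N\<close> and decision vectors live in an arbitrary Euclidean
  space. Because the bounds display their dependence on \<open>N\<close> and on the weight matrix, the number
  of nodes has to be a quantifiable number, so weight matrices are dimension-carrying matrices.
\<close>

section \<open>Functions\<close>

definition gradient :: "('a::real_inner \<Rightarrow> real) \<Rightarrow> 'a \<Rightarrow> 'a" where
  "gradient f x = (THE D. GDERIV f x :> D)"

text \<open>For \<open>\<mu> = 0\<close> this is plain convexity.\<close>

definition strongly_convex :: "real \<Rightarrow> ('a::real_inner \<Rightarrow> real) \<Rightarrow> bool" where
  "strongly_convex \<mu> f \<longleftrightarrow>
     (\<forall>x y. \<forall>s\<in>{0..1}. f (s *\<^sub>R x + (1 - s) *\<^sub>R y)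
        \<le> s * f x + (1 - s) * f y - \<mu> / 2 * s * (1 - s) * (norm (x - y))\<^sup>2)"

definition node_mean :: "nat \<Rightarrow> (nat \<Rightarrow> 'a::real_vector) \<Rightarrow> 'a" where
  "node_mean N x = (1 / real N) *\<^sub>R (\<Sum>i<N. x i)"

definition avg_fun :: "nat \<Rightarrow> (nat \<Rightarrow> 'a \<Rightarrow> real) \<Rightarrow> 'a \<Rightarrow> real" where
  "avg_fun N f v = (1 / real N) * (\<Sum>i<N. f i v)"

definition smooth_problem ::
  "nat \<Rightarrow> real \<Rightarrow> (nat \<Rightarrow> 'a::euclidean_space \<Rightarrow> real) \<Rightarrow> bool" where
  "smooth_problem N L f \<longleftrightarrow> L > 0 \<and>
     (\<forall>i<N. (\<forall>v. f i differentiable (at v)) \<and>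
        (\<forall>y z. norm (gradient (f i) y - gradient (f i) z) \<le> L * norm (y - z))) \<and>
     bdd_below (range (avg_fun N f))"

definition is_minimizer :: "('a \<Rightarrow> real) \<Rightarrow> 'a \<Rightarrow> bool" where
  "is_minimizer f z \<longleftrightarrow> (\<forall>v. f z \<le> f v)"

definition heterogeneity ::
  "nat \<Rightarrow> (nat \<Rightarrow> 'a::euclidean_space \<Rightarrow> real) \<Rightarrow> 'a \<Rightarrow> real" where
  "heterogeneity N f v =
     (1 / real N) * (\<Sum>i<N. (norm (gradient (f i) v - gradient (avg_fun N f) v))\<^sup>2)"

section \<open>Network\<close>

definition symmetric_mat :: "real mat \<Rightarrow> bool" where
  "symmetric_mat A \<longleftrightarrow> transpose_mat A = A"

definition doubly_stochastic_mat :: "nat \<Rightarrow> real mat \<Rightarrow> bool" where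
  "doubly_stochastic_mat N A \<longleftrightarrow>
     (\<forall>i<N. \<forall>j<N. A $$ (i, j) \<ge> 0) \<and>
     (\<forall>i<N. (\<Sum>j<N. A $$ (i, j)) = 1) \<and> (\<forall>j<N. (\<Sum>i<N. A $$ (i, j)) = 1)"

definition primitive_mat :: "nat \<Rightarrow> real mat \<Rightarrow> bool" where
  "primitive_mat N A \<longleftrightarrow>
     (\<forall>i<N. \<forall>j<N. A $$ (i, j) \<ge> 0) \<and>
     (\<exists>k\<ge>1. \<forall>i<N. \<forall>j<N. (A ^\<^sub>m k) $$ (i, j) > 0)"

definition pos_definite_mat :: "nat \<Rightarrow> real mat \<Rightarrow> bool" where
  "pos_definite_mat N A \<longleftrightarrow>
     (\<forall>v\<in>carrier_vec N. v \<noteq> 0\<^sub>v N \<longrightarrow> scalar_prod v (A *\<^sub>v v) > 0)"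

definition vec_norm2 :: "real vec \<Rightarrow> real" where
  "vec_norm2 v = sqrt (scalar_prod v v)"

definition spectral_norm :: "real mat \<Rightarrow> real" where
  "spectral_norm A = Sup {vec_norm2 (A *\<^sub>v v) | v. v \<in> carrier_vec (dim_col A) \<and> vec_norm2 v \<le> 1}"

definition mixing_rate :: "nat \<Rightarrow> real mat \<Rightarrow> real" where
  "mixing_rate N W = spectral_norm (W - mat N N (\<lambda>_. 1 / real N))"

text \<open>\<open>nb i\<close> is the neighbourhood of \<open>i\<close> in the undirected network, including \<open>i\<close> itself.\<close>

definition network_assumption :: "nat \<Rightarrow> (nat \<Rightarrow> nat set) \<Rightarrow> real mat \<Rightarrow> bool" where
  "network_assumption N nb W \<longleftrightarrow>
     N \<ge> 1 \<and>
     (\<forall>i<N. nb i \<subseteq> {..<N} \<and> i \<in> nb i) \<and>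
     (\<forall>i<N. \<forall>j<N. j \<in> nb i \<longleftrightarrow> i \<in> nb j) \<and>
     W \<in> carrier_mat N N \<and>
     (\<forall>i<N. \<forall>j<N. W $$ (i, j) \<ge> 0 \<and> (j \<notin> nb i \<longrightarrow> W $$ (i, j) = 0)) \<and>
     symmetric_mat W \<and> doubly_stochastic_mat N W \<and> primitive_mat N W \<and> pos_definite_mat N W \<and>
     mixing_rate N W < 1"

section \<open>Local Exact-Diffusion\<close>

text \<open>
  The recursion is deterministic in the stochastic gradients: \<open>G i r t v\<close> is the stochastic
  gradient that node \<open>i\<close> evaluates at \<open>v\<close> in local step \<open>t\<close> of round \<open>r\<close>. Randomness enters by
  instantiating \<open>G\<close> with the gradients at one outcome of the random data.
\<close>

primrec local_steps ::
  "real \<Rightarrow> real \<Rightarrow> (nat \<Rightarrow> 'a \<Rightarrow> 'a) \<Rightarrow> 'a \<Rightarrow> 'a::real_vector \<Rightarrow> nat \<Rightarrow> 'a" where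
  "local_steps \<alpha> \<beta> g y x 0 = x"
| "local_steps \<alpha> \<beta> g y x (Suc t) =
     local_steps \<alpha> \<beta> g y x t - \<alpha> *\<^sub>R g t (local_steps \<alpha> \<beta> g y x t) - \<beta> *\<^sub>R y"

definition mix :: "(nat \<Rightarrow> nat set) \<Rightarrow> real mat \<Rightarrow> (nat \<Rightarrow> 'a::real_vector) \<Rightarrow> nat \<Rightarrow> 'a" where
  "mix nb W p i = (\<Sum>j\<in>nb i. W $$ (i, j) *\<^sub>R p j)"

definition led_init ::
  "nat \<Rightarrow> (nat \<Rightarrow> nat set) \<Rightarrow> real mat \<Rightarrow> (nat \<Rightarrow> 'a::real_vector) \<Rightarrow> (nat \<Rightarrow> 'a) \<Rightarrow> bool" where
  "led_init N nb W x0 y0 \<longleftrightarrow> (\<forall>i<N. y0 i = x0 i - mix nb W x0 i) \<or> (\<forall>i<N. y0 i = 0)"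

text \<open>The state after \<open>r\<close> rounds, as the pair of \<open>x\<close>- and \<open>y\<close>-variables of all nodes.\<close>

primrec led_state ::
  "(nat \<Rightarrow> nat set) \<Rightarrow> real mat \<Rightarrow> nat \<Rightarrow> real \<Rightarrow> real \<Rightarrow> (nat \<Rightarrow> nat \<Rightarrow> nat \<Rightarrow> 'a \<Rightarrow> 'a) \<Rightarrow>
   (nat \<Rightarrow> 'a) \<Rightarrow> (nat \<Rightarrow> 'a) \<Rightarrow> nat \<Rightarrow> (nat \<Rightarrow> 'a::real_vector) \<times> (nat \<Rightarrow> 'a)" where
  "led_state nb W \<tau> \<alpha> \<beta> G x0 y0 0 = (x0, y0)"
| "led_state nb W \<tau> \<alpha> \<beta> G x0 y0 (Suc r) =
     (let (x, y) = led_state nb W \<tau> \<alpha> \<beta> G x0 y0 r;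
          p = (\<lambda>i. local_steps \<alpha> \<beta> (G i r) (y i) (x i) \<tau>)
      in (mix nb W p, \<lambda>i. y i + p i - mix nb W p i))"

definition led_x where
  "led_x nb W \<tau> \<alpha> \<beta> G x0 y0 r i = fst (led_state nb W \<tau> \<alpha> \<beta> G x0 y0 r) i"

definition led_y where
  "led_y nb W \<tau> \<alpha> \<beta> G x0 y0 r i = snd (led_state nb W \<tau> \<alpha> \<beta> G x0 y0 r) i"

definition led_phi where
  "led_phi nb W \<tau> \<alpha> \<beta> G x0 y0 r i t =
     local_steps \<alpha> \<beta> (G i r) (led_y nb W \<tau> \<alpha> \<beta> G x0 y0 r i) (led_x nb W \<tau> \<alpha> \<beta> G x0 y0 r i) t"

section \<open>Stochastic gradients\<close>

text \<open>
  \<open>\<Xi> i r t\<close> is the datum sampled by node \<open>i\<close> in local step \<open>t\<close> of round \<open>r\<close>, while \<open>\<xi> i\<close> is the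
  generic random variable defining the local cost. The gradient of \<open>F\<close> is taken in its second
  argument, with the datum held fixed.
\<close>

definition sample_grad ::
  "(nat \<Rightarrow> 'a::euclidean_space \<Rightarrow> 's \<Rightarrow> real) \<Rightarrow> (nat \<Rightarrow> nat \<Rightarrow> nat \<Rightarrow> 'w \<Rightarrow> 's) \<Rightarrow> 'w \<Rightarrow>
   nat \<Rightarrow> nat \<Rightarrow> nat \<Rightarrow> 'a \<Rightarrow> 'a" where
  "sample_grad F \<Xi> \<omega> i r t = gradient (\<lambda>v. F i v (\<Xi> i r t \<omega>))"

definition stochastic_costs ::
  "'w measure \<Rightarrow> nat \<Rightarrow> (nat \<Rightarrow> 's measure) \<Rightarrow> (nat \<Rightarrow> 'a::euclidean_space \<Rightarrow> 's \<Rightarrow> real) \<Rightarrow>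
   (nat \<Rightarrow> 'w \<Rightarrow> 's) \<Rightarrow> (nat \<Rightarrow> 'a \<Rightarrow> real) \<Rightarrow> bool" where
  "stochastic_costs M N S F \<xi> f \<longleftrightarrow> prob_space M \<and>
     (\<forall>i<N. (\<lambda>(v, s). F i v s) \<in> borel_measurable (borel \<Otimes>\<^sub>M S i) \<and>
        (\<forall>s\<in>space (S i). \<forall>v. (\<lambda>z. F i z s) differentiable (at v)) \<and>
        \<xi> i \<in> measurable M (S i) \<and>
        (\<forall>v. integrable M (\<lambda>\<omega>. F i v (\<xi> i \<omega>)) \<and> f i v = (\<integral>\<omega>. F i v (\<xi> i \<omega>) \<partial>M)))"

text \<open>
  The history up to local step \<open>t\<close> of round \<open>r\<close>. The variables \<open>x\<close> and \<open>y\<close> need not be listed: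
  \<open>x\<close> is the local iterate at step 0, and \<open>y\<close> is a function of the listed iterates.
\<close>

definition history ::
  "'w measure \<Rightarrow> nat \<Rightarrow> nat \<Rightarrow> ('w \<Rightarrow> nat \<Rightarrow> nat \<Rightarrow> nat \<Rightarrow> 'a::euclidean_space) \<Rightarrow>
   nat \<Rightarrow> nat \<Rightarrow> 'w measure" where
  "history M N \<tau> \<phi> r t = sigma (space M)
     {(\<lambda>\<omega>. \<phi> \<omega> q j s) -` A \<inter> space M | q j s A.
        j < N \<and> A \<in> sets borel \<and> (q < r \<and> s \<le> \<tau> \<or> q = r \<and> s \<le> t)}"

text \<open>
  The vector-valued conditional mean is expressed in coordinates. The conditional variance is the
  conditional expectation of a nonnegative function, so that the bound includes its finiteness.
\<close>

definition noise_assumption ::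
  "'w measure \<Rightarrow> nat \<Rightarrow> nat \<Rightarrow> (nat \<Rightarrow> 's measure) \<Rightarrow>
   (nat \<Rightarrow> 'a::euclidean_space \<Rightarrow> 's \<Rightarrow> real) \<Rightarrow> (nat \<Rightarrow> nat \<Rightarrow> nat \<Rightarrow> 'w \<Rightarrow> 's) \<Rightarrow>
   (nat \<Rightarrow> 'a \<Rightarrow> real) \<Rightarrow> ('w \<Rightarrow> nat \<Rightarrow> nat \<Rightarrow> nat \<Rightarrow> 'a) \<Rightarrow> real \<Rightarrow> bool" where
  "noise_assumption M N \<tau> S F \<Xi> f \<phi> \<sigma> \<longleftrightarrow> \<sigma> \<ge> 0 \<and>
     (\<forall>i<N. \<forall>r. \<forall>t<\<tau>.
        (AE \<omega> in M. \<forall>b\<in>Basis.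
           real_cond_exp M (history M N \<tau> \<phi> r t)
             (\<lambda>\<omega>. inner (sample_grad F \<Xi> \<omega> i r t (\<phi> \<omega> r i t)) b) \<omega>
           = inner (gradient (f i) (\<phi> \<omega> r i t)) b) \<and>
        (AE \<omega> in M.
           nn_cond_exp M (history M N \<tau> \<phi> r t)
             (\<lambda>\<omega>. ennreal ((norm (sample_grad F \<Xi> \<omega> i r t (\<phi> \<omega> r i t)
                                    - gradient (f i) (\<phi> \<omega> r i t)))\<^sup>2)) \<omega>
           \<le> ennreal (\<sigma>\<^sup>2))) \<and>
     (\<forall>i<N. \<forall>r. \<forall>t<\<tau>. \<Xi> i r t \<in> measurable M (S i)) \<and>
     prob_space.indep_vars M (\<lambda>(i, r, t). S i) (\<lambda>(i, r, t). \<Xi> i r t)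
       ({..<N} \<times> UNIV \<times> {..<\<tau>})"

text \<open>One run of the algorithm on a problem for which the sampling and noise assumptions hold.\<close>

definition led_run ::
  "'w measure \<Rightarrow> nat \<Rightarrow> (nat \<Rightarrow> nat set) \<Rightarrow> real mat \<Rightarrow> nat \<Rightarrow> real \<Rightarrow> real \<Rightarrow> (nat \<Rightarrow> 's measure) \<Rightarrow>
   (nat \<Rightarrow> 'a::euclidean_space \<Rightarrow> 's \<Rightarrow> real) \<Rightarrow> (nat \<Rightarrow> 'w \<Rightarrow> 's) \<Rightarrow>
   (nat \<Rightarrow> nat \<Rightarrow> nat \<Rightarrow> 'w \<Rightarrow> 's) \<Rightarrow> (nat \<Rightarrow> 'a \<Rightarrow> real) \<Rightarrow> (nat \<Rightarrow> 'a) \<Rightarrow> (nat \<Rightarrow> 'a) \<Rightarrow> real \<Rightarrow> bool"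
  where
  "led_run M N nb W \<tau> \<alpha> \<beta> S F \<xi> \<Xi> f x0 y0 \<sigma> \<longleftrightarrow>
     stochastic_costs M N S F \<xi> f \<and>
     noise_assumption M N \<tau> S F \<Xi> f
       (\<lambda>\<omega>. led_phi nb W \<tau> \<alpha> \<beta> (sample_grad F \<Xi> \<omega>) x0 y0) \<sigma>"

definition led_mean ::
  "nat \<Rightarrow> (nat \<Rightarrow> nat set) \<Rightarrow> real mat \<Rightarrow> nat \<Rightarrow> real \<Rightarrow> real \<Rightarrow>
   (nat \<Rightarrow> 'a::euclidean_space \<Rightarrow> 's \<Rightarrow> real) \<Rightarrow> (nat \<Rightarrow> nat \<Rightarrow> nat \<Rightarrow> 'w \<Rightarrow> 's) \<Rightarrow>
   (nat \<Rightarrow> 'a) \<Rightarrow> (nat \<Rightarrow> 'a) \<Rightarrow> nat \<Rightarrow> 'w \<Rightarrow> 'a" where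
  "led_mean N nb W \<tau> \<alpha> \<beta> F \<Xi> x0 y0 r \<omega> =
     node_mean N (led_x nb W \<tau> \<alpha> \<beta> (sample_grad F \<Xi> \<omega>) x0 y0 r)"

end

theory Submission
  imports Defs "Jordan_Normal_Form.Determinant"
begin

text \<open>
  Write \<open>a = \<alpha> \<tau>\<close> and \<open>l = a L\<close>. Each \<open>y\<close> is in the range of \<open>K = I - W\<close>, so the consensus error
  of the \<open>x\<close> variables is \<open>T p\<close> and that of \<open>y\<close>, shifted by \<open>a\<close> times the deviation of the local
  gradients from their mean, is \<open>K z\<close>, where \<open>T = W - J\<close> and \<open>J\<close> averages over the nodes. In these
  coordinates the form \<open>\<langle>p, T p\<rangle> + \<langle>z, K z\<rangle>\<close> contracts by the mixing rate in every round
  and receives at most the squared norm of the gradient noise; this yields the factor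
  \<open>1 / (1 - lam)\<close> of the noise terms. The squared distance of the node average to the minimizer plus
  \<open>120 l / (1 - lam)\<close> times the consensus energy is then a Lyapunov function: it loses
  \<open>a / 2\<close> times the optimality gap per round, and a factor \<open>1 - a \<mu> / 4\<close>.

  In the convex case the part of the consensus error caused by the initial heterogeneity is split
  off and enters the descent inequality linearly instead of quadratically. Its contribution is of
  order \<open>\<alpha>\<^sup>3\<close>, so that a small step size brings it below the claimed \<open>\<alpha>\<^sup>2 L\<^sup>2\<close> term for every \<open>L\<close>, whereas
  the quadratic estimate only gives \<open>\<alpha>\<^sup>2 L\<close>.

  Noise vectors of different nodes or steps are orthogonal: conditionally on everything but its own
  sample, a noise vector has mean \<open>k \<phi>\<close> with a deterministic \<open>k\<close>, and the conditional mean assumption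
  forces \<open>k \<phi> = 0\<close> almost surely.
\<close>

section \<open>Gradients, smoothness and convexity\<close>

text \<open>The matrix that advances the consensus error is not normal, so working in the plain norm
  would cost a condition number of the network. The energy avoids this: noise enters both
  coordinates through the same vector, and \<open>T + K\<close> is the projection onto mean-zero
  stacks, so a noise vector is charged with its centered norm and nothing more. Its inner products
  with past quantities vanish in expectation and are carried along unestimated. Only the gradient
  drift, which already has a factor \<open>l\<^sup>2\<close>, pays the \<open>1 / (1 - lam)\<close>
  of Young's inequality.

  Shifting \<open>z\<close> by a gradient deviation requires an inverse of \<open>K\<close> on
  mean-zero stacks. Its size \<kappa> depends on the network, but in the recursions it is always
  multiplied by the step size. The threshold for \<alpha> absorbs it, and the constants of the
  theorem stay absolute.

  The split of the consensus error is used in two extreme ways. In the strongly convex case the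
  split-off part is zero and the start goes into \<open>a0\<close>; in the convex case the whole
  initial error is split off, so that the remaining energy starts at zero.\<close>

lemma gderiv_gradient:
  fixes f :: "'a::euclidean_space \<Rightarrow> real"
  assumes "f differentiable (at x)"
  shows "GDERIV f x :> gradient f x"
proof -
  obtain f' where f': "(f has_derivative f') (at x)"
    using assms by (auto simp: differentiable_def)
  then interpret bounded_linear f' by (rule has_derivative_bounded_linear)
  \<comment> \<open>\<open>D\<close> is the Riesz vector of the derivative. Its uniqueness, shown
    below, is what lets the description \<open>THE\<close> denote it.\<close>
  define D where "D = (\<Sum>b\<in>Basis. f' b *\<^sub>R b)"
  have "f' h = inner h D" for h
  proof -
    have "f' h = f' (\<Sum>b\<in>Basis. inner h b *\<^sub>R b)" by (simp add: euclidean_representation)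
    also have "\<dots> = (\<Sum>b\<in>Basis. inner h b * f' b)" by (simp add: sum scaleR)
    finally show ?thesis by (simp add: D_def inner_sum_right mult.commute)
  qed
  then have "f' = (\<lambda>h. inner h D)" by blast
  then have D: "GDERIV f x :> D" using f' by (simp add: gderiv_def)
  moreover have "E = D" if "GDERIV f x :> E" for E
  proof -
    have "(\<lambda>h. inner h E) = (\<lambda>h. inner h D)"
      using that D has_derivative_unique unfolding gderiv_def by blast
    then have "inner (E - D) E = inner (E - D) D" by meson
    then show ?thesis by (metis eq_iff_diff_eq_0 inner_diff_right inner_eq_zero_iff)
  qed
  ultimately show ?thesis unfolding gradient_def by (metis theI)
qed

lemma gradient_eqI:
  fixes f :: "'a::euclidean_space \<Rightarrow> real"
  assumes "GDERIV f x :> D"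
  shows "gradient f x = D"
proof -
  have "f differentiable (at x)" using assms by (auto simp: gderiv_def differentiable_def)
  from gderiv_gradient[OF this] assms have "(\<lambda>h. inner h (gradient f x)) = (\<lambda>h. inner h D)"
    using has_derivative_unique unfolding gderiv_def by blast
  then have "inner (gradient f x - D) (gradient f x) = inner (gradient f x - D) D" by meson
  then show ?thesis by (metis eq_iff_diff_eq_0 inner_diff_right inner_eq_zero_iff)
qed

text \<open>The multivariate facts about costs are derived on lines: the quadratic upper bound, the
  convexity lower bound and the measurability of gradients all start from this one-variable
  derivative.\<close>

lemma has_real_derivative_along_line:
  fixes f :: "'a::euclidean_space \<Rightarrow> real"
  assumes "f differentiable (at (x + t *\<^sub>R v))"
  shows "((\<lambda>s. f (x + s *\<^sub>R v)) has_real_derivative inner v (gradient f (x + t *\<^sub>R v))) (at t)"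
proof -
  have f': "(f has_derivative (\<lambda>h. inner h (gradient f (x + t *\<^sub>R v)))) (at (x + t *\<^sub>R v))"
    using gderiv_gradient[OF assms] by (simp add: gderiv_def)
  have "((\<lambda>s. x + s *\<^sub>R v) has_derivative (\<lambda>s. s *\<^sub>R v)) (at t)"
    by (auto intro!: derivative_eq_intros)
  note has_derivative_compose[OF this f']
  moreover have "(\<lambda>s. inner (s *\<^sub>R v) D) = (*) (inner v D)" for D
    by (simp add: fun_eq_iff)
  ultimately show ?thesis
    unfolding has_field_derivative_def by simp
qed

lemma smooth_upper_bound:
  fixes f :: "'a::euclidean_space \<Rightarrow> real"
  assumes diff: "\<And>v. f differentiable (at v)"
    and lip: "\<And>y z. norm (gradient f y - gradient f z) \<le> L * norm (y - z)"
  shows "f y \<le> f x + inner (gradient f x) (y - x) + L / 2 * (norm (y - x))\<^sup>2"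
proof -
  define v where "v = y - x"
  \<comment> \<open>Up to the constant \<open>f x\<close>, this is \<open>f\<close> on the segment
    minus the claimed bound. The Lipschitz condition makes its derivative nonpositive.\<close>
  define \<phi> where "\<phi> t = f (x + t *\<^sub>R v) - t * inner (gradient f x) v - L / 2 * t\<^sup>2 * (norm v)\<^sup>2" for t
  have "\<exists>D. (\<phi> has_real_derivative D) (at t) \<and> D \<le> 0" if "0 \<le> t" for t
  proof (intro exI conjI)
    have line: "((\<lambda>s. f (x + s *\<^sub>R v)) has_real_derivative inner v (gradient f (x + t *\<^sub>R v))) (at t)"
      by (rule has_real_derivative_along_line) (rule diff)
    have lin: "((\<lambda>s. s * c) has_real_derivative c) (at t)" for c :: real
      by (auto intro!: derivative_eq_intros)
    have quad: "((\<lambda>s. L / 2 * s\<^sup>2 * c) has_real_derivative L * t * c) (at t)" for c :: real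
      by (auto intro!: derivative_eq_intros)
    show "(\<phi> has_real_derivative (inner v (gradient f (x + t *\<^sub>R v)) - inner (gradient f x) v
        - L * t * (norm v)\<^sup>2)) (at t)"
      unfolding \<phi>_def by (rule DERIV_diff[OF DERIV_diff[OF line lin] quad])
    have "inner v (gradient f (x + t *\<^sub>R v)) - inner (gradient f x) v
        = inner v (gradient f (x + t *\<^sub>R v) - gradient f x)"
      by (simp add: inner_diff_right inner_commute)
    also have "\<dots> \<le> norm v * norm (gradient f (x + t *\<^sub>R v) - gradient f x)"
      by (rule norm_cauchy_schwarz)
    also have "\<dots> \<le> norm v * (L * norm (t *\<^sub>R v))"
      using lip[of "x + t *\<^sub>R v" x] by (intro mult_left_mono) auto
    also have "\<dots> = L * t * (norm v)\<^sup>2" using that by (simp add: power2_eq_square)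
    finally show "inner v (gradient f (x + t *\<^sub>R v)) - inner (gradient f x) v
        - L * t * (norm v)\<^sup>2 \<le> 0" by simp
  qed
  then have "\<phi> 1 \<le> \<phi> 0" by (intro DERIV_nonpos_imp_nonincreasing[of 0 1 \<phi>]) auto
  then have "f (x + v) \<le> f x + inner (gradient f x) v + L / 2 * (norm v)\<^sup>2"
    unfolding \<phi>_def by simp
  then show ?thesis unfolding v_def by simp
qed

text \<open>Dividing the convexity inequality by \<open>s\<close> and letting \<open>s\<close> tend
  to 0 from the right turns the slope of the chord into the directional derivative.\<close>

lemma strongly_convex_lower_bound:
  fixes f :: "'a::euclidean_space \<Rightarrow> real"
  assumes diff: "\<And>v. f differentiable (at v)" and sc: "strongly_convex \<mu> f"
  shows "f x + inner (gradient f x) (y - x) + \<mu> / 2 * (norm (y - x))\<^sup>2 \<le> f y"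
proof -
  define v where "v = y - x"
  have "((\<lambda>s. f (x + s *\<^sub>R v)) has_real_derivative inner v (gradient f x)) (at 0)"
    using has_real_derivative_along_line[of f x 0 v] diff by simp
  then have "(\<lambda>s. (f (x + s *\<^sub>R v) - f x) / s) \<midarrow>0\<rightarrow> inner v (gradient f x)"
    unfolding DERIV_def by simp
  then have l: "((\<lambda>s. (f (x + s *\<^sub>R v) - f x) / s) \<longlongrightarrow> inner v (gradient f x)) (at_right 0)"
    by (rule filterlim_at_split[THEN iffD1, THEN conjunct2])
  have r: "((\<lambda>s. f y - f x - \<mu> / 2 * (1 - s) * (norm v)\<^sup>2) \<longlongrightarrow>
      f y - f x - \<mu> / 2 * (1 - 0) * (norm v)\<^sup>2) (at_right 0)"
    by (intro tendsto_intros)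
  have "\<forall>\<^sub>F s in at_right 0. (f (x + s *\<^sub>R v) - f x) / s \<le> f y - f x - \<mu> / 2 * (1 - s) * (norm v)\<^sup>2"
    unfolding eventually_at_right_field
  proof (intro exI[of _ 1] conjI allI impI)
    fix s :: real assume s: "0 < s" "s < 1"
    have "s *\<^sub>R y + (1 - s) *\<^sub>R x = x + s *\<^sub>R v" by (simp add: v_def algebra_simps)
    then have "f (x + s *\<^sub>R v) \<le> s * f y + (1 - s) * f x - \<mu> / 2 * s * (1 - s) * (norm v)\<^sup>2"
      using sc[unfolded strongly_convex_def, rule_format, of s y x] s by (simp add: v_def)
    then have "f (x + s *\<^sub>R v) - f x \<le> (f y - f x - \<mu> / 2 * (1 - s) * (norm v)\<^sup>2) * s"
      by (simp add: algebra_simps)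
    then show "(f (x + s *\<^sub>R v) - f x) / s \<le> f y - f x - \<mu> / 2 * (1 - s) * (norm v)\<^sup>2"
      using s by (subst pos_divide_le_eq) auto
  qed simp
  from tendsto_le[OF _ r l this] show ?thesis
    by (simp add: v_def inner_commute)
qed

text \<open>A gradient step of length \<open>1 / L\<close> lowers \<open>f\<close> by at least
  \<open>(norm (g x))\<^sup>2 / (2 * L)\<close>, and it cannot fall below the minimum. Only a
  quadratic upper bound with slope \<open>g\<close> enters, so the average cost is covered
  directly.\<close>

lemma gradient_norm_le_gap:
  fixes f :: "'a::euclidean_space \<Rightarrow> real"
  assumes ub: "\<And>x y. f y \<le> f x + inner (g x) (y - x) + L / 2 * (norm (y - x))\<^sup>2"
    and min: "is_minimizer f z" and L: "L > 0"
  shows "(norm (g x))\<^sup>2 \<le> 2 * L * (f x - f z)"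
proof -
  define y where "y = x - (1 / L) *\<^sub>R g x"
  have "f z \<le> f y" using min by (simp add: is_minimizer_def)
  also have "\<dots> \<le> f x + inner (g x) (y - x) + L / 2 * (norm (y - x))\<^sup>2" by (rule ub)
  also have "\<dots> = f x - (norm (g x))\<^sup>2 / (2 * L)"
  proof -
    have "inner (g x) (y - x) = - ((norm (g x))\<^sup>2 / L)"
      by (simp add: y_def power2_norm_eq_inner)
    moreover have "L / 2 * (norm (y - x))\<^sup>2 = (norm (g x))\<^sup>2 / (2 * L)"
      using L by (simp add: y_def power_divide power2_eq_square)
    moreover have "(norm (g x))\<^sup>2 / L = 2 * ((norm (g x))\<^sup>2 / (2 * L))" by simp
    ultimately show ?thesis by linarith
  qed
  finally show ?thesis using L by (simp add: field_simps)
qed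

lemma gradient_avg_fun:
  fixes f :: "nat \<Rightarrow> 'a::euclidean_space \<Rightarrow> real"
  assumes "\<And>i. i < N \<Longrightarrow> f i differentiable (at x)"
  shows "gradient (avg_fun N f) x = node_mean N (\<lambda>i. gradient (f i) x)"
proof (rule gradient_eqI)
  have "((\<lambda>x. (1 / real N) * (\<Sum>i<N. f i x)) has_derivative
      (\<lambda>h. (1 / real N) * (\<Sum>i<N. inner h (gradient (f i) x)))) (at x)"
    using gderiv_gradient[OF assms]
    by (intro has_derivative_mult_right has_derivative_sum) (auto simp: gderiv_def)
  then show "GDERIV (avg_fun N f) x :> node_mean N (\<lambda>i. gradient (f i) x)"
    by (simp add: gderiv_def avg_fun_def[abs_def] node_mean_def inner_sum_right)
qed

section \<open>Mixing operators and the consensus energy\<close>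

text \<open>The inner product of stacked vectors with one block per node. A stack is a function on
  all naturals whose values below \<open>N\<close> count, which explains the congruence
  rules.\<close>

definition ip :: "nat \<Rightarrow> (nat \<Rightarrow> 'a::real_inner) \<Rightarrow> (nat \<Rightarrow> 'a) \<Rightarrow> real" where
  "ip N u v = (\<Sum>i<N. inner (u i) (v i))"

lemma ip_commute: "ip N u v = ip N v u"
  by (simp add: ip_def inner_commute)

lemma ip_add_left: "ip N (\<lambda>i. u i + v i) x = ip N u x + ip N v x"
  by (simp add: ip_def inner_add_left sum.distrib)

lemma ip_add_right: "ip N x (\<lambda>i. u i + v i) = ip N x u + ip N x v"
  by (simp add: ip_def inner_add_right sum.distrib)

lemma ip_diff_left: "ip N (\<lambda>i. u i - v i) x = ip N u x - ip N v x"
  by (simp add: ip_def inner_diff_left sum_subtractf)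

lemma ip_diff_right: "ip N x (\<lambda>i. u i - v i) = ip N x u - ip N x v"
  by (simp add: ip_def inner_diff_right sum_subtractf)

lemma ip_scaleR_left: "ip N (\<lambda>i. c *\<^sub>R u i) x = c * ip N u x"
  by (simp add: ip_def sum_distrib_left)

lemma ip_scaleR_right: "ip N x (\<lambda>i. c *\<^sub>R u i) = c * ip N x u"
  by (simp add: ip_def sum_distrib_left)

lemma ip_self: "ip N u u = (\<Sum>i<N. (norm (u i))\<^sup>2)"
  by (simp add: ip_def power2_norm_eq_inner)

lemma ip_self_nonneg [simp]: "0 \<le> ip N u u"
  by (simp add: ip_self sum_nonneg)

lemma ip_const_right: "ip N u (\<lambda>_. c) = inner (\<Sum>i<N. u i) c"
  by (simp add: ip_def inner_sum_left)

lemma ip_cong: "(\<And>i. i < N \<Longrightarrow> u i = u' i) \<Longrightarrow> (\<And>i. i < N \<Longrightarrow> v i = v' i) \<Longrightarrow> ip N u v = ip N u' v'"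
  by (simp add: ip_def)

lemmas ip_linear = ip_add_left ip_add_right ip_diff_left ip_diff_right ip_scaleR_left ip_scaleR_right

lemma node_mean_add: "node_mean N (\<lambda>i. u i + v i) = node_mean N u + node_mean N v"
  by (simp add: node_mean_def sum.distrib scaleR_add_right)

lemma node_mean_diff: "node_mean N (\<lambda>i. u i - v i) = node_mean N u - node_mean N v"
  by (simp add: node_mean_def sum_subtractf scaleR_diff_right)

lemma node_mean_scaleR: "node_mean N (\<lambda>i. c *\<^sub>R u i) = c *\<^sub>R node_mean N u"
  by (simp add: node_mean_def scaleR_sum_right mult.commute)

lemma node_mean_const: "N \<ge> 1 \<Longrightarrow> node_mean N (\<lambda>_. c) = c"
  by (simp add: node_mean_def sum_constant_scaleR)

lemma node_mean_cong: "(\<And>i. i < N \<Longrightarrow> u i = v i) \<Longrightarrow> node_mean N u = node_mean N v"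
  by (simp add: node_mean_def)

lemma sum_eq_node_mean: "N \<ge> 1 \<Longrightarrow> (\<Sum>i<N. u i) = real N *\<^sub>R node_mean N u"
  by (simp add: node_mean_def)

lemma norm_sum_squared_le:
  fixes v :: "'b \<Rightarrow> 'a::real_normed_vector"
  assumes "finite I"
  shows "(norm (\<Sum>i\<in>I. v i))\<^sup>2 \<le> real (card I) * (\<Sum>i\<in>I. (norm (v i))\<^sup>2)"
proof -
  have "(norm (\<Sum>i\<in>I. v i))\<^sup>2 \<le> (\<Sum>i\<in>I. norm (v i))\<^sup>2"
    by (intro power_mono norm_sum) simp
  also have "\<dots> \<le> (\<Sum>i\<in>I. 1\<^sup>2) * (\<Sum>i\<in>I. (norm (v i))\<^sup>2)"
    using Cauchy_Schwarz_ineq_sum[of "\<lambda>_. 1" "\<lambda>i. norm (v i)" I] by simp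
  finally show ?thesis by simp
qed

lemma norm_node_mean_squared_le:
  assumes "N \<ge> 1"
  shows "(norm (node_mean N u))\<^sup>2 \<le> (1 / real N) * (\<Sum>i<N. (norm (u i))\<^sup>2)"
proof -
  have "(norm (\<Sum>i<N. u i))\<^sup>2 \<le> real N * (\<Sum>i<N. (norm (u i))\<^sup>2)"
    using norm_sum_squared_le[of "{..<N}" u] by simp
  then show ?thesis using assms
    by (simp add: node_mean_def power_divide divide_simps power2_eq_square mult.commute)
qed

lemma sum_norm_squared_centered:
  assumes "N \<ge> 1"
  shows "ip N (\<lambda>i. u i - node_mean N u) (\<lambda>i. u i - node_mean N u)
    = ip N u u - ip N u (\<lambda>_. node_mean N u)"
proof -
  let ?m = "node_mean N u"
  have "ip N (\<lambda>_. ?m) (\<lambda>_. ?m) = real N * inner ?m ?m" by (simp add: ip_def)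
  moreover have "ip N u (\<lambda>_. ?m) = real N * inner ?m ?m"
    unfolding ip_const_right sum_eq_node_mean[OF assms] by simp
  ultimately show ?thesis
    by (simp add: ip_diff_left ip_diff_right ip_commute[of N "\<lambda>_. ?m" u])
qed

section \<open>Mixing as an operator on stacks of vectors\<close>

locale gossip =
  fixes N :: nat and w :: "nat \<Rightarrow> nat \<Rightarrow> real" and lam :: real
  assumes N_pos: "N \<ge> 1"
    and w_sym: "\<And>i j. i < N \<Longrightarrow> j < N \<Longrightarrow> w i j = w j i"
    and w_row: "\<And>i. i < N \<Longrightarrow> (\<Sum>j<N. w i j) = 1"
    and w_psd: "\<And>c. 0 \<le> (\<Sum>i<N. \<Sum>j<N. w i j * (c i * c j))"
    and w_gap: "\<And>c. (\<Sum>i<N. \<Sum>j<N. (w i j - 1 / real N) * (c i * c j)) \<le> lam * (\<Sum>i<N. (c i)\<^sup>2)"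
    and lam_nonneg: "0 \<le> lam" and lam_less: "lam < 1"
begin

definition Wop :: "(nat \<Rightarrow> 'a::euclidean_space) \<Rightarrow> nat \<Rightarrow> 'a" where
  "Wop u i = (\<Sum>j<N. w i j *\<^sub>R u j)"

definition T :: "(nat \<Rightarrow> 'a::euclidean_space) \<Rightarrow> nat \<Rightarrow> 'a" where
  "T u i = Wop u i - node_mean N u"

text \<open>The Laplacian \<open>I - W\<close> of the weighted network.\<close>

definition K :: "(nat \<Rightarrow> 'a::euclidean_space) \<Rightarrow> nat \<Rightarrow> 'a" where
  "K u i = u i - Wop u i"

text \<open>Both operators are symmetric, positive semidefinite and zero on constant stacks, so this
  is a squared seminorm on pairs that is blind to the node means of \<open>p\<close> and
  \<open>z\<close>.\<close>

definition energy :: "(nat \<Rightarrow> 'a::euclidean_space) \<Rightarrow> (nat \<Rightarrow> 'a) \<Rightarrow> real" where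
  "energy p z = ip N p (T p) + ip N z (K z)"

lemma Wop_add: "Wop (\<lambda>i. u i + v i) i = Wop u i + Wop v i"
  by (simp add: Wop_def sum.distrib scaleR_add_right)

lemma Wop_diff: "Wop (\<lambda>i. u i - v i) i = Wop u i - Wop v i"
  by (simp add: Wop_def sum_subtractf scaleR_diff_right)

lemma Wop_scaleR: "Wop (\<lambda>i. c *\<^sub>R u i) i = c *\<^sub>R Wop u i"
  by (simp add: Wop_def scaleR_sum_right mult.commute)

lemma Wop_const: "i < N \<Longrightarrow> Wop (\<lambda>_. c) i = c"
  using w_row[of i] by (simp add: Wop_def flip: scaleR_sum_left)

lemma Wop_cong: "(\<And>j. j < N \<Longrightarrow> u j = v j) \<Longrightarrow> Wop u i = Wop v i"
  by (simp add: Wop_def)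

lemma node_mean_Wop: "node_mean N (Wop u) = node_mean N u"
proof -
  have "(\<Sum>i<N. Wop u i) = (\<Sum>j<N. \<Sum>i<N. w i j *\<^sub>R u j)"
    unfolding Wop_def by (rule sum.swap)
  also have "\<dots> = (\<Sum>j<N. (\<Sum>i<N. w j i) *\<^sub>R u j)"
    by (intro sum.cong refl) (simp add: scaleR_sum_left w_sym)
  finally show ?thesis by (simp add: node_mean_def w_row)
qed

lemma T_add: "T (\<lambda>i. u i + v i) i = T u i + T v i"
  by (simp add: T_def Wop_add node_mean_add)

lemma T_diff: "T (\<lambda>i. u i - v i) i = T u i - T v i"
  by (simp add: T_def Wop_diff node_mean_diff)

lemma T_scaleR: "T (\<lambda>i. c *\<^sub>R u i) i = c *\<^sub>R T u i"
  by (simp add: T_def Wop_scaleR node_mean_scaleR scaleR_diff_right)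

lemma T_const: "i < N \<Longrightarrow> T (\<lambda>_. c) i = 0"
  using N_pos by (simp add: T_def Wop_const node_mean_const)

lemma T_cong: "(\<And>j. j < N \<Longrightarrow> u j = v j) \<Longrightarrow> T u i = T v i"
  unfolding T_def using Wop_cong node_mean_cong by metis

lemma K_add: "K (\<lambda>i. u i + v i) i = K u i + K v i"
  by (simp add: K_def Wop_add)

lemma K_diff: "K (\<lambda>i. u i - v i) i = K u i - K v i"
  by (simp add: K_def Wop_diff)

lemma K_scaleR: "K (\<lambda>i. c *\<^sub>R u i) i = c *\<^sub>R K u i"
  by (simp add: K_def Wop_scaleR scaleR_diff_right)

lemma K_const: "i < N \<Longrightarrow> K (\<lambda>_. c) i = 0"
  by (simp add: K_def Wop_const)

lemma K_cong: "(\<And>j. j < N \<Longrightarrow> u j = v j) \<Longrightarrow> i < N \<Longrightarrow> K u i = K v i"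
  unfolding K_def using Wop_cong[of u v] by simp

lemma K_eq_T: "K u i = u i - node_mean N u - T u i"
  by (simp add: K_def T_def)

lemma sum_T: "(\<Sum>i<N. T u i) = 0"
  using node_mean_Wop[of u] N_pos sum_eq_node_mean[OF N_pos, of "Wop u"]
  by (simp add: T_def[abs_def] sum_subtractf sum_constant_scaleR)

lemma node_mean_T: "node_mean N (T u) = 0"
  by (simp add: node_mean_def sum_T)

lemma node_mean_K: "node_mean N (K u) = 0"
  unfolding K_def[abs_def] by (simp add: node_mean_diff node_mean_Wop)

lemma ip_T_const: "ip N (T u) (\<lambda>_. c) = 0"
  by (simp add: ip_const_right sum_T)

lemma ip_Wop: "ip N u (Wop v) = (\<Sum>i<N. \<Sum>j<N. w i j * inner (u i) (v j))"
  by (simp add: ip_def Wop_def inner_sum_right)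

lemma ip_Wop_sym: "ip N (Wop u) v = ip N u (Wop v)"
proof -
  have "ip N (Wop u) v = (\<Sum>i<N. \<Sum>j<N. w i j * inner (v i) (u j))"
    by (simp only: ip_commute[of N "Wop u"] ip_Wop)
  also have "\<dots> = (\<Sum>j<N. \<Sum>i<N. w i j * inner (v i) (u j))" by (rule sum.swap)
  also have "\<dots> = ip N u (Wop v)"
    unfolding ip_Wop by (intro sum.cong refl) (simp add: w_sym inner_commute)
  finally show ?thesis .
qed

lemma ip_mean_sym: "ip N (\<lambda>_. node_mean N u) v = ip N u (\<lambda>_. node_mean N v)"
proof -
  have "ip N (\<lambda>_. node_mean N u) v = inner (\<Sum>i<N. v i) (node_mean N u)"
    by (subst ip_commute) (simp only: ip_const_right)
  also have "\<dots> = inner (\<Sum>i<N. u i) (node_mean N v)"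
    unfolding sum_eq_node_mean[OF N_pos] by (simp add: inner_commute)
  finally show ?thesis by (simp add: ip_const_right)
qed

lemma ip_T_sym: "ip N (T u) v = ip N u (T v)"
  unfolding T_def[abs_def] by (simp add: ip_diff_left ip_diff_right ip_Wop_sym ip_mean_sym)

text \<open>Splitting into coordinates reduces stacks of vectors to the scalar quadratic forms that
  the locale assumes.\<close>

lemma ip_T_sum: "ip N u (T u) = (\<Sum>b\<in>Basis. \<Sum>i<N. \<Sum>j<N.
    (w i j - 1 / real N) * (inner (u i) b * inner (u j) b))"
proof -
  have "ip N u (\<lambda>_. node_mean N u) = (\<Sum>i<N. \<Sum>j<N. (1 / real N) * inner (u i) (u j))"
    by (simp add: ip_def node_mean_def inner_sum_right sum_divide_distrib)
  then have "ip N u (T u) = (\<Sum>i<N. \<Sum>j<N. (w i j - 1 / real N) * inner (u i) (u j))"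
    unfolding T_def[abs_def] ip_diff_right ip_Wop
    by (simp add: left_diff_distrib sum_subtractf)
  also have "\<dots> = (\<Sum>i<N. \<Sum>j<N. \<Sum>b\<in>Basis.
      (w i j - 1 / real N) * (inner (u i) b * inner (u j) b))"
    by (subst euclidean_inner) (simp add: sum_distrib_left)
  also have "\<dots> = (\<Sum>i<N. \<Sum>b\<in>Basis. \<Sum>j<N.
      (w i j - 1 / real N) * (inner (u i) b * inner (u j) b))"
    by (intro sum.cong refl sum.swap)
  also have "\<dots> = (\<Sum>b\<in>Basis. \<Sum>i<N. \<Sum>j<N.
      (w i j - 1 / real N) * (inner (u i) b * inner (u j) b))"
    by (rule sum.swap)
  finally show ?thesis .
qed

lemma ip_T_le: "ip N u (T u) \<le> lam * ip N u u"
proof -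
  have "ip N u (T u) \<le> (\<Sum>b\<in>Basis. lam * (\<Sum>i<N. (inner (u i) b)\<^sup>2))"
    unfolding ip_T_sum by (intro sum_mono w_gap)
  also have "\<dots> = lam * (\<Sum>i<N. \<Sum>b\<in>Basis. (inner (u i) b)\<^sup>2)"
    by (subst sum.swap) (simp add: sum_distrib_left)
  also have "\<dots> = lam * ip N u u"
    by (simp add: ip_def euclidean_inner[of "u _" "u _"] power2_eq_square)
  finally show ?thesis .
qed

lemma T_centered: "T (\<lambda>i. u i - c) i = T u i" if "i < N"
  using T_diff[of u "\<lambda>_. c" i] T_const[OF that, of c] by simp

text \<open>On centered stacks \<open>T\<close> coincides with \<open>W\<close>, whose form is
  nonnegative. Centering does not change the value, because \<open>T\<close> annihilates constants
  and has range of mean zero.\<close>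

lemma ip_T_nonneg: "0 \<le> ip N u (T u)"
proof -
  define v where "v i = u i - node_mean N u" for i
  have mean_v: "node_mean N v = 0"
    unfolding v_def[abs_def] using N_pos by (simp add: node_mean_diff node_mean_const)
  have "ip N v (T v) = ip N v (T u)"
    unfolding v_def[abs_def] by (intro ip_cong) (simp_all add: T_centered)
  also have "\<dots> = ip N u (T u)"
    unfolding v_def[abs_def] ip_diff_left
    by (subst (2) ip_commute) (simp add: ip_T_const)
  finally have eq: "ip N u (T u) = ip N v (T v)" ..
  have "T v = Wop v" by (simp add: T_def[abs_def] mean_v)
  then have "ip N v (T v) = (\<Sum>i<N. \<Sum>j<N. w i j * inner (v i) (v j))" by (simp add: ip_Wop)
  also have "\<dots> = (\<Sum>i<N. \<Sum>j<N. \<Sum>b\<in>Basis. w i j * (inner (v i) b * inner (v j) b))"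
    by (subst euclidean_inner) (simp add: sum_distrib_left)
  also have "\<dots> = (\<Sum>i<N. \<Sum>b\<in>Basis. \<Sum>j<N. w i j * (inner (v i) b * inner (v j) b))"
    by (intro sum.cong refl sum.swap)
  also have "\<dots> = (\<Sum>b\<in>Basis. \<Sum>i<N. \<Sum>j<N. w i j * (inner (v i) b * inner (v j) b))"
    by (rule sum.swap)
  finally show ?thesis unfolding eq by (simp add: sum_nonneg w_psd)
qed

text \<open>On the spectrum this is \<open>t\<^sup>2 \<le> lam * t\<close>; it follows from
  \<open>lam * (t * (lam - t)) = t * (lam - t) * t + (lam - t) * t * (lam - t)\<close>.\<close>

lemma ip_T_T_le: "ip N (T u) (T u) \<le> lam * ip N u (T u)"
proof (cases "lam = 0")
  case True
  then have zero: "ip N v (T v) = 0" for v :: "nat \<Rightarrow> 'a"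
    using ip_T_le[of v] ip_T_nonneg[of v] by simp
  have "ip N (\<lambda>i. u i + T u i) (T (\<lambda>i. u i + T u i)) = 0" by (rule zero)
  then have "ip N u (T u) + 2 * ip N (T u) (T u) + ip N (T u) (T (T u)) = 0"
    by (simp add: T_add[abs_def] ip_add_left ip_add_right ip_T_sym[of u "T u", symmetric])
  then show ?thesis using zero True by simp
next
  case False
  define v where "v i = lam *\<^sub>R u i - T u i" for i
  have Tv: "T v = (\<lambda>i. lam *\<^sub>R T u i - T (T u) i)"
    unfolding v_def[abs_def] by (simp add: T_diff T_scaleR fun_eq_iff)
  have "ip N v (T v) = lam\<^sup>2 * ip N u (T u) - 2 * lam * ip N (T u) (T u) + ip N (T u) (T (T u))"
    unfolding Tv unfolding v_def[abs_def] using ip_T_sym[of u "T u"]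
    by (simp add: ip_linear power2_eq_square algebra_simps)
  moreover have "0 \<le> ip N v (T v)" by (rule ip_T_nonneg)
  moreover have "ip N (T u) (T (T u)) \<le> lam * ip N (T u) (T u)" by (rule ip_T_le)
  ultimately have "0 \<le> lam * (lam * ip N u (T u) - ip N (T u) (T u))"
    by (simp add: power2_eq_square algebra_simps)
  then show ?thesis using False lam_nonneg by (simp add: zero_le_mult_iff)
qed

lemma ip_T_T_le': "ip N (T u) (T u) \<le> ip N u (T u)"
  using ip_T_T_le[of u] ip_T_nonneg[of u] lam_less mult_right_mono[of lam 1 "ip N u (T u)"] by simp

lemma ip_K: "ip N u (K u) = ip N (\<lambda>i. u i - node_mean N u) (\<lambda>i. u i - node_mean N u) - ip N u (T u)"
  by (subst sum_norm_squared_centered[OF N_pos]) (simp add: K_eq_T[abs_def] ip_diff_right)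

lemma ip_centered_T: "ip N (\<lambda>i. u i - c) (T u) = ip N u (T u)"
  unfolding ip_diff_left by (subst (2) ip_commute) (simp add: ip_T_const)

lemma ip_K_K: "ip N (K u) (K u) = ip N (\<lambda>i. u i - node_mean N u) (\<lambda>i. u i - node_mean N u)
    - 2 * ip N u (T u) + ip N (T u) (T u)"
proof -
  let ?v = "\<lambda>i. u i - node_mean N u"
  have "ip N (K u) (K u) = ip N ?v ?v - 2 * ip N ?v (T u) + ip N (T u) (T u)"
    unfolding K_eq_T[abs_def] ip_diff_left[of N ?v] ip_diff_right[of N _ ?v]
    by (simp add: ip_commute[of N "T u" ?v])
  then show ?thesis by (simp add: ip_centered_T)
qed

text \<open>The spectrum of \<open>K\<close> lies between 0 and 1. After centering, the claim is the
  same fact for \<open>T\<close>, namely \<open>ip_T_T_le'\<close>.\<close>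

lemma ip_K_K_le: "ip N (K u) (K u) \<le> ip N u (K u)"
  unfolding ip_K ip_K_K using ip_T_T_le'[of u] by simp

lemma ip_K_nonneg: "0 \<le> ip N u (K u)"
  using ip_K_K_le[of u] ip_self_nonneg[of N "K u"] by linarith

lemma ip_K_le: "ip N u (K u) \<le> ip N u u"
proof -
  have "ip N u (\<lambda>_. node_mean N u) = real N * inner (node_mean N u) (node_mean N u)"
    unfolding ip_const_right sum_eq_node_mean[OF N_pos] by simp
  then show ?thesis
    unfolding ip_K sum_norm_squared_centered[OF N_pos] using ip_T_nonneg[of u]
      mult_nonneg_nonneg[OF of_nat_0_le_iff[of N] inner_ge_zero[of "node_mean N u"]] by linarith
qed

lemma energy_nonneg: "0 \<le> energy p z"
  using ip_T_nonneg[of p] ip_K_nonneg[of z] by (simp add: energy_def)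

text \<open>This converts back: the energy dominates the consensus errors \<open>T p\<close> and
  \<open>K z\<close> that occur in the local iterates.\<close>

lemma energy_ge: "ip N (T p) (T p) + ip N (K z) (K z) \<le> energy p z"
  using ip_T_T_le'[of p] ip_K_K_le[of z] by (simp add: energy_def)

text \<open>The two \<open>T\<close> terms cancel, leaving the squared norm of the centered stack.
  This is the reason why noise, which is added to both coordinates alike, is charged with factor
  one.\<close>

lemma energy_diag: "energy n n \<le> ip N n n"
proof -
  have "ip N n (\<lambda>_. node_mean N n) = real N * inner (node_mean N n) (node_mean N n)"
    unfolding ip_const_right sum_eq_node_mean[OF N_pos] by simp
  then show ?thesis unfolding energy_def ip_K sum_norm_squared_centered[OF N_pos] by simp
qed

lemma ip_K_sym: "ip N (K u) v = ip N u (K v)"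
  unfolding K_def[abs_def] by (simp add: ip_diff_left ip_diff_right ip_Wop_sym)

text \<open>The polar form of \<open>energy\<close>, which carries the cross terms with the
  noise.\<close>

definition energy_form where
  "energy_form p z p' z' = ip N p (T p') + ip N z (K z')"

lemma energy_diff: "energy (\<lambda>i. p i - p' i) (\<lambda>i. z i - z' i)
    = energy p z - 2 * energy_form p z p' z' + energy p' z'"
proof -
  have "ip N p' (T p) = ip N p (T p')" using ip_T_sym[of p' p] by (simp add: ip_commute)
  moreover have "ip N z' (K z) = ip N z (K z')" using ip_K_sym[of z' z] by (simp add: ip_commute)
  ultimately show ?thesis
    unfolding energy_def energy_form_def T_diff[abs_def] K_diff[abs_def] by (simp add: ip_linear)
qed

lemma energy_scaleR: "energy (\<lambda>i. c *\<^sub>R p i) (\<lambda>i. c *\<^sub>R z i) = c\<^sup>2 * energy p z"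
  unfolding energy_def T_scaleR[abs_def] K_scaleR[abs_def]
  by (simp add: ip_linear power2_eq_square algebra_simps)

lemma energy_form_scaleR: "energy_form (\<lambda>i. c *\<^sub>R p i) (\<lambda>i. c *\<^sub>R z i) p' z' = c * energy_form p z p' z'"
  unfolding energy_form_def by (simp add: ip_linear algebra_simps)

text \<open>Young's inequality for the seminorm: nonnegativity at the pair scaled by
  \<open>- e\<close> minus the primed pair, divided by \<open>e\<close>.\<close>

lemma energy_diff_le:
  assumes "e > 0"
  shows "energy (\<lambda>i. p i - p' i) (\<lambda>i. z i - z' i) \<le> (1 + e) * energy p z + (1 + 1 / e) * energy p' z'"
proof -
  have "0 \<le> energy (\<lambda>i. (- e) *\<^sub>R p i - p' i) (\<lambda>i. (- e) *\<^sub>R z i - z' i)" by (rule energy_nonneg)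
  then have "0 \<le> e\<^sup>2 * energy p z + 2 * e * energy_form p z p' z' + energy p' z'"
    unfolding energy_diff energy_scaleR energy_form_scaleR by simp
  then have "0 \<le> (e\<^sup>2 * energy p z + 2 * e * energy_form p z p' z' + energy p' z') / e"
    using assms by simp
  also have "\<dots> = e * energy p z + 2 * energy_form p z p' z' + 1 / e * energy p' z'"
    using assms by (simp add: add_divide_distrib power2_eq_square)
  finally show ?thesis unfolding energy_diff by (simp add: algebra_simps)
qed

text \<open>The average gradient moves all nodes by the same vector; this is how it drops out of the
  consensus recursion.\<close>

lemma energy_shift: "energy (\<lambda>i. p i + c) (\<lambda>i. z i + c') = energy p z"
proof -
  have 1: "ip N (\<lambda>i. p i + c) (T (\<lambda>i. p i + c)) = ip N (\<lambda>i. p i + c) (T p)"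
    by (intro ip_cong) (simp_all add: T_add T_const)
  have 2: "ip N (\<lambda>i. z i + c') (K (\<lambda>i. z i + c')) = ip N (\<lambda>i. z i + c') (K z)"
    by (intro ip_cong) (simp_all add: K_add K_const)
  have "(\<Sum>i<N. K z i) = 0"
    using node_mean_K[of z] N_pos by (simp add: node_mean_def)
  then have 3: "ip N (\<lambda>_. c') (K z) = 0" by (subst ip_commute) (simp add: ip_const_right)
  have 4: "ip N (\<lambda>_. c) (T p) = 0" by (subst ip_commute) (simp add: ip_T_const)
  show ?thesis unfolding energy_def 1 2 by (simp add: ip_add_left 3 4)
qed

lemma energy_cong:
  assumes "\<And>i. i < N \<Longrightarrow> p i = p' i" "\<And>i. i < N \<Longrightarrow> z i = z' i"
  shows "energy p z = energy p' z'"
  unfolding energy_def using assms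
  by (intro arg_cong2[where f = "(+)"] ip_cong T_cong K_cong) auto

text \<open>On the eigenspace of an eigenvalue \<open>w\<close> the mixing step is, up to a scaling of the coordinates,
  \<open>sqrt w\<close> times a rotation; \<open>energy\<close> is the quadratic form that it multiplies by exactly \<open>w\<close>.\<close>

lemma energy_contraction:
  "energy (\<lambda>i. T p i - K z i) (\<lambda>i. z i + (T p i - K z i)) \<le> lam * energy p z"
proof -
  \<comment> \<open>Up to constants, both updated coordinates depend only on \<open>T s\<close> and
    \<open>z\<close>: they are \<open>T s - z\<close> and \<open>T s\<close>.\<close>
  define s where "s i = p i + z i" for i
  define m where "m = node_mean N z"
  have Ts: "T s i = T p i + T z i" for i unfolding s_def[abs_def] by (rule T_add)
  have d: "T p i - K z i = (T s i - z i) + m" for i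
    by (simp add: Ts K_eq_T m_def)
  have z': "z i + ((T s i - z i) + m) = T s i + m" for i by simp
  have mean_Ts: "node_mean N (T s) = 0" by (rule node_mean_T)
  have "energy (\<lambda>i. T p i - K z i) (\<lambda>i. z i + (T p i - K z i))
      = energy (\<lambda>i. (T s i - z i) + m) (\<lambda>i. T s i + m)" by (simp only: d z')
  also have "\<dots> = energy (\<lambda>i. T s i - z i) (T s)" by (rule energy_shift)
  also have "\<dots> = ip N (\<lambda>i. T s i - z i) (\<lambda>i. T (T s) i - T z i)
      + ip N (T s) (\<lambda>i. T s i - T (T s) i)"
    unfolding energy_def T_diff[abs_def] K_eq_T[abs_def] mean_Ts by simp
  also have "\<dots> = ip N (T s) (T s) - 2 * ip N (T s) (T z) + ip N z (T z)"
    using ip_T_sym[of z "T s"] by (simp add: ip_linear ip_commute[of N "T z" "T s"])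
  also have "\<dots> = ip N (T p) (T p) + ip N z (T z) - ip N (T z) (T z)"
    unfolding Ts[abs_def] by (simp add: ip_linear ip_commute[of N "T z" "T p"])
  finally have eq: "energy (\<lambda>i. T p i - K z i) (\<lambda>i. z i + (T p i - K z i))
    = ip N (T p) (T p) + ip N z (T z) - ip N (T z) (T z)" .
  define v where "v i = z i - m" for i
  have vT: "ip N v (T z) = ip N z (T z)" unfolding v_def[abs_def] by (rule ip_centered_T)
  have Tv: "T v i = T z i" if "i < N" for i unfolding v_def[abs_def] by (rule T_centered[OF that])
  have "ip N v (T v) = ip N v (T z)" by (intro ip_cong) (simp_all add: Tv)
  then have le: "ip N z (T z) \<le> lam * ip N v v" using ip_T_le[of v] vT by simp
  \<comment> \<open>For an eigenvalue \<open>t\<close> the remaining claim is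
    \<open>0 \<le> (lam - t) * (1 - t)\<close>, and this product equals
    \<open>(lam - t)\<^sup>2 + (1 - lam) * (lam - t)\<close>. The two summands are supplied here and
    in the next fact.\<close>
  have "0 \<le> ip N (\<lambda>i. T z i - lam *\<^sub>R v i) (\<lambda>i. T z i - lam *\<^sub>R v i)" by simp
  then have "0 \<le> ip N (T z) (T z) - 2 * lam * ip N z (T z) + lam * lam * ip N v v"
    by (simp add: ip_linear ip_commute[of N "T z" v] vT algebra_simps)
  moreover have "0 \<le> (1 - lam) * (lam * ip N v v - ip N z (T z))"
    using le lam_less by simp
  ultimately have "ip N z (T z) - ip N (T z) (T z) \<le> lam * (ip N v v - ip N z (T z))"
    by (simp add: algebra_simps)
  also have "ip N v v - ip N z (T z) = ip N z (K z)"
    unfolding ip_K v_def[abs_def] m_def ..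
  finally show ?thesis unfolding eq using ip_T_T_le[of p]
    by (simp add: energy_def distrib_left)
qed

end

section \<open>Weight matrices\<close>

text \<open>An injective square matrix has nonzero determinant. Applied to \<open>W\<close> itself
  and to \<open>I - W + J\<close>, in both cases over the reals, so that the inverse acts on vectors
  coordinatewise.\<close>

lemma right_inverse_of_injective:
  fixes m :: "nat \<Rightarrow> nat \<Rightarrow> real"
  assumes inj: "\<And>c. (\<And>i. i < N \<Longrightarrow> (\<Sum>j<N. m i j * c j) = 0) \<Longrightarrow> \<forall>j<N. c j = 0"
  obtains b where "\<And>i k. i < N \<Longrightarrow> k < N \<Longrightarrow> (\<Sum>j<N. m i j * b j k) = (if i = k then 1 else 0)"
proof -
  define A where "A = mat N N (\<lambda>(i, j). m i j)"
  have A: "A \<in> carrier_mat N N" by (simp add: A_def)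
  have entry: "(A *\<^sub>v v) $ i = (\<Sum>j<N. m i j * v $ j)" if "i < N" "v \<in> carrier_vec N" for i v
    using that by (simp add: A_def scalar_prod_def atLeast0LessThan)
  have "v = 0\<^sub>v N" if v: "v \<in> carrier_vec N" "A *\<^sub>v v = 0\<^sub>v N" for v
  proof -
    have "\<forall>j<N. v $ j = 0" by (rule inj) (use v entry[OF _ v(1)] in auto)
    then show ?thesis using v(1) by (intro eq_vecI) auto
  qed
  then have "det A \<noteq> 0" using det_0_iff_vec_prod_zero[OF A] by blast
  from det_non_zero_imp_unit[OF A this, of "()"] obtain B
    where B: "B \<in> carrier_mat N N" and AB: "A * B = 1\<^sub>m N"
    unfolding Units_def ring_mat_def by auto
  show thesis
  proof (rule that[of "\<lambda>j k. B $$ (j, k)"])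
    fix i k assume "i < N" "k < N"
    then have "(A * B) $$ (i, k) = (\<Sum>j<N. m i j * B $$ (j, k))"
      using A B by (simp add: A_def scalar_prod_def atLeast0LessThan)
    then show "(\<Sum>j<N. m i j * B $$ (j, k)) = (if i = k then 1 else 0)"
      using AB \<open>i < N\<close> \<open>k < N\<close> by simp
  qed
qed

section \<open>Spectral norm and mixing rate\<close>

lemma vec_norm2_eq: "v \<in> carrier_vec n \<Longrightarrow> vec_norm2 v = L2_set (\<lambda>i. v $ i) {..<n}"
  by (simp add: vec_norm2_def L2_set_def scalar_prod_def power2_eq_square atLeast0LessThan)

lemma mult_mat_vec_le_spectral_norm:
  assumes A: "A \<in> carrier_mat n n" and v: "v \<in> carrier_vec n"
  shows "vec_norm2 (A *\<^sub>v v) \<le> spectral_norm A * vec_norm2 v"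
proof -
  let ?X = "{vec_norm2 (A *\<^sub>v v) | v. v \<in> carrier_vec n \<and> vec_norm2 v \<le> 1}"
  have sn: "spectral_norm A = Sup ?X" using A by (simp add: spectral_norm_def)
  have entry: "(A *\<^sub>v u) $ i = (\<Sum>j<n. A $$ (i, j) * u $ j)" if "i < n" "u \<in> carrier_vec n" for i u
    using that A by (simp add: scalar_prod_def atLeast0LessThan)
  \<comment> \<open>A real supremum bounds its set only if the set is bounded. On the unit ball
    every coordinate is at most 1 in absolute value, so the sum of all absolute entries is a crude
    bound.\<close>
  have bdd: "bdd_above ?X"
  proof (rule bdd_aboveI[of _ "\<Sum>i<n. \<Sum>j<n. \<bar>A $$ (i, j)\<bar>"], clarify)
    fix u assume u: "u \<in> carrier_vec n" "vec_norm2 u \<le> 1"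
    have le1: "\<bar>u $ j\<bar> \<le> 1" if "j < n" for j
    proof -
      have "\<bar>u $ j\<bar> \<le> L2_set (\<lambda>i. \<bar>u $ i\<bar>) {..<n}"
        by (rule member_le_L2_set) (use that in auto)
      also have "\<dots> = vec_norm2 u" using u(1) by (simp add: vec_norm2_eq L2_set_def)
      finally show ?thesis using u(2) by linarith
    qed
    have "vec_norm2 (A *\<^sub>v u) = L2_set (\<lambda>i. (A *\<^sub>v u) $ i) {..<n}"
      using A u by (intro vec_norm2_eq) simp
    also have "\<dots> \<le> (\<Sum>i<n. \<bar>(A *\<^sub>v u) $ i\<bar>)" by (rule L2_set_le_sum_abs)
    also have "\<dots> \<le> (\<Sum>i<n. \<Sum>j<n. \<bar>A $$ (i, j)\<bar>)"
    proof (rule sum_mono)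
      fix i assume "i \<in> {..<n}"
      then have "\<bar>(A *\<^sub>v u) $ i\<bar> \<le> (\<Sum>j<n. \<bar>A $$ (i, j) * u $ j\<bar>)"
        using entry u(1) by (simp add: sum_abs)
      also have "\<dots> \<le> (\<Sum>j<n. \<bar>A $$ (i, j)\<bar>)"
        by (intro sum_mono) (use le1 in \<open>auto simp: abs_mult intro: mult_left_le\<close>)
      finally show "\<bar>(A *\<^sub>v u) $ i\<bar> \<le> (\<Sum>j<n. \<bar>A $$ (i, j)\<bar>)" .
    qed
    finally show "vec_norm2 (A *\<^sub>v u) \<le> (\<Sum>i<n. \<Sum>j<n. \<bar>A $$ (i, j)\<bar>)" .
  qed
  show ?thesis
  proof (cases "vec_norm2 v = 0")
    case True
    then have "\<forall>i<n. v $ i = 0" using v by (simp add: vec_norm2_eq L2_set_eq_0_iff)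
    then have "vec_norm2 (A *\<^sub>v v) = L2_set (\<lambda>i. 0) {..<n}"
      using A v by (subst vec_norm2_eq[of _ n]) (auto intro!: L2_set_cong simp: entry simp del: index_mult_mat_vec)
    then show ?thesis using True by (simp add: L2_set_def)
  next
    case False
    define s where "s = vec_norm2 v"
    have s: "s > 0" using False v by (simp add: s_def vec_norm2_eq order.strict_iff_order)
    define u where "u = (1 / s) \<cdot>\<^sub>v v"
    have u: "u \<in> carrier_vec n" using v by (simp add: u_def)
    have "vec_norm2 u = L2_set (\<lambda>i. (1 / s) * v $ i) {..<n}"
      using u v by (subst vec_norm2_eq[of _ n]) (auto intro!: L2_set_cong simp: u_def)
    also have "\<dots> = (1 / s) * L2_set (\<lambda>i. v $ i) {..<n}"
      using s by (intro L2_set_right_distrib[symmetric]) simp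
    also have "L2_set (\<lambda>i. v $ i) {..<n} = s" using v by (simp add: s_def vec_norm2_eq)
    finally have "vec_norm2 u = 1" using s by simp
    then have "vec_norm2 (A *\<^sub>v u) \<le> spectral_norm A"
      unfolding sn by (intro cSup_upper bdd) (use u in auto)
    moreover have "vec_norm2 (A *\<^sub>v u) = (1 / s) * vec_norm2 (A *\<^sub>v v)"
    proof -
      have "vec_norm2 (A *\<^sub>v u) = L2_set (\<lambda>i. (1 / s) * (A *\<^sub>v v) $ i) {..<n}"
        using u v A by (subst vec_norm2_eq[of _ n])
          (auto intro!: L2_set_cong simp: entry u_def sum_divide_distrib mult_ac simp del: index_mult_mat_vec)
      also have "\<dots> = (1 / s) * L2_set (\<lambda>i. (A *\<^sub>v v) $ i) {..<n}"
        using s by (intro L2_set_right_distrib[symmetric]) simp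
      also have "L2_set (\<lambda>i. (A *\<^sub>v v) $ i) {..<n} = vec_norm2 (A *\<^sub>v v)"
        using A v by (intro vec_norm2_eq[symmetric] mult_mat_vec_carrier)
      finally show ?thesis .
    qed
    ultimately show ?thesis using s by (simp add: s_def field_simps)
  qed
qed

lemma mixing_rate_nonneg: "0 \<le> mixing_rate N W"
proof -
  let ?A = "W - mat N N (\<lambda>_. 1 / real N)"
  have "0 \<le> vec_norm2 (?A *\<^sub>v unit_vec N 0)" by (simp add: vec_norm2_def scalar_prod_def sum_nonneg)
  show ?thesis
  proof (cases "N = 0")
    case False
    have A: "?A \<in> carrier_mat N N" by (intro minus_carrier_mat) simp
    have "vec_norm2 (unit_vec N 0) = 1" using False by (simp add: vec_norm2_def)
    then show ?thesis
      using mult_mat_vec_le_spectral_norm[OF _ unit_vec_carrier[of N 0], of ?A]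
        \<open>0 \<le> vec_norm2 _\<close> A by (simp add: mixing_rate_def)
  next
    \<comment> \<open>With no nodes only the empty vector remains, and the supremum is taken over
      \<open>{0}\<close>.\<close>
    case True
    have "{vec_norm2 (?A *\<^sub>v v) | v. v \<in> carrier_vec (dim_col ?A) \<and> vec_norm2 v \<le> 1} = {0}"
      using True by (auto simp: vec_norm2_def scalar_prod_def intro!: exI[of _ "0\<^sub>v 0"])
    then show ?thesis by (simp add: mixing_rate_def spectral_norm_def)
  qed
qed

lemma network_assumption_strictly_positive:
  assumes "network_assumption N nb W" and "i < N" "c i \<noteq> 0"
  shows "0 < (\<Sum>i<N. \<Sum>j<N. W $$ (i, j) * (c i * c j))"
proof -
  have W: "W \<in> carrier_mat N N" and pd: "pos_definite_mat N W"
    using assms(1) by (auto simp: network_assumption_def)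
  let ?v = "vec N c"
  have "?v \<noteq> 0\<^sub>v N" using assms(2,3) by (metis index_vec index_zero_vec(1))
  then have "0 < scalar_prod ?v (W *\<^sub>v ?v)"
    using pd by (simp add: pos_definite_mat_def)
  also have "scalar_prod ?v (W *\<^sub>v ?v) = (\<Sum>i<N. \<Sum>j<N. W $$ (i, j) * (c i * c j))"
    using W by (simp add: scalar_prod_def atLeast0LessThan sum_distrib_left mult_ac)
  finally show ?thesis .
qed

text \<open>By Cauchy-Schwarz, the operator bound for \<open>W - J\<close> becomes a bound for its
  quadratic form, which is the shape in which the locale uses the mixing rate.\<close>

lemma gossip_of_network_assumption:
  assumes "network_assumption N nb W"
  shows "gossip N (\<lambda>i j. W $$ (i, j)) (mixing_rate N W)"
proof -
  have W: "W \<in> carrier_mat N N" and sym: "symmetric_mat W" and ds: "doubly_stochastic_mat N W"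
    and lam: "mixing_rate N W < 1" and N: "N \<ge> 1"
    using assms by (auto simp: network_assumption_def)
  have w_sym: "W $$ (i, j) = W $$ (j, i)" if "i < N" "j < N" for i j
    using sym W that unfolding symmetric_mat_def
    by (metis carrier_matD(1) carrier_matD(2) index_transpose_mat(1))
  have w_row: "(\<Sum>j<N. W $$ (i, j)) = 1" if "i < N" for i
    by (rule ds[unfolded doubly_stochastic_mat_def, THEN conjunct2, THEN conjunct1, rule_format, OF that])
  have w_psd: "0 \<le> (\<Sum>i<N. \<Sum>j<N. W $$ (i, j) * (c i * c j))" for c
  proof (cases "\<exists>i<N. c i \<noteq> 0")
    case True
    then show ?thesis using network_assumption_strictly_positive[OF assms, of _ c] by (auto intro: less_imp_le)
  qed simp
  have w_gap: "(\<Sum>i<N. \<Sum>j<N. (W $$ (i, j) - 1 / real N) * (c i * c j)) \<le> mixing_rate N W * (\<Sum>i<N. (c i)\<^sup>2)" for c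
  proof -
    define A where "A = W - mat N N (\<lambda>_. 1 / real N)"
    have A: "A \<in> carrier_mat N N" unfolding A_def by (intro minus_carrier_mat) simp
    let ?v = "vec N c"
    have "(\<Sum>i<N. \<Sum>j<N. (W $$ (i, j) - 1 / real N) * (c i * c j))
        = (\<Sum>i<N. c i * (A *\<^sub>v ?v) $ i)"
      using W by (simp add: A_def scalar_prod_def atLeast0LessThan sum_distrib_left mult_ac)
    also have "\<dots> \<le> (\<Sum>i<N. \<bar>c i\<bar> * \<bar>(A *\<^sub>v ?v) $ i\<bar>)"
      by (intro sum_mono) (metis abs_ge_self abs_mult)
    also have "\<dots> \<le> L2_set c {..<N} * L2_set (\<lambda>i. (A *\<^sub>v ?v) $ i) {..<N}"
      by (rule L2_set_mult_ineq)
    also have "L2_set (\<lambda>i. (A *\<^sub>v ?v) $ i) {..<N} = vec_norm2 (A *\<^sub>v ?v)"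
      using A by (intro vec_norm2_eq[symmetric]) simp
    also have "L2_set c {..<N} * vec_norm2 (A *\<^sub>v ?v) \<le> L2_set c {..<N} * (spectral_norm A * vec_norm2 ?v)"
      by (intro mult_left_mono mult_mat_vec_le_spectral_norm[OF A]) auto
    also have "vec_norm2 ?v = L2_set c {..<N}"
      by (subst vec_norm2_eq[of _ N]) (auto intro!: L2_set_cong)
    also have "L2_set c {..<N} * (spectral_norm A * L2_set c {..<N})
        = mixing_rate N W * (L2_set c {..<N})\<^sup>2"
      by (simp add: mixing_rate_def A_def power2_eq_square)
    also have "(L2_set c {..<N})\<^sup>2 = (\<Sum>i<N. (c i)\<^sup>2)"
      by (simp add: L2_set_def sum_nonneg)
    finally show ?thesis .
  qed
  show ?thesis
    by (rule gossip.intro) (fact N w_sym w_row w_psd w_gap mixing_rate_nonneg lam)+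
qed

lemma mix_eq_sum:
  assumes "network_assumption N nb W" "i < N"
  shows "mix nb W u i = (\<Sum>j<N. W $$ (i, j) *\<^sub>R u j)"
proof -
  have "nb i \<subseteq> {..<N}" "\<And>j. j < N \<Longrightarrow> j \<notin> nb i \<Longrightarrow> W $$ (i, j) = 0"
    using assms by (auto simp: network_assumption_def)
  then show ?thesis unfolding mix_def by (intro sum.mono_neutral_left) auto
qed

section \<open>Linear systems with the weight matrix\<close>

definition mat_op :: "nat \<Rightarrow> (nat \<Rightarrow> nat \<Rightarrow> real) \<Rightarrow> (nat \<Rightarrow> 'a::real_vector) \<Rightarrow> nat \<Rightarrow> 'a" where
  "mat_op N b u i = (\<Sum>j<N. b i j *\<^sub>R u j)"

lemma mat_op_compose:
  "(\<Sum>j<N. m j *\<^sub>R mat_op N b u j) = (\<Sum>k<N. (\<Sum>j<N. m j * b j k) *\<^sub>R u k)"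
proof -
  have "(\<Sum>j<N. m j *\<^sub>R mat_op N b u j) = (\<Sum>j<N. \<Sum>k<N. (m j * b j k) *\<^sub>R u k)"
    by (simp add: mat_op_def scaleR_sum_right)
  also have "\<dots> = (\<Sum>k<N. \<Sum>j<N. (m j * b j k) *\<^sub>R u k)" by (rule sum.swap)
  finally show ?thesis by (simp add: scaleR_sum_left)
qed

lemma mat_op_diff: "mat_op N b (\<lambda>i. u i - v i) i = mat_op N b u i - mat_op N b v i"
  by (simp add: mat_op_def sum_subtractf scaleR_diff_right)

text \<open>The Frobenius norm dominates the operator norm. Applied to the inverse of
  \<open>K\<close>, its square is the \<kappa> of the recursions.\<close>

lemma mat_op_bounded:
  fixes u :: "nat \<Rightarrow> 'a::real_inner"
  shows "ip N (mat_op N b u) (mat_op N b u) \<le> (\<Sum>i<N. \<Sum>j<N. (b i j)\<^sup>2) * ip N u u"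
proof -
  have "(norm (mat_op N b u i))\<^sup>2 \<le> (\<Sum>j<N. (b i j)\<^sup>2) * ip N u u" for i
  proof -
    have "norm (mat_op N b u i) \<le> (\<Sum>j<N. \<bar>b i j\<bar> * norm (u j))"
      unfolding mat_op_def by (rule order_trans[OF norm_sum]) simp
    then have "(norm (mat_op N b u i))\<^sup>2 \<le> (\<Sum>j<N. \<bar>b i j\<bar> * norm (u j))\<^sup>2"
      by (intro power_mono) auto
    also have "\<dots> \<le> (\<Sum>j<N. \<bar>b i j\<bar>\<^sup>2) * (\<Sum>j<N. (norm (u j))\<^sup>2)"
      by (rule Cauchy_Schwarz_ineq_sum)
    finally show ?thesis by (simp add: ip_self)
  qed
  then have "(\<Sum>i<N. (norm (mat_op N b u i))\<^sup>2) \<le> (\<Sum>i<N. (\<Sum>j<N. (b i j)\<^sup>2) * ip N u u)"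
    by (intro sum_mono)
  then show ?thesis by (simp add: ip_self[of N "mat_op N b u"] sum_distrib_right)
qed

text \<open>Positive definiteness makes \<open>W\<close> injective. An arbitrary start
  \<open>x0\<close> can therefore be seen as the mixture of fictitious local iterates, so that round
  0 has the same form as every later round.\<close>

lemma network_assumption_mix_surj:
  assumes net: "network_assumption N nb W"
  obtains u :: "nat \<Rightarrow> 'a::euclidean_space" where "\<And>i. i < N \<Longrightarrow> mix nb W u i = v i"
proof -
  have inj: "\<forall>j<N. c j = 0" if c: "\<And>i. i < N \<Longrightarrow> (\<Sum>j<N. W $$ (i, j) * c j) = 0" for c
  proof (rule ccontr)
    assume "\<not> (\<forall>j<N. c j = 0)"
    then have "0 < (\<Sum>i<N. \<Sum>j<N. W $$ (i, j) * (c i * c j))"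
      using network_assumption_strictly_positive[OF net] by blast
    also have "\<dots> = (\<Sum>i<N. c i * (\<Sum>j<N. W $$ (i, j) * c j))"
      by (simp add: sum_distrib_left mult_ac)
    also have "\<dots> = 0" using c by simp
    finally show False by simp
  qed
  obtain b where b: "\<And>i k. i < N \<Longrightarrow> k < N \<Longrightarrow> (\<Sum>j<N. W $$ (i, j) * b j k) = (if i = k then 1 else 0)"
    using right_inverse_of_injective[where m = "\<lambda>i j. W $$ (i, j)", OF inj] by blast
  show thesis
  proof (rule that[of "mat_op N b v"])
    fix i assume i: "i < N"
    have "mix nb W (mat_op N b v) i = (\<Sum>k<N. (if i = k then 1 else 0) *\<^sub>R v k)"
      unfolding mix_eq_sum[OF net i] mat_op_compose by (intro sum.cong refl) (simp add: b i)
    then show "mix nb W (mat_op N b v) i = v i"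
      using i by (simp add: if_distrib[of "\<lambda>x. x *\<^sub>R _"] cong: if_cong)
  qed
qed

text \<open>\<open>K\<close> annihilates constants, so \<open>K + J\<close> is inverted instead. A
  null vector \<open>c\<close> of it satisfies \<open>T c = c\<close>, which forces
  \<open>c = 0\<close> because \<open>lam < 1\<close>. For a right-hand side of mean zero the
  solution has mean zero too, and \<open>J\<close> disappears.\<close>

lemma (in gossip) K_right_inverse:
  obtains b :: "nat \<Rightarrow> nat \<Rightarrow> real"
  where "\<And>(h :: nat \<Rightarrow> 'a::euclidean_space) i. node_mean N h = 0 \<Longrightarrow> i < N \<Longrightarrow> K (mat_op N b h) i = h i"
proof -
  define m where "m i j = (if i = j then 1 else 0) - w i j + 1 / real N" for i j
  have m_sum: "(\<Sum>j<N. m i j *\<^sub>R u j) = u i - Wop u i + node_mean N u" if "i < N"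
    for i and u :: "nat \<Rightarrow> 'b::euclidean_space"
    using that by (simp add: m_def Wop_def node_mean_def scaleR_add_left scaleR_diff_left sum.distrib
        sum_subtractf scaleR_sum_right if_distrib[of "\<lambda>x. x *\<^sub>R _"] cong: if_cong)
  have inj: "\<forall>j<N. c j = 0" if c: "\<And>i. i < N \<Longrightarrow> (\<Sum>j<N. m i j * c j) = 0" for c
  proof -
    have "T c i = c i" if "i < N" for i
      using m_sum[OF that, of c] c[OF that] by (simp add: T_def)
    then have "ip N c (T c) = ip N c c" by (intro ip_cong) auto
    with ip_T_le[of c] have "(1 - lam) * ip N c c \<le> 0" by (simp add: algebra_simps)
    then have "ip N c c \<le> 0" using lam_less by (simp add: mult_le_0_iff)
    then have "(\<Sum>i<N. (norm (c i))\<^sup>2) = 0" using ip_self_nonneg[of N c] by (simp add: ip_self)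
    then show ?thesis by (simp add: sum_nonneg_eq_0_iff)
  qed
  obtain b where b: "\<And>i k. i < N \<Longrightarrow> k < N \<Longrightarrow> (\<Sum>j<N. m i j * b j k) = (if i = k then 1 else 0)"
    using right_inverse_of_injective[where m = m, OF inj] by blast
  show thesis
  proof (rule that[of b])
    fix h :: "nat \<Rightarrow> 'a" and i assume h: "node_mean N h = 0" and i: "i < N"
    let ?u = "mat_op N b h"
    have eq: "?u i - Wop ?u i + node_mean N ?u = h i" if "i < N" for i
    proof -
      have "(\<Sum>j<N. m i j *\<^sub>R ?u j) = (\<Sum>k<N. (if i = k then 1 else 0) *\<^sub>R h k)"
        unfolding mat_op_compose by (intro sum.cong refl) (simp add: b that)
      also have "\<dots> = h i" using that by (simp add: if_distrib[of "\<lambda>x. x *\<^sub>R _"] cong: if_cong)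
      finally show ?thesis using m_sum[OF that, of ?u] by simp
    qed
    have "node_mean N h = node_mean N (\<lambda>i. ?u i - Wop ?u i + node_mean N ?u)"
      by (intro node_mean_cong) (simp add: eq)
    also have "\<dots> = node_mean N ?u - node_mean N (Wop ?u) + node_mean N ?u"
      unfolding node_mean_add node_mean_diff node_mean_const[OF N_pos] ..
    finally have "node_mean N ?u = 0" using h by (simp add: node_mean_Wop)
    then show "K ?u i = h i" using eq[OF i] by (simp add: K_def)
  qed
qed

section \<open>One communication round\<close>

lemma norm_add2_squared_le:
  fixes u v :: "'a::real_inner"
  shows "(norm (u + v))\<^sup>2 \<le> 2 * (norm u)\<^sup>2 + 2 * (norm v)\<^sup>2"
proof -
  have "0 \<le> (norm (u - v))\<^sup>2" by simp
  then show ?thesis unfolding power2_norm_eq_inner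
    by (simp add: inner_add_left inner_add_right inner_diff_left inner_diff_right inner_commute)
qed

lemma norm_diff2_squared_le:
  fixes u v :: "'a::real_inner"
  shows "(norm (u - v))\<^sup>2 \<le> 2 * (norm u)\<^sup>2 + 2 * (norm v)\<^sup>2"
  using norm_add2_squared_le[of u "- v"] by simp

lemma norm_sum5_squared_le:
  fixes a b c d e :: "'a::real_normed_vector"
  assumes "(norm a)\<^sup>2 \<le> A" "(norm b)\<^sup>2 \<le> B" "(norm c)\<^sup>2 \<le> C" "(norm d)\<^sup>2 \<le> D" "(norm e)\<^sup>2 \<le> E"
  shows "(norm (a - b - c - d - e))\<^sup>2 \<le> 5 * (A + B + C + D + E)"
proof -
  have sq: "(p + q + r + s + t)\<^sup>2 \<le> 5 * (p\<^sup>2 + q\<^sup>2 + r\<^sup>2 + s\<^sup>2 + t\<^sup>2)" for p q r s t :: real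
  proof -
    have "0 \<le> (p - q)\<^sup>2 + (p - r)\<^sup>2 + (p - s)\<^sup>2 + (p - t)\<^sup>2 + (q - r)\<^sup>2 + (q - s)\<^sup>2 + (q - t)\<^sup>2
      + (r - s)\<^sup>2 + (r - t)\<^sup>2 + (s - t)\<^sup>2" by simp
    then show ?thesis by (simp add: power2_eq_square algebra_simps)
  qed
  have "norm (a - b - c - d - e) \<le> norm a + norm b + norm c + norm d + norm e"
    using norm_triangle_ineq4[of "a - b - c - d" e] norm_triangle_ineq4[of "a - b - c" d]
      norm_triangle_ineq4[of "a - b" c] norm_triangle_ineq4[of a b] by linarith
  then have "(norm (a - b - c - d - e))\<^sup>2 \<le> (norm a + norm b + norm c + norm d + norm e)\<^sup>2"
    by (intro power_mono) auto
  also note sq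
  also have "5 * ((norm a)\<^sup>2 + (norm b)\<^sup>2 + (norm c)\<^sup>2 + (norm d)\<^sup>2 + (norm e)\<^sup>2)
      \<le> 5 * (A + B + C + D + E)"
    by (intro mult_left_mono add_mono assms) simp
  finally show ?thesis .
qed

section \<open>The average cost and the deviations of local gradients\<close>

locale led_costs = gossip N w lam for N w lam +
  fixes f :: "nat \<Rightarrow> 'a::euclidean_space \<Rightarrow> real" and L \<mu> :: real and xs :: 'a
  assumes L_pos: "L > 0" and mu_nonneg: "0 \<le> \<mu>" and mu_le: "\<mu> \<le> L"
    and diff: "\<And>i v. i < N \<Longrightarrow> f i differentiable (at v)"
    and lip: "\<And>i u v. i < N \<Longrightarrow> norm (gradient (f i) u - gradient (f i) v) \<le> L * norm (u - v)"
    and sc: "\<And>i. i < N \<Longrightarrow> strongly_convex \<mu> (f i)"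
    and xs_min: "is_minimizer (avg_fun N f) xs"
begin

definition gap :: "'a \<Rightarrow> real" where
  "gap v = avg_fun N f v - avg_fun N f xs"

definition gbar :: "'a \<Rightarrow> 'a" where
  "gbar v = node_mean N (\<lambda>i. gradient (f i) v)"

definition dev :: "'a \<Rightarrow> nat \<Rightarrow> 'a" where
  "dev v i = gradient (f i) v - gbar v"

lemma gap_nonneg: "0 \<le> gap v"
  using xs_min by (simp add: gap_def is_minimizer_def)

lemma avg_fun_upper_bound:
  "avg_fun N f y \<le> avg_fun N f x + inner (gbar x) (y - x) + L / 2 * (norm (y - x))\<^sup>2"
proof -
  have "(\<Sum>i<N. f i y) \<le> (\<Sum>i<N. f i x + inner (gradient (f i) x) (y - x) + L / 2 * (norm (y - x))\<^sup>2)"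
    by (intro sum_mono smooth_upper_bound) (auto simp: diff lip)
  also have "\<dots> = (\<Sum>i<N. f i x) + inner (\<Sum>i<N. gradient (f i) x) (y - x)
      + real N * (L / 2 * (norm (y - x))\<^sup>2)"
    by (simp add: sum.distrib inner_sum_left)
  finally have "(\<Sum>i<N. f i y) / real N \<le> ((\<Sum>i<N. f i x) + inner (\<Sum>i<N. gradient (f i) x) (y - x)
      + real N * (L / 2 * (norm (y - x))\<^sup>2)) / real N"
    using N_pos by (intro divide_right_mono) auto
  then show ?thesis using N_pos by (simp add: avg_fun_def gbar_def node_mean_def add_divide_distrib)
qed

lemma gbar_le: "(norm (gbar v))\<^sup>2 \<le> 2 * L * gap v"
  unfolding gap_def by (rule gradient_norm_le_gap[OF avg_fun_upper_bound xs_min L_pos])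

lemma gbar_xs: "gbar xs = 0"
  using gbar_le[of xs] by (simp add: gap_def)

lemma gap_le: "gap v \<le> L / 2 * (norm (v - xs))\<^sup>2"
  using avg_fun_upper_bound[of v xs] by (simp add: gap_def gbar_xs)

lemma node_mean_dev: "node_mean N (dev v) = 0"
  unfolding dev_def[abs_def] using N_pos
  by (simp add: node_mean_diff node_mean_const gbar_def)

text \<open>Centering can only decrease a sum of squares, so the Lipschitz constant of the local
  gradients carries over to their deviations.\<close>

lemma dev_diff_le: "ip N (\<lambda>i. dev u i - dev v i) (\<lambda>i. dev u i - dev v i) \<le> real N * L\<^sup>2 * (norm (u - v))\<^sup>2"
proof -
  define d where "d i = gradient (f i) u - gradient (f i) v" for i
  have m: "node_mean N d = gbar u - gbar v" by (simp add: d_def[abs_def] gbar_def node_mean_diff)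
  have "ip N (\<lambda>i. dev u i - dev v i) (\<lambda>i. dev u i - dev v i)
      = ip N (\<lambda>i. d i - node_mean N d) (\<lambda>i. d i - node_mean N d)"
    unfolding m by (simp add: d_def dev_def algebra_simps)
  also have "\<dots> = ip N d d - real N * inner (node_mean N d) (node_mean N d)"
    unfolding sum_norm_squared_centered[OF N_pos] ip_const_right sum_eq_node_mean[OF N_pos] by simp
  also have "\<dots> \<le> ip N d d" by simp
  also have "\<dots> \<le> (\<Sum>i<N. L\<^sup>2 * (norm (u - v))\<^sup>2)"
    unfolding ip_self d_def using lip by (intro sum_mono) (simp flip: power_mult_distrib add: power_mono)
  finally show ?thesis by simp
qed

text \<open>The gradient is evaluated at the true local iterate \<open>p\<close>, but smoothness and convexity are applied
  at \<open>q\<close>, so that the discrepancy \<open>p - q\<close> enters only linearly.\<close>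

lemma descent_term:
  assumes "i < N"
  shows "inner (gradient (f i) p) (xs - x) \<le> f i xs - f i x - \<mu> / 4 * (norm (x - xs))\<^sup>2
    + L * (norm (q - x))\<^sup>2 + L * norm (p - q) * norm (x - xs)"
proof -
  have 1: "inner (gradient (f i) q) (xs - q) \<le> f i xs - f i q - \<mu> / 2 * (norm (xs - q))\<^sup>2"
    using strongly_convex_lower_bound[OF diff[OF assms] sc[OF assms], of q xs] by simp
  have 2: "inner (gradient (f i) q) (q - x) \<le> f i q - f i x + L / 2 * (norm (q - x))\<^sup>2"
    using smooth_upper_bound[OF diff[OF assms] lip[OF assms], of x q]
    by (simp add: inner_diff_right norm_minus_commute)
  \<comment> \<open>Strong convexity is applied at \<open>q\<close> but claimed around
    \<open>x\<close>. Half of \<mu> is given up for this; the rest is covered by the smoothness term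
    because \<open>\<mu> \<le> L\<close>.\<close>
  have "(norm (x - xs))\<^sup>2 \<le> 2 * (norm (q - xs))\<^sup>2 + 2 * (norm (q - x))\<^sup>2"
    using norm_diff2_squared_le[of "q - xs" "q - x"] by simp
  then have "\<mu> / 4 * (norm (x - xs))\<^sup>2 \<le> \<mu> / 4 * (2 * (norm (q - xs))\<^sup>2 + 2 * (norm (q - x))\<^sup>2)"
    using mu_nonneg by (intro mult_left_mono) auto
  then have 3: "\<mu> / 4 * (norm (x - xs))\<^sup>2 \<le> \<mu> / 2 * (norm (xs - q))\<^sup>2 + \<mu> / 2 * (norm (q - x))\<^sup>2"
    by (simp add: norm_minus_commute distrib_left)
  have 4: "\<mu> / 2 * (norm (q - x))\<^sup>2 \<le> L / 2 * (norm (q - x))\<^sup>2"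
    using mu_le by (intro mult_right_mono) auto
  have "inner (gradient (f i) p - gradient (f i) q) (xs - x)
      \<le> norm (gradient (f i) p - gradient (f i) q) * norm (xs - x)"
    by (rule norm_cauchy_schwarz)
  also have "\<dots> \<le> (L * norm (p - q)) * norm (xs - x)"
    using lip[OF assms] by (intro mult_right_mono) auto
  finally have 5: "inner (gradient (f i) p) (xs - x)
      \<le> inner (gradient (f i) q) (xs - q) + inner (gradient (f i) q) (q - x) + L * norm (p - q) * norm (x - xs)"
    by (simp add: inner_diff_left inner_diff_right norm_minus_commute)
  have "L * (norm (q - x))\<^sup>2 = L / 2 * (norm (q - x))\<^sup>2 + L / 2 * (norm (q - x))\<^sup>2" by simp
  then show ?thesis using 1 2 3 4 5 by linarith
qed

end

text \<open>A round is analysed for one fixed outcome with arbitrary noise vectors \<nu>, and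
  expectations are taken of the final inequalities only. \<open>eX\<close> and \<open>eY\<close> are
  the places for the deterministic part of the consensus error, \<open>qX\<close> and
  \<open>qY\<close> for the rest.\<close>

locale led_round = led_costs N w lam f L \<mu> xs
  for N w lam and f :: "nat \<Rightarrow> 'a::euclidean_space \<Rightarrow> real" and L \<mu> xs +
  fixes \<alpha> :: real and \<tau> :: nat and x y :: "nat \<Rightarrow> 'a" and \<phi> \<nu> :: "nat \<Rightarrow> nat \<Rightarrow> 'a"
    and eX eY qX qY :: "nat \<Rightarrow> 'a"
  assumes alpha_pos: "\<alpha> > 0" and tau_pos: "\<tau> \<ge> 1" and small: "\<alpha> * real \<tau> * L \<le> 1 / 16"
    and phi_0: "\<And>i. i < N \<Longrightarrow> \<phi> i 0 = x i"
    and phi_Suc: "\<And>i t. i < N \<Longrightarrow> t < \<tau> \<Longrightarrow>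
      \<phi> i (Suc t) = \<phi> i t - \<alpha> *\<^sub>R (gradient (f i) (\<phi> i t) + \<nu> i t) - (1 / real \<tau>) *\<^sub>R y i"
    and mean_y: "node_mean N y = 0"
    and split_x: "\<And>i. i < N \<Longrightarrow> x i - node_mean N x = eX i + qX i"
    and split_y: "\<And>i. i < N \<Longrightarrow> y i + (\<alpha> * real \<tau>) *\<^sub>R dev (node_mean N x) i = eY i + qY i"
begin

definition "xb = node_mean N x"
definition "xb' = node_mean N (\<lambda>i. \<phi> i \<tau>)"
definition "nbar = node_mean N (\<lambda>i. \<Sum>t<\<tau>. \<nu> i t)"
definition "G = node_mean N (\<lambda>i. \<Sum>t<\<tau>. gradient (f i) (\<phi> i t))"
text \<open>The share of the split-off part in the local iterate: after \<open>t\<close> steps the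
  correction by \<open>y\<close> has been applied for \<open>t\<close> of the \<tau> steps.\<close>

definition "e i t = eX i - (real t / real \<tau>) *\<^sub>R eY i"
definition "Sphi = (\<Sum>i<N. \<Sum>t<\<tau>. (norm (\<phi> i t - xb))\<^sup>2)"
definition "Spsi = (\<Sum>i<N. \<Sum>t<\<tau>. (norm (\<phi> i t - e i t - xb))\<^sup>2)"
definition "NN = (\<Sum>i<N. \<Sum>t<\<tau>. (norm (\<Sum>s<t. \<nu> i s))\<^sup>2)"
definition "hT = ip N eX eX + ip N eY eY"
definition "qq = ip N qX qX + ip N qY qY"
definition "drift i t = (\<Sum>s<t. gradient (f i) (\<phi> i s) - gradient (f i) xb)"

text \<open>Because the correction has weight \<open>1 / \<tau>\<close>, it combines with the
  gradient deviation at the mean into \<open>t / \<tau>\<close> times \<open>y + a * dev\<close>,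
  which is the shifted variable that splits into \<open>eY + qY\<close>. What remains is the average
  gradient, the drift of the gradients away from their values at the mean, and noise.\<close>

lemma phi_expand:
  assumes "i < N" "t \<le> \<tau>"
  shows "\<phi> i t = xb + (eX i + qX i) - (real t / real \<tau>) *\<^sub>R (eY i + qY i)
    - (\<alpha> * real t) *\<^sub>R gbar xb - \<alpha> *\<^sub>R drift i t - \<alpha> *\<^sub>R (\<Sum>s<t. \<nu> i s)"
  using assms(2)
proof (induction t)
  case 0
  then show ?case using phi_0[OF assms(1)] split_x[OF assms(1)]
    by (simp add: drift_def xb_def algebra_simps)
next
  case (Suc t)
  have y: "(1 / real \<tau>) *\<^sub>R y i = (1 / real \<tau>) *\<^sub>R (eY i + qY i) - \<alpha> *\<^sub>R dev xb i"
    unfolding split_y[OF assms(1), folded xb_def, symmetric] using tau_pos by (simp add: scaleR_add_right)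
  define g where "g = gradient (f i) (\<phi> i t)"
  have drift_Suc: "drift i (Suc t) = drift i t + (g - gradient (f i) xb)"
    by (simp add: drift_def g_def)
  have "\<phi> i (Suc t) = \<phi> i t - \<alpha> *\<^sub>R (g - gradient (f i) xb) - \<alpha> *\<^sub>R gbar xb
      - \<alpha> *\<^sub>R \<nu> i t - (1 / real \<tau>) *\<^sub>R (eY i + qY i)"
    using phi_Suc[OF assms(1), of t] Suc.prems by (simp add: y dev_def g_def algebra_simps)
  also have "\<phi> i t = xb + (eX i + qX i) - (real t / real \<tau>) *\<^sub>R (eY i + qY i)
    - (\<alpha> * real t) *\<^sub>R gbar xb - \<alpha> *\<^sub>R drift i t - \<alpha> *\<^sub>R (\<Sum>s<t. \<nu> i s)"
    using Suc by simp
  finally show ?case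
    by (simp add: drift_Suc add_divide_distrib algebra_simps)
qed

lemma drift_le:
  assumes "i < N" "t \<le> \<tau>"
  shows "(norm (drift i t))\<^sup>2 \<le> real \<tau> * L\<^sup>2 * (\<Sum>s<\<tau>. (norm (\<phi> i s - xb))\<^sup>2)"
proof -
  have "(norm (drift i t))\<^sup>2 \<le> real t * (\<Sum>s<t. (norm (gradient (f i) (\<phi> i s) - gradient (f i) xb))\<^sup>2)"
    unfolding drift_def using norm_sum_squared_le[of "{..<t}"] by simp
  also have "\<dots> \<le> real \<tau> * (\<Sum>s<\<tau>. L\<^sup>2 * (norm (\<phi> i s - xb))\<^sup>2)"
  proof (intro mult_mono)
    have "(\<Sum>s<t. (norm (gradient (f i) (\<phi> i s) - gradient (f i) xb))\<^sup>2)
        \<le> (\<Sum>s<t. L\<^sup>2 * (norm (\<phi> i s - xb))\<^sup>2)"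
      using lip[OF assms(1)] by (intro sum_mono) (simp flip: power_mult_distrib add: power_mono)
    also have "\<dots> \<le> (\<Sum>s<\<tau>. L\<^sup>2 * (norm (\<phi> i s - xb))\<^sup>2)"
      using assms(2) by (intro sum_mono2) auto
    finally show "(\<Sum>s<t. (norm (gradient (f i) (\<phi> i s) - gradient (f i) xb))\<^sup>2)
        \<le> (\<Sum>s<\<tau>. L\<^sup>2 * (norm (\<phi> i s - xb))\<^sup>2)" .
  qed (use assms(2) in \<open>auto intro: sum_nonneg\<close>)
  finally show ?thesis by (simp add: sum_distrib_left mult.assoc)
qed

lemma norm_frac_le: "t \<le> \<tau> \<Longrightarrow> (norm ((real t / real \<tau>) *\<^sub>R (v :: 'a)))\<^sup>2 \<le> (norm v)\<^sup>2"
proof -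
  assume "t \<le> \<tau>"
  then have "norm ((real t / real \<tau>) *\<^sub>R v) \<le> norm v"
    using tau_pos mult_right_mono[of "real t / real \<tau>" 1 "norm v"] by simp
  then show ?thesis by (intro power_mono) auto
qed

lemma sum_const_NT: "(\<Sum>i<N. \<Sum>t<\<tau>. c i) = real \<tau> * (\<Sum>i<N. c i :: real)"
  by (simp add: sum_distrib_left)

lemma Sphi_le: "Sphi \<le> 2 * Spsi + 4 * real \<tau> * hT"
proof -
  have "(norm (\<phi> i t - xb))\<^sup>2 \<le> 2 * (norm (\<phi> i t - e i t - xb))\<^sup>2
      + 4 * ((norm (eX i))\<^sup>2 + (norm (eY i))\<^sup>2)" if "t < \<tau>" for i t
  proof -
    have "(norm (\<phi> i t - xb))\<^sup>2 \<le> 2 * (norm (\<phi> i t - e i t - xb))\<^sup>2 + 2 * (norm (e i t))\<^sup>2"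
      using norm_add2_squared_le[of "\<phi> i t - e i t - xb" "e i t"] by (simp add: algebra_simps)
    moreover have "(norm (e i t))\<^sup>2 \<le> 2 * (norm (eX i))\<^sup>2 + 2 * (norm (eY i))\<^sup>2"
      unfolding e_def using norm_frac_le[of t "eY i"] that
        norm_diff2_squared_le[of "eX i" "(real t / real \<tau>) *\<^sub>R eY i"] by linarith
    ultimately show ?thesis by (simp add: distrib_left)
  qed
  then have "Sphi \<le> (\<Sum>i<N. \<Sum>t<\<tau>. 2 * (norm (\<phi> i t - e i t - xb))\<^sup>2
      + 4 * ((norm (eX i))\<^sup>2 + (norm (eY i))\<^sup>2))"
    unfolding Sphi_def by (intro sum_mono) auto
  also have "\<dots> = 2 * Spsi + 4 * real \<tau> * hT"
    by (simp add: Spsi_def hT_def ip_self sum.distrib sum_distrib_left algebra_simps)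
  finally show ?thesis .
qed

text \<open>Subtracting \<open>e\<close> and \<open>xb\<close> from \<open>phi_expand\<close> leaves
  five summands, hence the factor 5.\<close>

lemma Spsi_le_aux: "Spsi \<le> 5 * (real \<tau> * qq + real N * real \<tau> * ((\<alpha> * real \<tau>)\<^sup>2 * (norm (gbar xb))\<^sup>2)
    + (\<alpha> * real \<tau> * L)\<^sup>2 * Sphi + \<alpha>\<^sup>2 * NN)"
proof -
  let ?D = "\<lambda>i. \<alpha>\<^sup>2 * (real \<tau> * L\<^sup>2 * (\<Sum>s<\<tau>. (norm (\<phi> i s - xb))\<^sup>2))"
  have "(norm (\<phi> i t - e i t - xb))\<^sup>2 \<le> 5 * ((norm (qX i))\<^sup>2 + (norm (qY i))\<^sup>2
      + (\<alpha> * real \<tau>)\<^sup>2 * (norm (gbar xb))\<^sup>2 + ?D i + \<alpha>\<^sup>2 * (norm (\<Sum>s<t. \<nu> i s))\<^sup>2)"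
    if it: "i < N" "t < \<tau>" for i t
  proof -
    have eq: "\<phi> i t - e i t - xb = qX i - (real t / real \<tau>) *\<^sub>R qY i - (\<alpha> * real t) *\<^sub>R gbar xb
        - \<alpha> *\<^sub>R drift i t - \<alpha> *\<^sub>R (\<Sum>s<t. \<nu> i s)"
      using phi_expand[of i t] it by (simp add: e_def scaleR_add_right algebra_simps)
    have "(norm ((\<alpha> * real t) *\<^sub>R gbar xb))\<^sup>2 \<le> (\<alpha> * real \<tau>)\<^sup>2 * (norm (gbar xb))\<^sup>2"
      using it alpha_pos by (simp add: power_mult_distrib mult_mono power_mono mult_right_mono)
    moreover have "(norm (\<alpha> *\<^sub>R drift i t))\<^sup>2 \<le> ?D i"
      using drift_le[of i t] it by (simp add: power_mult_distrib mult_left_mono)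
    moreover have "(norm (\<alpha> *\<^sub>R (\<Sum>s<t. \<nu> i s)))\<^sup>2 = \<alpha>\<^sup>2 * (norm (\<Sum>s<t. \<nu> i s))\<^sup>2"
      by (simp add: power_mult_distrib)
    moreover have "(norm ((real t / real \<tau>) *\<^sub>R qY i))\<^sup>2 \<le> (norm (qY i))\<^sup>2"
      using norm_frac_le it by simp
    ultimately show ?thesis unfolding eq by (intro norm_sum5_squared_le) auto
  qed
  then have "Spsi \<le> (\<Sum>i<N. \<Sum>t<\<tau>. 5 * ((norm (qX i))\<^sup>2 + (norm (qY i))\<^sup>2
      + (\<alpha> * real \<tau>)\<^sup>2 * (norm (gbar xb))\<^sup>2 + ?D i + \<alpha>\<^sup>2 * (norm (\<Sum>s<t. \<nu> i s))\<^sup>2))"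
    unfolding Spsi_def by (intro sum_mono) auto
  also have "\<dots> = 5 * (\<Sum>i<N. \<Sum>t<\<tau>. ((norm (qX i))\<^sup>2 + (norm (qY i))\<^sup>2
      + (\<alpha> * real \<tau>)\<^sup>2 * (norm (gbar xb))\<^sup>2 + ?D i) + \<alpha>\<^sup>2 * (norm (\<Sum>s<t. \<nu> i s))\<^sup>2)"
    by (simp only: sum_distrib_left)
  also have "(\<Sum>i<N. \<Sum>t<\<tau>. ((norm (qX i))\<^sup>2 + (norm (qY i))\<^sup>2
      + (\<alpha> * real \<tau>)\<^sup>2 * (norm (gbar xb))\<^sup>2 + ?D i) + \<alpha>\<^sup>2 * (norm (\<Sum>s<t. \<nu> i s))\<^sup>2)
    = real \<tau> * (\<Sum>i<N. (norm (qX i))\<^sup>2 + (norm (qY i))\<^sup>2 + (\<alpha> * real \<tau>)\<^sup>2 * (norm (gbar xb))\<^sup>2 + ?D i)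
      + \<alpha>\<^sup>2 * NN"
    by (subst sum_const_NT[symmetric]) (simp only: sum.distrib NN_def sum_distrib_left)
  also have "(\<Sum>i<N. (norm (qX i))\<^sup>2 + (norm (qY i))\<^sup>2 + (\<alpha> * real \<tau>)\<^sup>2 * (norm (gbar xb))\<^sup>2 + ?D i)
    = qq + real N * ((\<alpha> * real \<tau>)\<^sup>2 * (norm (gbar xb))\<^sup>2) + \<alpha>\<^sup>2 * (real \<tau> * L\<^sup>2 * Sphi)"
    by (simp add: qq_def ip_self sum.distrib Sphi_def sum_distrib_left)
  finally show ?thesis by (simp add: algebra_simps power2_eq_square)
qed

end

text \<open>Both sides are squared, so that nothing is divided by \<open>c\<close>, which is 0 in
  the strongly convex case.\<close>

lemma young_with_weight:
  fixes u d c v l :: real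
  assumes "0 \<le> d" "0 \<le> c" "0 \<le> v" "u\<^sup>2 \<le> c * v"
  shows "2 * l * u * d \<le> c * d\<^sup>2 + l\<^sup>2 * v"
proof (rule power2_le_imp_le)
  have "(2 * l * u * d)\<^sup>2 = 4 * (l\<^sup>2 * d\<^sup>2) * u\<^sup>2" by (simp add: power_mult_distrib)
  also have "\<dots> \<le> 4 * (l\<^sup>2 * d\<^sup>2) * (c * v)" using assms(4) by (intro mult_left_mono) auto
  also have "\<dots> = 4 * (c * d\<^sup>2) * (l\<^sup>2 * v)" by simp
  also have "\<dots> \<le> (c * d\<^sup>2 + l\<^sup>2 * v)\<^sup>2"
  proof -
    have "0 \<le> (c * d\<^sup>2 - l\<^sup>2 * v)\<^sup>2" by simp
    then show ?thesis by (simp add: power2_sum power2_diff mult_ac)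
  qed
  finally show "(2 * l * u * d)\<^sup>2 \<le> (c * d\<^sup>2 + l\<^sup>2 * v)\<^sup>2" .
  show "0 \<le> c * d\<^sup>2 + l\<^sup>2 * v" using assms by simp
qed

lemma norm_diff_scaleR_squared:
  fixes u v :: "'a::real_inner"
  shows "(norm (u - c *\<^sub>R v))\<^sup>2 = (norm u)\<^sup>2 - 2 * c * inner u v + c\<^sup>2 * (norm v)\<^sup>2"
  unfolding power2_norm_eq_inner
  by (simp add: inner_diff_left inner_diff_right inner_commute power2_eq_square algebra_simps)

context led_round
begin

abbreviation "a \<equiv> \<alpha> * real \<tau>"
abbreviation "l \<equiv> \<alpha> * real \<tau> * L"

lemma N_real_pos: "0 < real N" using N_pos by simp

lemma tau_real_pos: "0 < real \<tau>" using tau_pos by simp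

lemma a_pos: "0 < a" using alpha_pos tau_pos by simp

lemma l_pos: "0 < l" using a_pos L_pos by simp

lemma l_sq_le: "l\<^sup>2 \<le> 1 / 256"
  using power_mono[OF small less_imp_le[OF l_pos], of 2] by (simp add: power_divide)

lemma Sphi_nonneg: "0 \<le> Sphi" unfolding Sphi_def by (intro sum_nonneg) simp
lemma Spsi_nonneg: "0 \<le> Spsi" unfolding Spsi_def by (intro sum_nonneg) simp
lemma NN_nonneg: "0 \<le> NN" unfolding NN_def by (intro sum_nonneg) simp
lemma hT_nonneg: "0 \<le> hT" unfolding hT_def by simp
lemma qq_nonneg: "0 \<le> qq" unfolding qq_def by simp

text \<open>\<open>Spsi\<close> returns on the right through the drift, but with a factor of at most
  10/256 since \<open>l \<le> 1 / 16\<close>. Absorbing it costs a factor of at most 2 in every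
  other coefficient.\<close>

lemma Spsi_le: "Spsi \<le> 10 * real \<tau> * qq + 20 * real N * real \<tau> * (a * l) * gap xb
    + 40 * l\<^sup>2 * real \<tau> * hT + 10 * \<alpha>\<^sup>2 * NN"
proof -
  have 1: "l\<^sup>2 * Sphi \<le> l\<^sup>2 * (2 * Spsi + 4 * real \<tau> * hT)"
    by (intro mult_left_mono Sphi_le) simp
  have 2: "l\<^sup>2 * Spsi \<le> 1 / 256 * Spsi"
    by (intro mult_right_mono l_sq_le Spsi_nonneg)
  have "a\<^sup>2 * (norm (gbar xb))\<^sup>2 \<le> a\<^sup>2 * (2 * L * gap xb)"
    by (intro mult_left_mono gbar_le) simp
  then have "real N * real \<tau> * (a\<^sup>2 * (norm (gbar xb))\<^sup>2) \<le> real N * real \<tau> * (a\<^sup>2 * (2 * L * gap xb))"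
    by (rule mult_left_mono) simp
  also have "\<dots> = 2 * (real N * real \<tau> * (a * l) * gap xb)" by (simp add: power2_eq_square)
  finally have 3: "real N * real \<tau> * (a\<^sup>2 * (norm (gbar xb))\<^sup>2) \<le> 2 * (real N * real \<tau> * (a * l) * gap xb)" .
  have 4: "l\<^sup>2 * (2 * Spsi + 4 * real \<tau> * hT) = 2 * (l\<^sup>2 * Spsi) + 4 * (l\<^sup>2 * real \<tau> * hT)"
    by (simp add: algebra_simps)
  define A where "A = real \<tau> * qq"
  define B where "B = real N * real \<tau> * (a * l) * gap xb"
  define C where "C = l\<^sup>2 * real \<tau> * hT"
  define D where "D = \<alpha>\<^sup>2 * NN"
  define E where "E = l\<^sup>2 * Sphi"
  define F where "F = l\<^sup>2 * Spsi"
  define H where "H = real N * real \<tau> * (a\<^sup>2 * (norm (gbar xb))\<^sup>2)"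
  have "Spsi \<le> 5 * (A + H + E + D)" using Spsi_le_aux unfolding A_def H_def E_def D_def .
  moreover have "E \<le> 2 * F + 4 * C" using 1 unfolding 4 E_def F_def C_def .
  moreover have "F \<le> 1 / 256 * Spsi" using 2 unfolding F_def .
  moreover have "H \<le> 2 * B" using 3 unfolding H_def B_def .
  moreover have "0 \<le> A" "0 \<le> C" "0 \<le> D" unfolding A_def C_def D_def
    using qq_nonneg hT_nonneg NN_nonneg by (auto intro!: mult_nonneg_nonneg)
  moreover have "0 \<le> B" unfolding B_def
    using alpha_pos L_pos gap_nonneg[of xb] by (intro mult_nonneg_nonneg) auto
  ultimately have "Spsi \<le> 10 * A + 20 * B + 40 * C + 10 * D"
    using Spsi_nonneg by argo
  then show ?thesis unfolding A_def B_def C_def D_def by (simp add: mult.assoc)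
qed

lemma Spsi_mean_le: "Spsi / (real N * real \<tau>) \<le> 10 * (qq / real N) + 20 * (a * l) * gap xb
    + 40 * l\<^sup>2 * (hT / real N) + 10 * (\<alpha>\<^sup>2 * (NN / (real N * real \<tau>)))"
proof -
  have "Spsi / (real N * real \<tau>) \<le> (10 * real \<tau> * qq + 20 * real N * real \<tau> * (a * l) * gap xb
      + 40 * l\<^sup>2 * real \<tau> * hT + 10 * \<alpha>\<^sup>2 * NN) / (real N * real \<tau>)"
    by (intro divide_right_mono Spsi_le) auto
  also have "\<dots> = 10 * (qq / real N) + 20 * (a * l) * gap xb
    + 40 * l\<^sup>2 * (hT / real N) + 10 * (\<alpha>\<^sup>2 * (NN / (real N * real \<tau>)))"
    using N_real_pos tau_real_pos unfolding add_divide_distrib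
    by (intro arg_cong2[where f = "(+)"]) (simp_all add: field_simps)
  finally show ?thesis .
qed

lemma Sphi_mean_le: "Sphi / (real N * real \<tau>) \<le> 2 * (Spsi / (real N * real \<tau>)) + 4 * (hT / real N)"
proof -
  have "Sphi / (real N * real \<tau>) \<le> (2 * Spsi + 4 * real \<tau> * hT) / (real N * real \<tau>)"
    by (intro divide_right_mono Sphi_le) auto
  also have "\<dots> = 2 * (Spsi / (real N * real \<tau>)) + 4 * (hT / real N)"
    using N_real_pos tau_real_pos by (simp add: field_simps)
  finally show ?thesis .
qed

lemma G_split: "G = real \<tau> *\<^sub>R gbar xb + node_mean N (\<lambda>i. drift i \<tau>)"
proof -
  have "G = node_mean N (\<lambda>i. real \<tau> *\<^sub>R gradient (f i) xb + drift i \<tau>)"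
    unfolding G_def drift_def by (simp add: sum_subtractf sum_constant_scaleR)
  then show ?thesis unfolding node_mean_add node_mean_scaleR gbar_def .
qed

lemma G_le: "\<alpha>\<^sup>2 * (norm G)\<^sup>2 \<le> 4 * (a * l) * gap xb + 2 * l\<^sup>2 * (Sphi / (real N * real \<tau>))"
proof -
  have "(norm (node_mean N (\<lambda>i. drift i \<tau>)))\<^sup>2 \<le> (1 / real N) * (\<Sum>i<N. (norm (drift i \<tau>))\<^sup>2)"
    by (rule norm_node_mean_squared_le[OF N_pos])
  also have "\<dots> \<le> (1 / real N) * (\<Sum>i<N. real \<tau> * L\<^sup>2 * (\<Sum>s<\<tau>. (norm (\<phi> i s - xb))\<^sup>2))"
    by (intro mult_left_mono sum_mono drift_le) auto
  also have "\<dots> = real \<tau> * L\<^sup>2 * Sphi / real N"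
    by (simp add: Sphi_def sum_distrib_left sum_divide_distrib)
  finally have 1: "(norm (node_mean N (\<lambda>i. drift i \<tau>)))\<^sup>2 \<le> real \<tau> * L\<^sup>2 * Sphi / real N" .
  have "(norm (real \<tau> *\<^sub>R gbar xb))\<^sup>2 = (real \<tau>)\<^sup>2 * (norm (gbar xb))\<^sup>2" by (simp add: power_mult_distrib)
  also have "\<dots> \<le> (real \<tau>)\<^sup>2 * (2 * L * gap xb)" by (intro mult_left_mono gbar_le) simp
  finally have 2: "(norm (real \<tau> *\<^sub>R gbar xb))\<^sup>2 \<le> (real \<tau>)\<^sup>2 * (2 * L * gap xb)" .
  have "(norm G)\<^sup>2 \<le> 2 * ((real \<tau>)\<^sup>2 * (2 * L * gap xb)) + 2 * (real \<tau> * L\<^sup>2 * Sphi / real N)"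
    unfolding G_split using norm_add2_squared_le[of "real \<tau> *\<^sub>R gbar xb" "node_mean N (\<lambda>i. drift i \<tau>)"] 1 2
    by linarith
  then have "\<alpha>\<^sup>2 * (norm G)\<^sup>2 \<le> \<alpha>\<^sup>2 * (2 * ((real \<tau>)\<^sup>2 * (2 * L * gap xb)) + 2 * (real \<tau> * L\<^sup>2 * Sphi / real N))"
    by (intro mult_left_mono) auto
  also have "\<dots> = 4 * (a * l) * gap xb + 2 * l\<^sup>2 * (Sphi / (real N * real \<tau>))"
    using tau_real_pos N_real_pos by (simp add: power2_eq_square field_simps)
  finally show ?thesis .
qed

lemma phi_sum:
  assumes "i < N" "t \<le> \<tau>"
  shows "\<phi> i t = x i - \<alpha> *\<^sub>R (\<Sum>s<t. gradient (f i) (\<phi> i s)) - \<alpha> *\<^sub>R (\<Sum>s<t. \<nu> i s) - (real t / real \<tau>) *\<^sub>R y i"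
  using assms(2)
proof (induction t)
  case (Suc t)
  define g where "g = (\<lambda>s. gradient (f i) (\<phi> i s))"
  have "\<phi> i (Suc t) = \<phi> i t - \<alpha> *\<^sub>R (g t + \<nu> i t) - (1 / real \<tau>) *\<^sub>R y i"
    using phi_Suc[OF assms(1), of t] Suc.prems by (simp add: g_def)
  also have "\<phi> i t = x i - \<alpha> *\<^sub>R (\<Sum>s<t. g s) - \<alpha> *\<^sub>R (\<Sum>s<t. \<nu> i s) - (real t / real \<tau>) *\<^sub>R y i"
    using Suc by (simp add: g_def)
  finally have "\<phi> i (Suc t) = x i - \<alpha> *\<^sub>R (\<Sum>s<Suc t. g s) - \<alpha> *\<^sub>R (\<Sum>s<Suc t. \<nu> i s) - (real (Suc t) / real \<tau>) *\<^sub>R y i"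
    by (simp add: add_divide_distrib algebra_simps)
  then show ?case unfolding g_def .
qed (simp add: phi_0[OF assms(1)])

text \<open>The correction \<open>y\<close> has mean zero, so the mean performs a perturbed gradient
  step.\<close>

lemma xb'_eq: "xb' = xb - \<alpha> *\<^sub>R G - \<alpha> *\<^sub>R nbar"
proof -
  have "xb' = node_mean N (\<lambda>i. x i - \<alpha> *\<^sub>R (\<Sum>s<\<tau>. gradient (f i) (\<phi> i s)) - \<alpha> *\<^sub>R (\<Sum>s<\<tau>. \<nu> i s) - y i)"
    unfolding xb'_def using tau_pos by (intro node_mean_cong) (simp add: phi_sum[where t = \<tau>])
  then show ?thesis
    unfolding node_mean_diff node_mean_scaleR mean_y by (simp add: xb_def G_def nbar_def)
qed

lemma sum_e_le: "((\<Sum>i<N. \<Sum>t<\<tau>. norm (e i t)) / (real N * real \<tau>))\<^sup>2 \<le> 2 * hT / real N"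
proof -
  define s where "s = (\<Sum>i<N. norm (eX i) + norm (eY i))"
  have "norm (e i t) \<le> norm (eX i) + norm (eY i)" if "t < \<tau>" for i t
  proof -
    have "norm (e i t) \<le> norm (eX i) + norm ((real t / real \<tau>) *\<^sub>R eY i)"
      unfolding e_def by (rule norm_triangle_ineq4)
    moreover have "norm ((real t / real \<tau>) *\<^sub>R eY i) \<le> norm (eY i)"
      using norm_frac_le[of t "eY i"] that by (auto intro: power2_le_imp_le)
    ultimately show ?thesis by simp
  qed
  then have "(\<Sum>i<N. \<Sum>t<\<tau>. norm (e i t)) \<le> (\<Sum>i<N. \<Sum>t<\<tau>. norm (eX i) + norm (eY i))"
    by (intro sum_mono) auto
  also have "\<dots> = real \<tau> * s" unfolding s_def by (rule sum_const_NT)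
  finally have "(\<Sum>i<N. \<Sum>t<\<tau>. norm (e i t)) / (real N * real \<tau>) \<le> s / real N"
    using tau_real_pos N_real_pos by (simp add: field_simps)
  moreover have "0 \<le> (\<Sum>i<N. \<Sum>t<\<tau>. norm (e i t)) / (real N * real \<tau>)"
    by (intro divide_nonneg_nonneg sum_nonneg) auto
  ultimately have "((\<Sum>i<N. \<Sum>t<\<tau>. norm (e i t)) / (real N * real \<tau>))\<^sup>2 \<le> (s / real N)\<^sup>2"
    by (intro power_mono)
  also have "s\<^sup>2 \<le> real N * (\<Sum>i<N. (norm (eX i) + norm (eY i))\<^sup>2)"
    using norm_sum_squared_le[of "{..<N}" "\<lambda>i. norm (eX i) + norm (eY i)"] by (simp add: s_def)
  then have "(s / real N)\<^sup>2 \<le> (\<Sum>i<N. (norm (eX i) + norm (eY i))\<^sup>2) / real N"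
    using N_real_pos by (simp add: power_divide power2_eq_square field_simps)
  also have "\<dots> \<le> (\<Sum>i<N. 2 * (norm (eX i))\<^sup>2 + 2 * (norm (eY i))\<^sup>2) / real N"
    using norm_add2_squared_le[of "norm (eX _)" "norm (eY _)"]
    by (intro divide_right_mono sum_mono) auto
  also have "\<dots> = 2 * hT / real N"
    by (simp add: hT_def ip_self sum.distrib sum_distrib_left)
  finally show ?thesis .
qed

text \<open>\<open>descent_term\<close> is applied with \<open>q\<close> equal to the local iterate
  freed from \<open>e\<close>. The rest, \<open>norm (e i t)\<close> times the distance to the
  minimizer, is divided between \<open>c\<close> and \<open>v\<close>. Only their product is tied to
  \<open>hT\<close>, which leaves the balance to be chosen round by round.\<close>

lemma inner_G_le:
  assumes "0 \<le> c" "0 \<le> v" "2 * hT / real N \<le> c * v"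
  shows "- 2 * \<alpha> * inner (xb - xs) G \<le> (c - a * \<mu> / 2) * (norm (xb - xs))\<^sup>2 - 2 * a * gap xb
    + 2 * l * (Spsi / (real N * real \<tau>)) + l\<^sup>2 * v"
proof -
  let ?d = "norm (xb - xs)"
  let ?E = "\<Sum>i<N. \<Sum>t<\<tau>. norm (e i t)"
  define A where "A i = f i xs - f i xb - \<mu> / 4 * ?d\<^sup>2" for i
  have "(\<Sum>i<N. \<Sum>t<\<tau>. inner (gradient (f i) (\<phi> i t)) (xs - xb))
      \<le> (\<Sum>i<N. \<Sum>t<\<tau>. A i + L * (norm (\<phi> i t - e i t - xb))\<^sup>2
        + L * norm (\<phi> i t - (\<phi> i t - e i t)) * ?d)"
    unfolding A_def by (intro sum_mono descent_term) simp
  also have "\<dots> = real \<tau> * (\<Sum>i<N. A i) + L * Spsi + L * ?d * ?E"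
    unfolding sum_const_NT[symmetric]
    by (simp add: Spsi_def sum.distrib sum_distrib_left mult.commute mult.left_commute)
  also have "(\<Sum>i<N. A i) = real N * (- gap xb - \<mu> / 4 * ?d\<^sup>2)"
  proof -
    have "(\<Sum>i<N. A i) = (\<Sum>i<N. f i xs) - (\<Sum>i<N. f i xb) - real N * (\<mu> / 4 * ?d\<^sup>2)"
      by (simp add: A_def sum_subtractf)
    moreover have "real N * gap xb = (\<Sum>i<N. f i xb) - (\<Sum>i<N. f i xs)"
      using N_pos by (simp add: gap_def avg_fun_def right_diff_distrib)
    ultimately show ?thesis by (simp add: right_diff_distrib)
  qed
  finally have 1: "(\<Sum>i<N. \<Sum>t<\<tau>. inner (gradient (f i) (\<phi> i t)) (xs - xb))
      \<le> real \<tau> * (real N * (- gap xb - \<mu> / 4 * ?d\<^sup>2)) + L * Spsi + L * ?d * ?E" .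
  have "- 2 * \<alpha> * inner (xb - xs) G = 2 * \<alpha> / real N * (\<Sum>i<N. \<Sum>t<\<tau>. inner (gradient (f i) (\<phi> i t)) (xs - xb))"
    unfolding G_def node_mean_def
    by (simp add: inner_sum_right inner_sum_left inner_commute[of "gradient _ _"] inner_diff_left sum_subtractf algebra_simps)
  also have "\<dots> \<le> 2 * \<alpha> / real N * (real \<tau> * (real N * (- gap xb - \<mu> / 4 * ?d\<^sup>2)) + L * Spsi + L * ?d * ?E)"
    using alpha_pos by (intro mult_left_mono 1) auto
  also have "\<dots> = - 2 * a * gap xb - a * \<mu> / 2 * ?d\<^sup>2 + 2 * l * (Spsi / (real N * real \<tau>))
      + 2 * l * (?E / (real N * real \<tau>)) * ?d"
    using N_real_pos tau_real_pos by (simp add: field_simps)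
  also have "2 * l * (?E / (real N * real \<tau>)) * ?d \<le> c * ?d\<^sup>2 + l\<^sup>2 * v"
    by (rule young_with_weight) (use assms order_trans[OF sum_e_le] in auto)
  finally show ?thesis by (simp add: algebra_simps)
qed

lemma descent:
  assumes "0 \<le> c" "0 \<le> v" "2 * hT / real N \<le> c * v"
  shows "(norm (xb' - xs))\<^sup>2 \<le> (1 - a * \<mu> / 2 + c) * (norm (xb - xs))\<^sup>2 - a * gap xb
    + 30 * l * (qq / real N) + l\<^sup>2 * (v + 31 * (hT / real N))
    + 30 * l * (\<alpha>\<^sup>2 * (NN / (real N * real \<tau>))) + 2 * \<alpha>\<^sup>2 * (norm nbar)\<^sup>2 - 2 * \<alpha> * inner (xb - xs) nbar"
proof -
  define P where "P = Spsi / (real N * real \<tau>)"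
  define S where "S = Sphi / (real N * real \<tau>)"
  define q where "q = qq / real N"
  define h where "h = hT / real N"
  define n where "n = \<alpha>\<^sup>2 * (NN / (real N * real \<tau>))"
  define g where "g = gap xb"
  have nn: "0 \<le> P" "0 \<le> q" "0 \<le> h" "0 \<le> n" "0 \<le> g"
    using Spsi_nonneg qq_nonneg hT_nonneg NN_nonneg gap_nonneg by (auto simp: P_def q_def h_def n_def g_def)
  have eq: "xb' - xs = (xb - xs) - \<alpha> *\<^sub>R (G + nbar)" by (simp add: xb'_eq algebra_simps)
  have "(norm (xb' - xs))\<^sup>2 = (norm (xb - xs))\<^sup>2 - 2 * \<alpha> * inner (xb - xs) (G + nbar) + \<alpha>\<^sup>2 * (norm (G + nbar))\<^sup>2"
    unfolding eq by (rule norm_diff_scaleR_squared)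
  moreover have "\<alpha>\<^sup>2 * (norm (G + nbar))\<^sup>2 \<le> \<alpha>\<^sup>2 * (2 * (norm G)\<^sup>2 + 2 * (norm nbar)\<^sup>2)"
    by (intro mult_left_mono norm_add2_squared_le) simp
  ultimately have 1: "(norm (xb' - xs))\<^sup>2 \<le> (norm (xb - xs))\<^sup>2 - 2 * \<alpha> * inner (xb - xs) G
      - 2 * \<alpha> * inner (xb - xs) nbar + 2 * (\<alpha>\<^sup>2 * (norm G)\<^sup>2) + 2 * \<alpha>\<^sup>2 * (norm nbar)\<^sup>2"
    by (simp add: inner_add_right distrib_left)
  have 2: "\<alpha>\<^sup>2 * (norm G)\<^sup>2 \<le> 4 * (a * l) * g + 2 * l\<^sup>2 * S" using G_le by (simp add: g_def S_def)
  have 3: "P \<le> 10 * q + 20 * (a * l) * g + 40 * l\<^sup>2 * h + 10 * n"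
    unfolding P_def q_def g_def h_def n_def by (rule Spsi_mean_le)
  have 4: "S \<le> 2 * P + 4 * h"
    unfolding S_def P_def h_def by (rule Sphi_mean_le)
  have 5: "4 * l\<^sup>2 * S \<le> 8 * (l\<^sup>2 * P) + 16 * (l\<^sup>2 * h)"
    using mult_left_mono[OF 4, of "4 * l\<^sup>2"] by (simp add: algebra_simps)
  have 6: "8 * (l\<^sup>2 * P) \<le> l * P"
  proof -
    have "8 * l * (l * P) \<le> 1 * (l * P)" using small nn l_pos by (intro mult_right_mono) auto
    then show ?thesis by (simp add: power2_eq_square)
  qed
  have 7: "3 * (l * P) \<le> 30 * (l * q) + 60 * (l * (a * l) * g) + 120 * (l * l\<^sup>2 * h) + 30 * (l * n)"
    using mult_left_mono[OF 3, of "3 * l"] l_pos by (simp add: algebra_simps)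
  have 12: "0 \<le> a * g" "0 \<le> l\<^sup>2 * h" using a_pos nn by auto
  have 8: "60 * (l * (a * l) * g) \<le> 60 / 256 * (a * g)"
  proof -
    have "60 * (l * (a * l) * g) = l\<^sup>2 * (60 * (a * g))" by (simp add: power2_eq_square)
    also have "\<dots> \<le> 1 / 256 * (60 * (a * g))" using 12 by (intro mult_right_mono l_sq_le) simp
    finally show ?thesis by (simp add: mult_ac)
  qed
  have 9: "8 * ((a * l) * g) \<le> 8 / 16 * (a * g)"
  proof -
    have "8 * ((a * l) * g) = l * (8 * (a * g))" by simp
    also have "\<dots> \<le> 1 / 16 * (8 * (a * g))" using 12 by (intro mult_right_mono small) simp
    finally show ?thesis by (simp add: mult_ac)
  qed
  have 10: "120 * (l * l\<^sup>2 * h) \<le> 120 / 16 * (l\<^sup>2 * h)"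
  proof -
    have "120 * (l * l\<^sup>2 * h) = l * (120 * (l\<^sup>2 * h))" by simp
    also have "\<dots> \<le> 1 / 16 * (120 * (l\<^sup>2 * h))" using 12 by (intro mult_right_mono small) simp
    finally show ?thesis by (simp add: mult_ac)
  qed
  have 11: "- 2 * \<alpha> * inner (xb - xs) G \<le> (c - a * \<mu> / 2) * (norm (xb - xs))\<^sup>2 - 2 * (a * g) + 2 * (l * P) + l\<^sup>2 * v"
    using inner_G_le[OF assms] unfolding g_def P_def by (simp only: mult.assoc)
  \<comment> \<open>Naming every product makes the remaining combination of estimates
    linear.\<close>
  define X where "X = (norm (xb - xs))\<^sup>2"
  define I1 where "I1 = 2 * \<alpha> * inner (xb - xs) G"
  define I2 where "I2 = 2 * \<alpha> * inner (xb - xs) nbar"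
  define c' where "c' = (c - a * \<mu> / 2) * X"
  define GG where "GG = \<alpha>\<^sup>2 * (norm G)\<^sup>2"
  define NB where "NB = 2 * \<alpha>\<^sup>2 * (norm nbar)\<^sup>2"
  define lP where "lP = l * P"
  define l2P where "l2P = l\<^sup>2 * P"
  define l2S where "l2S = l\<^sup>2 * S"
  define l2h where "l2h = l\<^sup>2 * h"
  define l3h where "l3h = l * l\<^sup>2 * h"
  define ag where "ag = a * g"
  define alg where "alg = a * l * g"
  define lalg where "lalg = l * (a * l) * g"
  define lq where "lq = l * q"
  define ln' where "ln' = l * n"
  define lv where "lv = l\<^sup>2 * v"
  note defs = X_def I1_def I2_def c'_def GG_def NB_def lP_def l2P_def l2S_def l2h_def l3h_def ag_def alg_def lalg_def lq_def ln'_def lv_def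
  have "(norm (xb' - xs))\<^sup>2 \<le> X - I1 - I2 + 2 * GG + NB" using 1 by (simp add: defs)
  moreover have "GG \<le> 4 * alg + 2 * l2S" using 2 by (simp add: defs mult.assoc)
  moreover have "4 * l2S \<le> 8 * l2P + 16 * l2h" using 5 by (simp add: defs mult.assoc)
  moreover have "8 * l2P \<le> lP" using 6 by (simp add: defs)
  moreover have "3 * lP \<le> 30 * lq + 60 * lalg + 120 * l3h + 30 * ln'" using 7 by (simp add: defs)
  moreover have "60 * lalg \<le> 60 / 256 * ag" using 8 by (simp add: defs)
  moreover have "8 * alg \<le> 8 / 16 * ag" using 9 by (simp add: defs)
  moreover have "120 * l3h \<le> 120 / 16 * l2h" using 10 by (simp add: defs)
  moreover have "- I1 \<le> c' - 2 * ag + 2 * lP + lv" using 11 by (simp add: defs)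
  moreover have "0 \<le> ag" "0 \<le> l2h" using 12 by (simp_all add: defs)
  \<comment> \<open>The balance of the gap is \<open>- 2 + 8 / 16 + 60 / 256\<close>, which is below
    \<open>- 1\<close>; that of \<open>h\<close> is \<open>16 + 120 / 16\<close>, which is below
    31.\<close>
  ultimately have "(norm (xb' - xs))\<^sup>2 \<le> X + c' - ag + 30 * lq + lv + 31 * l2h + 30 * ln' + NB - I2"
    by linarith
  then have "(norm (xb' - xs))\<^sup>2 \<le> (1 - a * \<mu> / 2 + c) * X - a * g + 30 * l * q + l\<^sup>2 * (v + 31 * h)
      + 30 * l * n + NB - I2"
    by (simp add: c'_def ag_def lq_def lv_def l2h_def ln'_def algebra_simps)
  then show ?thesis unfolding X_def g_def q_def h_def n_def NB_def I2_def .
qed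

text \<open>Up to a vector common to all nodes, the new pair is the contracted pair minus noise and
  gradient drift; in the second coordinate the moved reference point of the gradient deviations adds
  \<open>a * d\<eta>\<close>. Drift and reference change are split off with \<epsilon>, while the
  noise stays in the same square with its cross term, so that its factor remains bounded.\<close>

lemma consensus:
  fixes tp tz qp qz d\<eta> :: "nat \<Rightarrow> 'a" and \<kappa> \<epsilon> :: real
  assumes eX: "\<And>i. i < N \<Longrightarrow> eX i = T tp i" and eY: "\<And>i. i < N \<Longrightarrow> eY i = K tz i"
    and qX: "\<And>i. i < N \<Longrightarrow> qX i = T qp i" and qY: "\<And>i. i < N \<Longrightarrow> qY i = K qz i"
    and kappa: "0 \<le> \<kappa>" and eps: "0 < \<epsilon>"
    and d\<eta>: "ip N d\<eta> d\<eta> \<le> \<kappa> * (real N * L\<^sup>2 * (norm (xb' - xb))\<^sup>2)"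
  defines "A1 \<equiv> \<lambda>i. T qp i - K qz i" and "nn \<equiv> \<lambda>i. \<alpha> *\<^sub>R (\<Sum>t<\<tau>. \<nu> i t)"
    and "qp' \<equiv> \<lambda>i. \<phi> i \<tau> - (T tp i - K tz i)"
  shows "energy qp' (\<lambda>i. qz i + qp' i + a *\<^sub>R d\<eta> i)
    \<le> (1 + \<epsilon>) * (lam * energy qp qz - 2 * ip N (\<lambda>i. T A1 i + K (\<lambda>i. qz i + A1 i) i) nn + ip N nn nn)
      + (1 + 1 / \<epsilon>) * (real N * (l\<^sup>2 * (1 + \<kappa>) * (160 * (energy qp qz / real N) + 336 * (a * l) * gap xb
        + 96 * (energy tp tz / real N) + 160 * (\<alpha>\<^sup>2 * (NN / (real N * real \<tau>)))
        + 4 * (\<alpha>\<^sup>2 * (norm nbar)\<^sup>2))))"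
proof -
  define A2 where "A2 i = qz i + A1 i" for i
  define gg where "gg i = \<alpha> *\<^sub>R drift i \<tau>" for i
  define c where "c = xb - a *\<^sub>R gbar xb"
  define S where "S = Sphi / (real N * real \<tau>)"
  define n where "n = \<alpha>\<^sup>2 * (NN / (real N * real \<tau>))"
  define nb where "nb = \<alpha>\<^sup>2 * (norm nbar)\<^sup>2"
  define agl where "agl = (a * l) * gap xb"
  define q where "q = energy qp qz / real N"
  define h where "h = energy tp tz / real N"
  have qp': "qp' i = (A1 i - nn i - gg i) + c" if "i < N" for i
    using phi_expand[OF that, of \<tau>] tau_pos that
    by (simp add: qp'_def A1_def nn_def gg_def c_def eX eY qX qY algebra_simps)
  have qz': "qz i + qp' i + a *\<^sub>R d\<eta> i = (A2 i - nn i - (gg i - a *\<^sub>R d\<eta> i)) + c" if "i < N" for i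
    using qp'[OF that] by (simp add: A2_def algebra_simps)
  have "energy qp' (\<lambda>i. qz i + qp' i + a *\<^sub>R d\<eta> i)
      = energy (\<lambda>i. (A1 i - nn i - gg i) + c) (\<lambda>i. (A2 i - nn i - (gg i - a *\<^sub>R d\<eta> i)) + c)"
    by (rule energy_cong) (erule qp', erule qz')
  also have "\<dots> = energy (\<lambda>i. (A1 i - nn i) - gg i) (\<lambda>i. (A2 i - nn i) - (gg i - a *\<^sub>R d\<eta> i))"
    by (rule energy_shift)
  also have "\<dots> \<le> (1 + \<epsilon>) * energy (\<lambda>i. A1 i - nn i) (\<lambda>i. A2 i - nn i)
      + (1 + 1 / \<epsilon>) * energy gg (\<lambda>i. gg i - a *\<^sub>R d\<eta> i)"
    by (rule energy_diff_le[OF eps])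
  finally have 1: "energy qp' (\<lambda>i. qz i + qp' i + a *\<^sub>R d\<eta> i)
    \<le> (1 + \<epsilon>) * energy (\<lambda>i. A1 i - nn i) (\<lambda>i. A2 i - nn i)
      + (1 + 1 / \<epsilon>) * energy gg (\<lambda>i. gg i - a *\<^sub>R d\<eta> i)" .
  have "energy A1 A2 \<le> lam * energy qp qz"
    unfolding A2_def[abs_def] A1_def by (rule energy_contraction)
  moreover have "energy_form A1 A2 nn nn = ip N (\<lambda>i. T A1 i + K A2 i) nn"
    unfolding energy_form_def ip_add_left by (simp add: ip_T_sym ip_K_sym)
  ultimately have 2: "energy (\<lambda>i. A1 i - nn i) (\<lambda>i. A2 i - nn i)
      \<le> lam * energy qp qz - 2 * ip N (\<lambda>i. T A1 i + K A2 i) nn + ip N nn nn"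
    unfolding energy_diff using energy_diag[of nn] by linarith
  \<comment> \<open>The zero stack is subtracted so that the pair has the shape of
    \<open>energy_diff_le\<close>; the choice \<open>e = 1\<close> gives the factors 2.\<close>
  have "energy (\<lambda>i. gg i - 0) (\<lambda>i. gg i - a *\<^sub>R d\<eta> i)
      \<le> (1 + 1) * energy gg gg + (1 + 1 / 1) * energy (\<lambda>_. 0) (\<lambda>i. a *\<^sub>R d\<eta> i)"
    by (rule energy_diff_le) simp
  moreover have "energy (\<lambda>_. 0) (\<lambda>i. a *\<^sub>R d\<eta> i) \<le> a\<^sup>2 * ip N d\<eta> d\<eta>"
    using ip_K_le[of "\<lambda>i. a *\<^sub>R d\<eta> i"] by (simp add: energy_def ip_def[of N "\<lambda>_. 0"] ip_linear power2_eq_square mult_ac)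
  ultimately have 3: "energy gg (\<lambda>i. gg i - a *\<^sub>R d\<eta> i) \<le> 2 * ip N gg gg + 2 * (a\<^sup>2 * ip N d\<eta> d\<eta>)"
    using energy_diag[of gg] by simp
  have 4: "ip N gg gg \<le> real N * (l\<^sup>2 * S)"
  proof -
    have "ip N gg gg = \<alpha>\<^sup>2 * (\<Sum>i<N. (norm (drift i \<tau>))\<^sup>2)"
      by (simp add: ip_self gg_def power_mult_distrib sum_distrib_left)
    also have "\<dots> \<le> \<alpha>\<^sup>2 * (\<Sum>i<N. real \<tau> * L\<^sup>2 * (\<Sum>s<\<tau>. (norm (\<phi> i s - xb))\<^sup>2))"
      by (intro mult_left_mono sum_mono drift_le) auto
    also have "\<dots> = \<alpha>\<^sup>2 * (real \<tau> * L\<^sup>2 * Sphi)" by (simp add: Sphi_def sum_distrib_left)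
    also have "\<dots> = real N * (l\<^sup>2 * S)"
      using N_real_pos tau_real_pos by (simp add: S_def power2_eq_square)
    finally show ?thesis .
  qed
  have 5: "(norm (xb' - xb))\<^sup>2 \<le> 8 * agl + 4 * (l\<^sup>2 * S) + 2 * nb"
  proof -
    have "xb' - xb = \<alpha> *\<^sub>R (- G - nbar)" by (simp add: xb'_eq algebra_simps)
    then have "(norm (xb' - xb))\<^sup>2 = \<alpha>\<^sup>2 * (norm (- G - nbar))\<^sup>2" by (simp add: power_mult_distrib)
    also have "\<dots> \<le> \<alpha>\<^sup>2 * (2 * (norm (- G))\<^sup>2 + 2 * (norm nbar)\<^sup>2)"
      by (intro mult_left_mono norm_diff2_squared_le) simp
    also have "\<dots> = 2 * (\<alpha>\<^sup>2 * (norm G)\<^sup>2) + 2 * nb" by (simp add: nb_def algebra_simps)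
    finally show ?thesis using G_le unfolding agl_def S_def by argo
  qed
  have "l\<^sup>2 \<le> 1" using l_sq_le by simp
  have S_nn: "0 \<le> S" unfolding S_def using Sphi_nonneg by simp
  have nn0: "0 \<le> n" "0 \<le> nb" unfolding n_def nb_def using NN_nonneg by simp_all
  have agl0: "0 \<le> agl" unfolding agl_def
    using alpha_pos L_pos gap_nonneg[of xb] by (intro mult_nonneg_nonneg) auto
  have q0: "qq / real N \<le> q"
    unfolding q_def qq_def using energy_ge[of qp qz] qX qY
    by (intro divide_right_mono) (auto cong: ip_cong)
  have h0: "hT / real N \<le> h"
    unfolding h_def hT_def using energy_ge[of tp tz] eX eY
    by (intro divide_right_mono) (auto cong: ip_cong)
  have h_nn: "0 \<le> h" "0 \<le> q" unfolding h_def q_def by (simp_all add: energy_nonneg)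
  have hT_nn: "0 \<le> hT / real N" using hT_nonneg by simp
  have l2h: "l\<^sup>2 * (hT / real N) \<le> 1 / 256 * (hT / real N)" by (intro mult_right_mono l_sq_le hT_nn)
  have S_le: "S \<le> 20 * q + 40 * agl + 12 * h + 20 * n"
    using Sphi_mean_le Spsi_mean_le l2h q0 h0 h_nn hT_nn unfolding S_def agl_def n_def by argo
  have "a\<^sup>2 * ip N d\<eta> d\<eta> \<le> a\<^sup>2 * (\<kappa> * (real N * L\<^sup>2 * (8 * agl + 4 * (l\<^sup>2 * S) + 2 * nb)))"
    using kappa by (intro mult_left_mono order_trans[OF d\<eta>] 5) auto
  also have "\<dots> = real N * (l\<^sup>2 * (\<kappa> * (8 * agl + 4 * (l\<^sup>2 * S) + 2 * nb)))"
    by (simp add: power_mult_distrib mult_ac)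
  also have "\<dots> \<le> real N * (l\<^sup>2 * (\<kappa> * (8 * agl + 4 * (1 * S) + 2 * nb)))"
    using kappa S_nn \<open>l\<^sup>2 \<le> 1\<close> by (intro mult_left_mono add_mono mult_right_mono order_refl) auto
  finally have 6: "a\<^sup>2 * ip N d\<eta> d\<eta> \<le> real N * (l\<^sup>2 * (\<kappa> * (8 * agl + 4 * S + 2 * nb)))" by simp
  have "energy gg (\<lambda>i. gg i - a *\<^sub>R d\<eta> i)
      \<le> 2 * (real N * (l\<^sup>2 * S)) + 2 * (real N * (l\<^sup>2 * (\<kappa> * (8 * agl + 4 * S + 2 * nb))))"
    using 3 4 6 by linarith
  also have "\<dots> = real N * (l\<^sup>2 * (2 * S + \<kappa> * (16 * agl + 8 * S + 4 * nb)))"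
    by (simp add: algebra_simps)
  also have "\<dots> \<le> real N * (l\<^sup>2 * ((1 + \<kappa>) * (160 * q + 336 * agl + 96 * h + 160 * n + 4 * nb)))"
  proof (intro mult_left_mono)
    have "\<kappa> * (16 * agl + 8 * S + 4 * nb) \<le> \<kappa> * (160 * q + 336 * agl + 96 * h + 160 * n + 4 * nb)"
      using S_le kappa by (intro mult_left_mono) (linarith, simp)
    moreover have "2 * S \<le> 160 * q + 336 * agl + 96 * h + 160 * n + 4 * nb"
      using S_le S_nn agl0 nn0 by linarith
    ultimately show "2 * S + \<kappa> * (16 * agl + 8 * S + 4 * nb)
        \<le> (1 + \<kappa>) * (160 * q + 336 * agl + 96 * h + 160 * n + 4 * nb)"
      by (simp add: distrib_right)
  qed auto
  finally have 7: "energy gg (\<lambda>i. gg i - a *\<^sub>R d\<eta> i)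
      \<le> real N * (l\<^sup>2 * (1 + \<kappa>) * (160 * q + 336 * (a * l) * gap xb + 96 * h + 160 * n + 4 * nb))"
    by (simp only: agl_def mult.assoc)
  have "energy qp' (\<lambda>i. qz i + qp' i + a *\<^sub>R d\<eta> i)
    \<le> (1 + \<epsilon>) * (lam * energy qp qz - 2 * ip N (\<lambda>i. T A1 i + K A2 i) nn + ip N nn nn)
      + (1 + 1 / \<epsilon>) * (real N * (l\<^sup>2 * (1 + \<kappa>) * (160 * q + 336 * (a * l) * gap xb + 96 * h + 160 * n + 4 * nb)))"
    by (rule order_trans[OF 1], intro add_mono mult_left_mono 2 7) (use eps in auto)
  then show ?thesis unfolding A2_def[abs_def] q_def h_def n_def nb_def .
qed

end

section \<open>Square-integrable random vectors and independent samples\<close>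

text \<open>Each coordinate is a pointwise limit of difference quotients with increment
  \<open>1 / (n + 1)\<close>. Measurability has to be joint because the iterate and the datum are
  both random.\<close>

lemma borel_measurable_gradient:
  fixes F :: "'a::euclidean_space \<Rightarrow> 's \<Rightarrow> real"
  assumes F[measurable]: "(\<lambda>(v, s). F v s) \<in> borel_measurable (borel \<Otimes>\<^sub>M S)"
    and diff: "\<And>s v. s \<in> space S \<Longrightarrow> (\<lambda>z. F z s) differentiable (at v)"
  shows "(\<lambda>(v, s). gradient (\<lambda>z. F z s) v) \<in> borel_measurable (borel \<Otimes>\<^sub>M S)"
proof (subst borel_measurable_euclidean_space, rule ballI)
  fix b :: 'a assume "b \<in> Basis"
  define h where "h n = inverse (real (Suc n))" for n
  define D where "D n x = (F (fst x + h n *\<^sub>R b) (snd x) - F (fst x) (snd x)) / h n" for n x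
  have h_at: "filterlim h (at 0) sequentially"
    unfolding h_def[abs_def] filterlim_at using LIMSEQ_inverse_real_of_nat by auto
  have [measurable]: "D n \<in> borel_measurable (borel \<Otimes>\<^sub>M S)" for n
  proof -
    have "(\<lambda>x. (\<lambda>(v, s). F v s) (fst x + h n *\<^sub>R b, snd x)) \<in> borel_measurable (borel \<Otimes>\<^sub>M S)"
      by measurable
    moreover have "(\<lambda>x. (\<lambda>(v, s). F v s) (fst x, snd x)) \<in> borel_measurable (borel \<Otimes>\<^sub>M S)"
      by measurable
    ultimately show ?thesis unfolding D_def[abs_def] by simp
  qed
  have "(\<lambda>x. inner b (gradient (\<lambda>z. F z (snd x)) (fst x))) \<in> borel_measurable (borel \<Otimes>\<^sub>M S)"
  proof (rule borel_measurable_LIMSEQ_real)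
    show "D n \<in> borel_measurable (borel \<Otimes>\<^sub>M S)" for n by measurable
    fix x :: "'a \<times> 's" assume "x \<in> space (borel \<Otimes>\<^sub>M S)"
    then have s: "snd x \<in> space S" by (auto simp: space_pair_measure)
    have "((\<lambda>t. F (fst x + t *\<^sub>R b) (snd x)) has_real_derivative
        inner b (gradient (\<lambda>z. F z (snd x)) (fst x + 0 *\<^sub>R b))) (at 0)"
      by (rule has_real_derivative_along_line[OF diff[OF s]])
    then have "(\<lambda>t. (F (fst x + t *\<^sub>R b) (snd x) - F (fst x) (snd x)) / t) \<midarrow>0\<rightarrow>
        inner b (gradient (\<lambda>z. F z (snd x)) (fst x))"
      unfolding DERIV_def by simp
    from filterlim_compose[OF this h_at] show "(\<lambda>n. D n x) \<longlonglongrightarrow> inner b (gradient (\<lambda>z. F z (snd x)) (fst x))"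
      by (simp add: D_def)
  qed
  then show "(\<lambda>x. inner (case x of (v, s) \<Rightarrow> gradient (\<lambda>z. F z s) v) b) \<in> borel_measurable (borel \<Otimes>\<^sub>M S)"
    by (simp add: split_beta inner_commute)
qed

lemma borel_measurable_of_lipschitz:
  fixes g :: "'a::euclidean_space \<Rightarrow> 'b::euclidean_space"
  assumes "\<And>u v. norm (g u - g v) \<le> L * norm (u - v)" "0 \<le> L"
  shows "g \<in> borel_measurable borel"
proof -
  have "L-lipschitz_on UNIV g"
    using assms by (intro lipschitz_onI) (auto simp: dist_norm)
  then show ?thesis
    by (intro borel_measurable_continuous_onI lipschitz_on_continuous_on)
qed

text \<open>Rectangles determine the joint law. The hypothesis is about events because independence
  will be available between a generated sigma-algebra and one sample.\<close>

lemma (in prob_space) distr_pair_eq: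
  assumes X[measurable]: "X \<in> measurable M A" and Y[measurable]: "Y \<in> measurable M B"
    and ind: "\<And>a b. a \<in> sets A \<Longrightarrow> b \<in> sets B \<Longrightarrow>
      prob ((X -` a \<inter> space M) \<inter> (Y -` b \<inter> space M)) = prob (X -` a \<inter> space M) * prob (Y -` b \<inter> space M)"
  shows "distr M A X \<Otimes>\<^sub>M distr M B Y = distr M (A \<Otimes>\<^sub>M B) (\<lambda>\<omega>. (X \<omega>, Y \<omega>))"
proof (rule pair_measure_eqI)
  interpret A: prob_space "distr M A X" by (rule prob_space_distr) (rule X)
  interpret B: prob_space "distr M B Y" by (rule prob_space_distr) (rule Y)
  show "sigma_finite_measure (distr M A X)" "sigma_finite_measure (distr M B Y)" by unfold_locales
  fix a b assume "a \<in> sets (distr M A X)" "b \<in> sets (distr M B Y)"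
  then have ab[measurable]: "a \<in> sets A" "b \<in> sets B" by auto
  have "(\<lambda>\<omega>. (X \<omega>, Y \<omega>)) -` (a \<times> b) \<inter> space M = (X -` a \<inter> space M) \<inter> (Y -` b \<inter> space M)" by auto
  then show "emeasure (distr M A X) a * emeasure (distr M B Y) b
      = emeasure (distr M (A \<Otimes>\<^sub>M B) (\<lambda>\<omega>. (X \<omega>, Y \<omega>))) (a \<times> b)"
    using ind[OF ab] by (simp add: emeasure_distr emeasure_eq_measure ennreal_mult)
qed (simp cong: sets_pair_measure_cong)

text \<open>Fubini on the joint law: \<open>Y\<close> is independent of the pair of \<open>V\<close>
  and \<open>Z\<close> and is integrated out first, which leaves a function \<open>k\<close> of
  \<open>V\<close> alone.\<close>

lemma (in prob_space) indep_integral_inner: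
  fixes nz :: "'b::euclidean_space \<times> 's \<Rightarrow> 'c::euclidean_space"
  assumes VZ[measurable]: "(\<lambda>\<omega>. (V \<omega>, Z \<omega>)) \<in> measurable M (borel \<Otimes>\<^sub>M borel)"
    and Y[measurable]: "Y \<in> measurable M T"
    and ind: "\<And>a b. a \<in> sets (borel \<Otimes>\<^sub>M borel) \<Longrightarrow> b \<in> sets T \<Longrightarrow>
      prob (((\<lambda>\<omega>. (V \<omega>, Z \<omega>)) -` a \<inter> space M) \<inter> (Y -` b \<inter> space M))
      = prob ((\<lambda>\<omega>. (V \<omega>, Z \<omega>)) -` a \<inter> space M) * prob (Y -` b \<inter> space M)"
    and nz[measurable]: "nz \<in> borel_measurable (borel \<Otimes>\<^sub>M T)"
    and int_nz: "integrable M (\<lambda>\<omega>. nz (V \<omega>, Y \<omega>))"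
    and int_Z: "integrable M (\<lambda>\<omega>. inner (nz (V \<omega>, Y \<omega>)) (Z \<omega>))"
  defines "k \<equiv> \<lambda>v. \<integral>y. nz (v, y) \<partial>distr M T Y"
  shows "integrable M (\<lambda>\<omega>. inner (k (V \<omega>)) (Z \<omega>))"
    and "(\<integral>\<omega>. inner (nz (V \<omega>, Y \<omega>)) (Z \<omega>) \<partial>M) = (\<integral>\<omega>. inner (k (V \<omega>)) (Z \<omega>) \<partial>M)"
    and "k \<in> borel_measurable borel"
proof -
  define P where "P = distr M (borel \<Otimes>\<^sub>M borel) (\<lambda>\<omega>. (V \<omega>, Z \<omega>))"
  define Q where "Q = distr M T Y"
  have setsP[measurable_cong]: "sets P = sets (borel \<Otimes>\<^sub>M borel)" by (simp add: P_def)
  have setsQ[measurable_cong]: "sets Q = sets T" by (simp add: Q_def)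
  interpret P: prob_space P unfolding P_def by (rule prob_space_distr) (rule VZ)
  interpret Q: prob_space Q unfolding Q_def by (rule prob_space_distr) (rule Y)
  interpret PQ: pair_prob_space P Q ..
  have PQ: "P \<Otimes>\<^sub>M Q = distr M ((borel \<Otimes>\<^sub>M borel) \<Otimes>\<^sub>M T) (\<lambda>\<omega>. ((V \<omega>, Z \<omega>), Y \<omega>))"
    unfolding P_def Q_def by (rule distr_pair_eq[OF VZ Y ind])
  have VZY[measurable]: "(\<lambda>\<omega>. ((V \<omega>, Z \<omega>), Y \<omega>)) \<in> measurable M ((borel \<Otimes>\<^sub>M borel) \<Otimes>\<^sub>M T)"
    by measurable
  define h where "h x = inner (nz (fst (fst x), snd x)) (snd (fst x))" for x
  define g where "g x = nz (fst (fst x), snd x)" for x :: "('b \<times> 'c) \<times> 's"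
  have [measurable]: "h \<in> borel_measurable ((borel \<Otimes>\<^sub>M borel) \<Otimes>\<^sub>M T)"
    unfolding h_def[abs_def] by measurable
  have [measurable]: "g \<in> borel_measurable ((borel \<Otimes>\<^sub>M borel) \<Otimes>\<^sub>M T)"
    unfolding g_def[abs_def] by measurable
  have int_h: "integrable (P \<Otimes>\<^sub>M Q) h"
    unfolding PQ by (subst integrable_distr_eq) (use int_Z in \<open>auto simp: h_def\<close>)
  have int_g: "integrable (P \<Otimes>\<^sub>M Q) g"
    unfolding PQ by (subst integrable_distr_eq) (use int_nz in \<open>auto simp: g_def\<close>)
  have k_eq: "k = (\<lambda>v. \<integral>y. nz (v, y) \<partial>Q)" by (simp add: k_def Q_def)
  show k_meas: "k \<in> borel_measurable borel"
    unfolding k_eq by (rule Q.borel_measurable_lebesgue_integral) simp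
  note [measurable] = k_meas
  \<comment> \<open>Sections of an integrable function are integrable only almost everywhere, so the
    inner integral is evaluated almost everywhere.\<close>
  have AE: "AE x in P. (\<integral>y. h (x, y) \<partial>Q) = inner (k (fst x)) (snd x)"
    using PQ.AE_integrable_fst'[OF int_g]
  proof eventually_elim
    case (elim x)
    then have "integrable Q (\<lambda>y. nz (fst x, y))" by (simp add: g_def)
    then show ?case unfolding h_def k_eq by (simp add: integral_inner_left)
  qed
  have hm: "(\<lambda>x. \<integral>y. h (x, y) \<partial>Q) \<in> borel_measurable P"
    using PQ.integrable_fst'[OF int_h] by (rule borel_measurable_integrable)
  have km: "(\<lambda>x. inner (k (fst x)) (snd x)) \<in> borel_measurable P" by measurable
  have km': "(\<lambda>x. inner (k (fst x)) (snd x)) \<in> borel_measurable (borel \<Otimes>\<^sub>M borel)" by measurable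
  have int_k: "integrable P (\<lambda>x. inner (k (fst x)) (snd x))"
    using PQ.integrable_fst'[OF int_h] integrable_cong_AE[OF hm km AE] by simp
  then show "integrable M (\<lambda>\<omega>. inner (k (V \<omega>)) (Z \<omega>))"
    unfolding P_def by (subst (asm) integrable_distr_eq[OF VZ km']) simp
  have "(\<integral>\<omega>. inner (nz (V \<omega>, Y \<omega>)) (Z \<omega>) \<partial>M) = (\<integral>\<omega>. h ((V \<omega>, Z \<omega>), Y \<omega>) \<partial>M)"
    by (simp add: h_def)
  also have "\<dots> = integral\<^sup>L (P \<Otimes>\<^sub>M Q) h"
    unfolding PQ by (rule integral_distr[symmetric]) measurable
  also have "\<dots> = (\<integral>x. (\<integral>y. h (x, y) \<partial>Q) \<partial>P)" by (rule PQ.integral_fst'[symmetric, OF int_h])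
  also have "\<dots> = (\<integral>x. inner (k (fst x)) (snd x) \<partial>P)" by (rule integral_cong_AE[OF hm km AE])
  also have "\<dots> = (\<integral>\<omega>. inner (k (V \<omega>)) (Z \<omega>) \<partial>M)"
    unfolding P_def by (subst integral_distr[OF VZ km']) simp
  finally show "(\<integral>\<omega>. inner (nz (V \<omega>, Y \<omega>)) (Z \<omega>) \<partial>M) = (\<integral>\<omega>. inner (k (V \<omega>)) (Z \<omega>) \<partial>M)" .
qed

context prob_space
begin

text \<open>This class is preserved by the whole recursion, since linear combinations and Lipschitz
  gradients stay in it, and it makes every inner product integrable.\<close>

definition sqi :: "('a \<Rightarrow> 'b::euclidean_space) \<Rightarrow> bool" where
  "sqi Z \<longleftrightarrow> Z \<in> borel_measurable M \<and> integrable M (\<lambda>\<omega>. (norm (Z \<omega>))\<^sup>2)"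

lemma sqi_measurable: "sqi Z \<Longrightarrow> Z \<in> borel_measurable M"
  by (simp add: sqi_def)

lemma sqi_integrable: "sqi Z \<Longrightarrow> integrable M (\<lambda>\<omega>. (norm (Z \<omega>))\<^sup>2)"
  by (simp add: sqi_def)

lemma sqi_bound:
  assumes "Z \<in> borel_measurable M" "integrable M b" "\<And>\<omega>. \<omega> \<in> space M \<Longrightarrow> (norm (Z \<omega>))\<^sup>2 \<le> b \<omega>"
  shows "sqi Z"
  unfolding sqi_def
proof (intro conjI Bochner_Integration.integrable_bound[OF assms(2)])
  show "AE \<omega> in M. norm ((norm (Z \<omega>))\<^sup>2) \<le> norm (b \<omega>)"
    using assms(3) by (intro AE_I2) (metis abs_ge_self abs_of_nonneg order_trans real_norm_def zero_le_power2)
qed (use assms(1) in auto)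

lemma sqi_const: "sqi (\<lambda>_. c)"
  by (simp add: sqi_def)

lemma sqi_scaleR: "sqi Z \<Longrightarrow> sqi (\<lambda>\<omega>. c *\<^sub>R Z \<omega>)"
  by (auto simp: sqi_def power_mult_distrib intro: borel_measurable_scaleR)

lemma sqi_add: assumes "sqi Z" "sqi Z'" shows "sqi (\<lambda>\<omega>. Z \<omega> + Z' \<omega>)"
proof (rule sqi_bound)
  show "integrable M (\<lambda>\<omega>. 2 * (norm (Z \<omega>))\<^sup>2 + 2 * (norm (Z' \<omega>))\<^sup>2)"
    using assms by (simp add: sqi_def)
qed (use assms in \<open>auto simp: sqi_def intro: norm_add2_squared_le\<close>)

lemma sqi_diff: assumes "sqi Z" "sqi Z'" shows "sqi (\<lambda>\<omega>. Z \<omega> - Z' \<omega>)"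
proof (rule sqi_bound)
  show "integrable M (\<lambda>\<omega>. 2 * (norm (Z \<omega>))\<^sup>2 + 2 * (norm (Z' \<omega>))\<^sup>2)"
    using assms by (simp add: sqi_def)
qed (use assms in \<open>auto simp: sqi_def intro: norm_diff2_squared_le\<close>)

lemma sqi_sum: "(\<And>i. i \<in> I \<Longrightarrow> sqi (Z i)) \<Longrightarrow> sqi (\<lambda>\<omega>. \<Sum>i\<in>I. Z i \<omega>)"
  by (induction I rule: infinite_finite_induct) (auto intro: sqi_add sqi_const)

lemma sqi_lipschitz:
  assumes Z: "sqi Z" and lip: "\<And>u v. norm (g u - g v) \<le> L * norm (u - v)" and L: "0 \<le> L"
  shows "sqi (\<lambda>\<omega>. g (Z \<omega>))"
proof (rule sqi_bound)
  show "(\<lambda>\<omega>. g (Z \<omega>)) \<in> borel_measurable M"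
    using borel_measurable_of_lipschitz[OF lip L] Z by (auto simp: sqi_def)
  show "integrable M (\<lambda>\<omega>. 2 * (norm (g 0))\<^sup>2 + 2 * (L\<^sup>2 * (norm (Z \<omega>))\<^sup>2))"
    using Z by (simp add: sqi_def)
  fix \<omega>
  have "(norm (g (Z \<omega>)))\<^sup>2 \<le> 2 * (norm (g 0))\<^sup>2 + 2 * (norm (g (Z \<omega>) - g 0))\<^sup>2"
    using norm_add2_squared_le[of "g 0" "g (Z \<omega>) - g 0"] by simp
  moreover have "(norm (g (Z \<omega>) - g 0))\<^sup>2 \<le> (L * norm (Z \<omega>))\<^sup>2"
    using lip[of "Z \<omega>" 0] by (intro power_mono) auto
  ultimately show "(norm (g (Z \<omega>)))\<^sup>2 \<le> 2 * (norm (g 0))\<^sup>2 + 2 * (L\<^sup>2 * (norm (Z \<omega>))\<^sup>2)"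
    by (simp add: power_mult_distrib)
qed

lemma sqi_inner_integrable: assumes "sqi Z" "sqi Z'" shows "integrable M (\<lambda>\<omega>. inner (Z \<omega>) (Z' \<omega>))"
proof (rule Bochner_Integration.integrable_bound)
  show "integrable M (\<lambda>\<omega>. (norm (Z \<omega>))\<^sup>2 + (norm (Z' \<omega>))\<^sup>2)" using assms by (simp add: sqi_def)
  show "(\<lambda>\<omega>. inner (Z \<omega>) (Z' \<omega>)) \<in> borel_measurable M"
    using assms by (auto simp: sqi_def intro: borel_measurable_inner)
  show "AE \<omega> in M. norm (inner (Z \<omega>) (Z' \<omega>)) \<le> norm ((norm (Z \<omega>))\<^sup>2 + (norm (Z' \<omega>))\<^sup>2)"
  proof (rule AE_I2)
    fix \<omega>
    have "\<bar>inner (Z \<omega>) (Z' \<omega>)\<bar> \<le> norm (Z \<omega>) * norm (Z' \<omega>)" by (rule Cauchy_Schwarz_ineq2)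
    also have "\<dots> \<le> (norm (Z \<omega>))\<^sup>2 + (norm (Z' \<omega>))\<^sup>2"
    proof -
      have "0 \<le> (norm (Z \<omega>) - norm (Z' \<omega>))\<^sup>2" by simp
      moreover have "0 \<le> norm (Z \<omega>) * norm (Z' \<omega>)" by simp
      ultimately show ?thesis unfolding power2_diff by linarith
    qed
    finally show "norm (inner (Z \<omega>) (Z' \<omega>)) \<le> norm ((norm (Z \<omega>))\<^sup>2 + (norm (Z' \<omega>))\<^sup>2)" by simp
  qed
qed

lemma sqi_imp_integrable: assumes "sqi Z" shows "integrable M Z"
proof (rule Bochner_Integration.integrable_bound)
  show "integrable M (\<lambda>\<omega>. 1 + (norm (Z \<omega>))\<^sup>2)" using assms by (simp add: sqi_def)
  show "AE \<omega> in M. norm (Z \<omega>) \<le> norm (1 + (norm (Z \<omega>))\<^sup>2)"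
  proof (rule AE_I2)
    fix \<omega>
    have "0 \<le> (norm (Z \<omega>) - 1)\<^sup>2" by simp
    then have "2 * norm (Z \<omega>) \<le> (norm (Z \<omega>))\<^sup>2 + 1" unfolding power2_diff by simp
    with norm_ge_zero[of "Z \<omega>"] have "norm (Z \<omega>) \<le> 1 + (norm (Z \<omega>))\<^sup>2" by linarith
    then show "norm (Z \<omega>) \<le> norm (1 + (norm (Z \<omega>))\<^sup>2)" by simp
  qed
qed (use assms in \<open>simp add: sqi_def\<close>)

text \<open>After expanding the square only the diagonal survives, so the bound grows with the
  number of summands and not with its square.\<close>

lemma orthogonal_sum_second_moment:
  assumes "finite A" "\<And>k. k \<in> A \<Longrightarrow> sqi (Z k)"
    and "\<And>k k'. k \<in> A \<Longrightarrow> k' \<in> A \<Longrightarrow> k \<noteq> k' \<Longrightarrow> (\<integral>\<omega>. inner (Z k \<omega>) (Z k' \<omega>) \<partial>M) = 0"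
    and "\<And>k. k \<in> A \<Longrightarrow> (\<integral>\<omega>. (norm (Z k \<omega>))\<^sup>2 \<partial>M) \<le> B"
  shows "(\<integral>\<omega>. (norm (\<Sum>k\<in>A. Z k \<omega>))\<^sup>2 \<partial>M) \<le> real (card A) * B"
proof -
  have "(\<integral>\<omega>. (norm (\<Sum>k\<in>A. Z k \<omega>))\<^sup>2 \<partial>M) = (\<integral>\<omega>. (\<Sum>k\<in>A. \<Sum>k'\<in>A. inner (Z k \<omega>) (Z k' \<omega>)) \<partial>M)"
    by (simp add: power2_norm_eq_inner inner_sum_left inner_sum_right inner_commute)
  also have "\<dots> = (\<Sum>k\<in>A. \<Sum>k'\<in>A. \<integral>\<omega>. inner (Z k \<omega>) (Z k' \<omega>) \<partial>M)"
    using assms(2) by (simp add: Bochner_Integration.integral_sum sqi_inner_integrable)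
  also have "\<dots> = (\<Sum>k\<in>A. \<Sum>k'\<in>A. if k' = k then (\<integral>\<omega>. (norm (Z k \<omega>))\<^sup>2 \<partial>M) else 0)"
    using assms(3) by (intro sum.cong refl) (auto simp: power2_norm_eq_inner)
  also have "\<dots> = (\<Sum>k\<in>A. \<integral>\<omega>. (norm (Z k \<omega>))\<^sup>2 \<partial>M)" using assms(1) by simp
  also have "\<dots> \<le> (\<Sum>k\<in>A. B)" by (intro sum_mono assms(4))
  finally show ?thesis by simp
qed

end

section \<open>The stochastic process\<close>

locale led_process =
  led_costs N "\<lambda>i j. W $$ (i, j)" "mixing_rate N W" f L \<mu> xs + prob_space M
  for N :: nat and W :: "real mat" and f :: "nat \<Rightarrow> 'a::euclidean_space \<Rightarrow> real" and L \<mu> :: real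
    and xs :: 'a and M :: "'w measure" +
  fixes nb :: "nat \<Rightarrow> nat set" and \<tau> :: nat and \<alpha> \<sigma> :: real and S :: "nat \<Rightarrow> 's measure"
    and F :: "nat \<Rightarrow> 'a \<Rightarrow> 's \<Rightarrow> real" and \<xi> :: "nat \<Rightarrow> 'w \<Rightarrow> 's"
    and \<Xi> :: "nat \<Rightarrow> nat \<Rightarrow> nat \<Rightarrow> 'w \<Rightarrow> 's" and x0 y0 :: "nat \<Rightarrow> 'a"
  assumes net: "network_assumption N nb W" and alpha_pos: "\<alpha> > 0" and tau_pos: "\<tau> \<ge> 1"
    and mean_y0: "node_mean N y0 = 0"
    and run: "led_run M N nb W \<tau> \<alpha> (1 / real \<tau>) S F \<xi> \<Xi> f x0 y0 \<sigma>"
begin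

definition "XX r i \<omega> = led_x nb W \<tau> \<alpha> (1 / real \<tau>) (sample_grad F \<Xi> \<omega>) x0 y0 r i"
definition "YY r i \<omega> = led_y nb W \<tau> \<alpha> (1 / real \<tau>) (sample_grad F \<Xi> \<omega>) x0 y0 r i"
definition "PH r i t \<omega> = led_phi nb W \<tau> \<alpha> (1 / real \<tau>) (sample_grad F \<Xi> \<omega>) x0 y0 r i t"
definition "noise r i t \<omega> = sample_grad F \<Xi> \<omega> i r t (PH r i t \<omega>) - gradient (f i) (PH r i t \<omega>)"

lemma mix_eq_Wop: "i < N \<Longrightarrow> mix nb W u i = Wop u i"
  using mix_eq_sum[OF net] by (simp add: Wop_def)

lemma XX_0: "XX 0 i \<omega> = x0 i" and YY_0: "YY 0 i \<omega> = y0 i"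
  by (simp_all add: XX_def YY_def led_x_def led_y_def)

lemma PH_0: "PH r i 0 \<omega> = XX r i \<omega>"
  by (simp add: PH_def XX_def led_phi_def)

lemma PH_Suc: "PH r i (Suc t) \<omega> = PH r i t \<omega> - \<alpha> *\<^sub>R (gradient (f i) (PH r i t \<omega>) + noise r i t \<omega>)
    - (1 / real \<tau>) *\<^sub>R YY r i \<omega>"
  by (simp add: PH_def YY_def noise_def led_phi_def)

lemma XX_Suc: "i < N \<Longrightarrow> XX (Suc r) i \<omega> = Wop (\<lambda>j. PH r j \<tau> \<omega>) i"
  by (simp add: XX_def PH_def led_phi_def led_x_def led_y_def Let_def split_beta mix_eq_Wop)

lemma YY_Suc: "i < N \<Longrightarrow> YY (Suc r) i \<omega> = YY r i \<omega> + K (\<lambda>j. PH r j \<tau> \<omega>) i"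
  by (simp add: YY_def PH_def led_phi_def led_x_def led_y_def Let_def split_beta mix_eq_Wop K_def)

lemma mean_YY: "node_mean N (\<lambda>i. YY r i \<omega>) = 0"
proof (induction r)
  case 0
  then show ?case using mean_y0 by (simp add: YY_0)
next
  case (Suc r)
  have "node_mean N (\<lambda>i. YY (Suc r) i \<omega>) = node_mean N (\<lambda>i. YY r i \<omega> + K (\<lambda>j. PH r j \<tau> \<omega>) i)"
    by (intro node_mean_cong) (rule YY_Suc)
  then show ?case by (simp add: node_mean_add Suc node_mean_K)
qed

lemma led_mean_eq: "led_mean N nb W \<tau> \<alpha> (1 / real \<tau>) F \<Xi> x0 y0 r \<omega> = node_mean N (\<lambda>i. XX r i \<omega>)"
  by (simp add: led_mean_def XX_def[abs_def])

lemma Xi_measurable: "i < N \<Longrightarrow> t < \<tau> \<Longrightarrow> \<Xi> i r t \<in> measurable M (S i)"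
  using run by (simp add: led_run_def noise_assumption_def)

definition grad_map :: "nat \<Rightarrow> 'a \<times> 's \<Rightarrow> 'a" where
  "grad_map i = (\<lambda>(v, s). gradient (\<lambda>z. F i z s) v)"

lemma grad_map_measurable: "i < N \<Longrightarrow> grad_map i \<in> borel_measurable (borel \<Otimes>\<^sub>M S i)"
  unfolding grad_map_def using run
  by (intro borel_measurable_gradient) (auto simp: led_run_def stochastic_costs_def)

lemma gradient_measurable: "i < N \<Longrightarrow> gradient (f i) \<in> borel_measurable borel"
  using lip L_pos by (intro borel_measurable_of_lipschitz[of _ L]) auto

lemma noise_eq: "noise r i t \<omega> = grad_map i (PH r i t \<omega>, \<Xi> i r t \<omega>) - gradient (f i) (PH r i t \<omega>)"
  by (simp add: noise_def grad_map_def sample_grad_def)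

section \<open>Sigma-algebras generated by sets of samples\<close>

definition "slots = {..<N} \<times> (UNIV :: nat set) \<times> {..<\<tau>}"

text \<open>The samples of all nodes drawn before local step \<open>t\<close> of round
  \<open>r\<close>. Step \<open>t\<close> itself is excluded for every node, so
  \<open>past r 0\<close> is the information at the start of the round.\<close>

definition "past r t = {(i, q, s). i < N \<and> s < \<tau> \<and> (q < r \<or> q = r \<and> s < t)}"

definition samples :: "nat \<times> nat \<times> nat \<Rightarrow> 'w set set" where
  "samples = (\<lambda>(i, r, t). {\<Xi> i r t -` A \<inter> space M | A. A \<in> sets (S i)})"

definition gen :: "(nat \<times> nat \<times> nat) set \<Rightarrow> 'w measure" where
  "gen I = sigma (space M) (\<Union>k\<in>I. samples k)"

lemma space_gen [simp]: "space (gen I) = space M"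
  by (simp add: gen_def space_measure_of_conv)

lemma sets_gen: "sets (gen I) = sigma_sets (space M) (\<Union>k\<in>I. samples k)"
  unfolding gen_def by (intro sets_measure_of) (auto simp: samples_def)

lemma samples_sets: "k \<in> slots \<Longrightarrow> samples k \<subseteq> sets M"
  by (auto simp: samples_def slots_def intro!: measurable_sets Xi_measurable)

lemma gen_subset: "I \<subseteq> slots \<Longrightarrow> sets (gen I) \<subseteq> sets M"
  unfolding sets_gen by (intro sets.sigma_sets_subset) (use samples_sets in blast)

lemma measurable_gen_M: "X \<in> measurable (gen I) A \<Longrightarrow> I \<subseteq> slots \<Longrightarrow> X \<in> measurable M A"
  using gen_subset[of I] by (auto simp: measurable_def)

lemma measurable_gen_mono: "X \<in> measurable (gen I) A \<Longrightarrow> I \<subseteq> J \<Longrightarrow> X \<in> measurable (gen J) A"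
proof -
  assume "X \<in> measurable (gen I) A" "I \<subseteq> J"
  moreover from \<open>I \<subseteq> J\<close> have "sets (gen I) \<subseteq> sets (gen J)"
    unfolding sets_gen by (intro sigma_sets_mono') auto
  ultimately show ?thesis by (auto simp: measurable_def)
qed

lemma Xi_measurable_gen: "(i, r, t) \<in> I \<Longrightarrow> I \<subseteq> slots \<Longrightarrow> \<Xi> i r t \<in> measurable (gen I) (S i)"
proof (rule measurableI)
  fix A assume I: "(i, r, t) \<in> I" and A: "A \<in> sets (S i)"
  have "\<Xi> i r t -` A \<inter> space M \<in> samples (i, r, t)" using A by (auto simp: samples_def)
  then show "\<Xi> i r t -` A \<inter> space (gen I) \<in> sets (gen I)"
    unfolding sets_gen space_gen using I by (intro sigma_sets.Basic) blast
next
  fix \<omega> assume "(i, r, t) \<in> I" "I \<subseteq> slots" "\<omega> \<in> space (gen I)"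
  then show "\<Xi> i r t \<omega> \<in> space (S i)"
    using Xi_measurable[of i t r] by (auto simp: slots_def dest: measurable_space)
qed

lemma past_slots: "past r t \<subseteq> slots"
  by (auto simp: past_def slots_def)

lemma noise_measurable_gen:
  assumes "i < N" "t < \<tau>" and PH: "PH r i t \<in> borel_measurable (gen I)" and I: "(i, r, t) \<in> I" "I \<subseteq> slots"
  shows "noise r i t \<in> borel_measurable (gen I)"
proof -
  note [measurable] = PH Xi_measurable_gen[OF I] grad_map_measurable[OF assms(1)] gradient_measurable[OF assms(1)]
  show ?thesis unfolding noise_eq[abs_def] by measurable
qed

lemma PH_measurable_of_start:
  assumes i: "i < N" and X: "XX r i \<in> borel_measurable (gen (past r 0))"
    and Y: "YY r i \<in> borel_measurable (gen (past r 0))" and "t \<le> \<tau>"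
  shows "PH r i t \<in> borel_measurable (gen (past r t))"
  using assms(4)
proof (induction t)
  case 0
  then show ?case using X by (simp add: PH_0[abs_def])
next
  case (Suc t)
  have sub: "past r t \<subseteq> past r (Suc t)" "past r 0 \<subseteq> past r (Suc t)" by (auto simp: past_def)
  have PH: "PH r i t \<in> borel_measurable (gen (past r (Suc t)))"
    using Suc by (intro measurable_gen_mono[OF _ sub(1)]) simp
  have "(i, r, t) \<in> past r (Suc t)" using i Suc.prems by (auto simp: past_def)
  then have "noise r i t \<in> borel_measurable (gen (past r (Suc t)))"
    using Suc.prems by (intro noise_measurable_gen i PH past_slots) auto
  note [measurable] = this PH measurable_gen_mono[OF Y sub(2)] gradient_measurable[OF i]
  show ?case unfolding PH_Suc[abs_def] by measurable
qed

lemma start_measurable: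
  "\<forall>i<N. XX r i \<in> borel_measurable (gen (past r 0)) \<and> YY r i \<in> borel_measurable (gen (past r 0))"
proof (induction r)
  case 0
  then show ?case by (simp add: XX_0[abs_def] YY_0[abs_def])
next
  case (Suc r)
  have sub: "past r \<tau> \<subseteq> past (Suc r) 0" "past r 0 \<subseteq> past (Suc r) 0" by (auto simp: past_def)
  have PH: "PH r j \<tau> \<in> borel_measurable (gen (past (Suc r) 0))" if "j < N" for j
    using Suc that by (intro measurable_gen_mono[OF PH_measurable_of_start sub(1)]) auto
  have W: "(\<lambda>\<omega>. Wop (\<lambda>j. PH r j \<tau> \<omega>) i) \<in> borel_measurable (gen (past (Suc r) 0))" for i
    unfolding Wop_def by (intro borel_measurable_sum borel_measurable_scaleR borel_measurable_const PH) auto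
  show ?case
  proof (intro allI impI conjI)
    fix i assume i: "i < N"
    show "XX (Suc r) i \<in> borel_measurable (gen (past (Suc r) 0))"
      unfolding XX_Suc[OF i, abs_def] by (rule W)
    have "YY r i \<in> borel_measurable (gen (past (Suc r) 0))"
      using Suc i by (intro measurable_gen_mono[OF _ sub(2)]) auto
    then show "YY (Suc r) i \<in> borel_measurable (gen (past (Suc r) 0))"
      unfolding YY_Suc[OF i, abs_def] K_def by (intro borel_measurable_add borel_measurable_diff PH W i)
  qed
qed

lemma XX_measurable: "i < N \<Longrightarrow> XX r i \<in> borel_measurable (gen (past r 0))"
  and YY_measurable: "i < N \<Longrightarrow> YY r i \<in> borel_measurable (gen (past r 0))"
  using start_measurable by auto

lemma PH_measurable: "i < N \<Longrightarrow> t \<le> \<tau> \<Longrightarrow> PH r i t \<in> borel_measurable (gen (past r t))"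
  by (rule PH_measurable_of_start) (auto intro: XX_measurable YY_measurable)

lemma PH_measurable_M: "i < N \<Longrightarrow> t \<le> \<tau> \<Longrightarrow> PH r i t \<in> borel_measurable M"
  by (rule measurable_gen_M[OF PH_measurable past_slots])

lemma noise_measurable_M: "i < N \<Longrightarrow> t < \<tau> \<Longrightarrow> noise r i t \<in> borel_measurable M"
proof -
  assume it: "i < N" "t < \<tau>"
  then have "PH r i t \<in> borel_measurable (gen slots)"
    by (intro measurable_gen_mono[OF PH_measurable past_slots]) auto
  from noise_measurable_gen[OF it this] show ?thesis
    using it by (intro measurable_gen_M[of _ slots]) (auto simp: slots_def)
qed

section \<open>Conditioning on the iterates and the variance of a noise vector\<close>

abbreviation "hist r t \<equiv> history M N \<tau> (\<lambda>\<omega>. led_phi nb W \<tau> \<alpha> (1 / real \<tau>) (sample_grad F \<Xi> \<omega>) x0 y0) r t"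

lemma hist_eq: "hist r t = sigma (space M) {PH q j s -` A \<inter> space M | q j s A.
    j < N \<and> A \<in> sets borel \<and> (q < r \<and> s \<le> \<tau> \<or> q = r \<and> s \<le> t)}"
  unfolding history_def PH_def[abs_def] ..

lemma space_hist [simp]: "space (hist r t) = space M"
  by (simp add: history_def space_measure_of_conv)

lemma sets_hist: "sets (hist r t) = sigma_sets (space M) {PH q j s -` A \<inter> space M | q j s A.
    j < N \<and> A \<in> sets borel \<and> (q < r \<and> s \<le> \<tau> \<or> q = r \<and> s \<le> t)}"
  unfolding hist_eq by (intro sets_measure_of) auto

lemma hist_subalgebra: "t \<le> \<tau> \<Longrightarrow> subalgebra M (hist r t)"
proof -
  assume "t \<le> \<tau>"
  then have "sets (hist r t) \<subseteq> sets M"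
    unfolding sets_hist by (intro sets.sigma_sets_subset) (auto intro!: measurable_sets PH_measurable_M)
  then show ?thesis by (simp add: subalgebra_def)
qed

lemma PH_hist_measurable: "i < N \<Longrightarrow> PH r i t \<in> borel_measurable (hist r t)"
proof (rule measurableI)
  fix A :: "'a set" assume "i < N" "A \<in> sets borel"
  then show "PH r i t -` A \<inter> space (hist r t) \<in> sets (hist r t)"
    unfolding sets_hist space_hist by (intro sigma_sets.Basic) blast
qed simp

text \<open>The conditional bound is integrated against the constant 1. As it concerns the
  conditional expectation of a nonnegative function, finiteness is part of the result and square
  integrability need not be presupposed.\<close>

lemma noise_variance:
  assumes it: "i < N" "t < \<tau>"
  shows "sqi (noise r i t)" and "(\<integral>\<omega>. (norm (noise r i t \<omega>))\<^sup>2 \<partial>M) \<le> \<sigma>\<^sup>2"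
proof -
  interpret H: finite_measure_subalgebra M "hist r t"
    using hist_subalgebra[of t r] it by unfold_locales auto
  note [measurable] = noise_measurable_M[OF it, of r]
  have "AE \<omega> in M. nn_cond_exp M (hist r t) (\<lambda>\<omega>. ennreal ((norm (noise r i t \<omega>))\<^sup>2)) \<omega> \<le> ennreal (\<sigma>\<^sup>2)"
    using run it unfolding led_run_def noise_assumption_def noise_def[abs_def] PH_def[abs_def] by blast
  then have "(\<integral>\<^sup>+\<omega>. nn_cond_exp M (hist r t) (\<lambda>\<omega>. ennreal ((norm (noise r i t \<omega>))\<^sup>2)) \<omega> \<partial>M)
      \<le> (\<integral>\<^sup>+\<omega>. ennreal (\<sigma>\<^sup>2) \<partial>M)" by (rule nn_integral_mono_AE)
  also have "(\<integral>\<^sup>+\<omega>. nn_cond_exp M (hist r t) (\<lambda>\<omega>. ennreal ((norm (noise r i t \<omega>))\<^sup>2)) \<omega> \<partial>M)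
      = (\<integral>\<^sup>+\<omega>. ennreal ((norm (noise r i t \<omega>))\<^sup>2) \<partial>M)"
    using H.nn_cond_exp_intg[of "\<lambda>_. 1" "\<lambda>\<omega>. ennreal ((norm (noise r i t \<omega>))\<^sup>2)"] by simp
  also have "(\<integral>\<^sup>+\<omega>. ennreal (\<sigma>\<^sup>2) \<partial>M) = ennreal (\<sigma>\<^sup>2)" by (simp add: emeasure_space_1)
  finally have le: "(\<integral>\<^sup>+\<omega>. ennreal ((norm (noise r i t \<omega>))\<^sup>2) \<partial>M) \<le> ennreal (\<sigma>\<^sup>2)" .
  then have int: "integrable M (\<lambda>\<omega>. (norm (noise r i t \<omega>))\<^sup>2)"
    by (intro integrableI_nonneg) (auto intro: le_less_trans)
  then show "sqi (noise r i t)" by (simp add: sqi_def)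
  show "(\<integral>\<omega>. (norm (noise r i t \<omega>))\<^sup>2 \<partial>M) \<le> \<sigma>\<^sup>2"
    using le by (subst (asm) nn_integral_eq_integral[OF int]) (auto simp: ennreal_le_iff)
qed

lemma PH_sqi_of_start:
  assumes i: "i < N" and X: "sqi (XX r i)" and Y: "sqi (YY r i)" and "t \<le> \<tau>"
  shows "sqi (PH r i t)"
  using assms(4)
proof (induction t)
  case (Suc t)
  then have "sqi (PH r i t)" by simp
  moreover from this have "sqi (\<lambda>\<omega>. gradient (f i) (PH r i t \<omega>))"
    using lip[OF i] L_pos by (intro sqi_lipschitz[where g = "gradient (f i)" and L = L]) auto
  ultimately show ?case
    unfolding PH_Suc[abs_def] using Suc.prems Y i
    by (intro sqi_diff sqi_scaleR sqi_add noise_variance) auto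
qed (use X in \<open>simp add: PH_0[abs_def]\<close>)

lemma start_sqi: "\<forall>i<N. sqi (XX r i) \<and> sqi (YY r i)"
proof (induction r)
  case 0
  then show ?case by (simp add: XX_0[abs_def] YY_0[abs_def] sqi_const)
next
  case (Suc r)
  have PH: "sqi (PH r j \<tau>)" if "j < N" for j
    using Suc that by (intro PH_sqi_of_start) auto
  have W: "sqi (\<lambda>\<omega>. Wop (\<lambda>j. PH r j \<tau> \<omega>) i)" for i
    unfolding Wop_def by (intro sqi_sum sqi_scaleR PH) auto
  show ?case
  proof (intro allI impI conjI)
    fix i assume i: "i < N"
    show "sqi (XX (Suc r) i)" unfolding XX_Suc[OF i, abs_def] by (rule W)
    show "sqi (YY (Suc r) i)" unfolding YY_Suc[OF i, abs_def] K_def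
      using Suc i by (intro sqi_add sqi_diff PH W) auto
  qed
qed

lemma XX_sqi: "i < N \<Longrightarrow> sqi (XX r i)" and YY_sqi: "i < N \<Longrightarrow> sqi (YY r i)"
  using start_sqi by auto

lemma PH_sqi: "i < N \<Longrightarrow> t \<le> \<tau> \<Longrightarrow> sqi (PH r i t)"
  by (rule PH_sqi_of_start) (auto intro: XX_sqi YY_sqi)

text \<open>The preimages under one sample form a pi-system, so mutual independence may be grouped
  into the block \<open>I\<close> and the single remaining slot.\<close>

lemma sample_independent:
  assumes k: "(i, r, t) \<in> slots" "(i, r, t) \<notin> I" and I: "I \<subseteq> slots"
    and X: "X \<in> measurable (gen I) A" and a: "a \<in> sets A" and b: "b \<in> sets (S i)"
  shows "prob ((X -` a \<inter> space M) \<inter> (\<Xi> i r t -` b \<inter> space M))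
    = prob (X -` a \<inter> space M) * prob (\<Xi> i r t -` b \<inter> space M)"
proof -
  have "indep_vars (\<lambda>(i, r, t). S i) (\<lambda>(i, r, t). \<Xi> i r t) slots"
    using run by (simp add: led_run_def noise_assumption_def slots_def)
  then have "indep_sets (\<lambda>k. {(case k of (i, r, t) \<Rightarrow> \<Xi> i r t) -` A \<inter> space M | A.
      A \<in> sets (case k of (i, r, t) \<Rightarrow> S i)}) slots"
    unfolding indep_vars_def2 by blast
  also have "(\<lambda>k. {(case k of (i, r, t) \<Rightarrow> \<Xi> i r t) -` A \<inter> space M | A.
      A \<in> sets (case k of (i, r, t) \<Rightarrow> S i)}) = samples"
    by (auto simp: samples_def fun_eq_iff)
  finally have ind: "indep_sets samples slots" .
  have "indep_sets (\<lambda>j. sigma_sets (space M) (\<Union>k\<in>case_bool I {(i, r, t)} j. samples k)) UNIV"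
  proof (rule indep_sets_collect_sigma)
    show "indep_sets samples (\<Union>j\<in>UNIV. case_bool I {(i, r, t)} j)"
      by (rule indep_sets_mono_index[OF _ ind]) (use I k in \<open>auto split: bool.splits\<close>)
    show "disjoint_family_on (case_bool I {(i, r, t)}) UNIV"
      using k by (auto simp: disjoint_family_on_def split: bool.splits)
    show "Int_stable (samples k)" for k
    proof (cases k)
      case (fields j q s)
      show ?thesis unfolding Int_stable_def
      proof (intro ballI)
        fix P Q assume "P \<in> samples k" "Q \<in> samples k"
        then obtain C D where "C \<in> sets (S j)" "D \<in> sets (S j)"
          "P = \<Xi> j q s -` C \<inter> space M" "Q = \<Xi> j q s -` D \<inter> space M"
          by (auto simp: samples_def fields)
        then have "P \<inter> Q = \<Xi> j q s -` (C \<inter> D) \<inter> space M \<and> C \<inter> D \<in> sets (S j)" by auto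
        then have "\<exists>A. P \<inter> Q = \<Xi> j q s -` A \<inter> space M \<and> A \<in> sets (S j)" by (rule exI)
        then show "P \<inter> Q \<in> samples k" by (simp add: samples_def fields)
      qed
    qed
  qed
  then have "indep_sets (case_bool (sets (gen I)) (sets (gen {(i, r, t)}))) UNIV"
    by (rule indep_sets_mono_sets) (auto simp: sets_gen split: bool.splits)
  then have "indep_set (sets (gen I)) (sets (gen {(i, r, t)}))" by (simp add: indep_set_def)
  then show ?thesis
  proof (rule indep_setD)
    show "X -` a \<inter> space M \<in> sets (gen I)" using measurable_sets[OF X a] by simp
    show "\<Xi> i r t -` b \<inter> space M \<in> sets (gen {(i, r, t)})"
      using measurable_sets[OF Xi_measurable_gen[of i r t "{(i, r, t)}"] b] k by simp
  qed
qed

text \<open>\<open>Z\<close> may involve samples that other nodes draw in the same step, which the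
  history of iterates does not determine. The conditional mean assumption therefore does not apply
  to \<open>Z\<close> directly, and independence has to transfer it.\<close>

lemma noise_orthogonal:
  assumes it: "i < N" "t < \<tau>" and I: "I \<subseteq> slots" "(i, r, t) \<notin> I" "past r t \<subseteq> I"
    and Z: "Z \<in> borel_measurable (gen I)" "sqi Z"
  shows "(\<integral>\<omega>. inner (noise r i t \<omega>) (Z \<omega>) \<partial>M) = 0"
proof -
  define V where "V = PH r i t"
  define nz where "nz = (\<lambda>(v, s). grad_map i (v, s) - gradient (f i) v)"
  define k where "k v = (\<integral>y. nz (v, y) \<partial>distr M (S i) (\<Xi> i r t))" for v
  have slot: "(i, r, t) \<in> slots" using it by (simp add: slots_def)
  have nz[measurable]: "nz \<in> borel_measurable (borel \<Otimes>\<^sub>M S i)"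
    unfolding nz_def using grad_map_measurable[OF it(1)] gradient_measurable[OF it(1)] by measurable
  have noise: "noise r i t \<omega> = nz (V \<omega>, \<Xi> i r t \<omega>)" for \<omega>
    by (simp add: nz_def V_def noise_eq)
  have V: "V \<in> borel_measurable (gen I)"
    unfolding V_def using it by (intro measurable_gen_mono[OF PH_measurable I(3)]) auto
  note Vh[measurable] = PH_hist_measurable[OF it(1), of r t, folded V_def]
  \<comment> \<open>Kept general in \<open>U\<close>: it is needed for the test vectors below and,
    at the end, for \<open>Z\<close>.\<close>
  have main: "integrable M (\<lambda>\<omega>. inner (k (V \<omega>)) (U \<omega>))"
      "(\<integral>\<omega>. inner (noise r i t \<omega>) (U \<omega>) \<partial>M) = (\<integral>\<omega>. inner (k (V \<omega>)) (U \<omega>) \<partial>M)"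
      "k \<in> borel_measurable borel"
    if U: "U \<in> borel_measurable (gen I)" "sqi U" for U :: "'w \<Rightarrow> 'a"
  proof -
    have VU: "(\<lambda>\<omega>. (V \<omega>, U \<omega>)) \<in> measurable (gen I) (borel \<Otimes>\<^sub>M borel)" using V U(1) by measurable
    have i1: "integrable M (\<lambda>\<omega>. nz (V \<omega>, \<Xi> i r t \<omega>))"
      using sqi_imp_integrable[OF noise_variance(1)[OF it]] unfolding noise[symmetric] by simp
    have i2: "integrable M (\<lambda>\<omega>. inner (nz (V \<omega>, \<Xi> i r t \<omega>)) (U \<omega>))"
      using sqi_inner_integrable[OF noise_variance(1)[OF it] U(2)] unfolding noise[symmetric] by simp
    note fub = indep_integral_inner[OF measurable_gen_M[OF VU I(1)] Xi_measurable[OF it, of r]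
        sample_independent[OF slot I(2,1) VU] nz i1 i2]
    show "integrable M (\<lambda>\<omega>. inner (k (V \<omega>)) (U \<omega>))" unfolding k_def by (rule fub(1))
    show "(\<integral>\<omega>. inner (noise r i t \<omega>) (U \<omega>) \<partial>M) = (\<integral>\<omega>. inner (k (V \<omega>)) (U \<omega>) \<partial>M)"
      unfolding k_def noise by (rule fub(2))
    show "k \<in> borel_measurable borel" unfolding k_def[abs_def] by (rule fub(3))
  qed
  note [measurable] = main(3)[OF Z]
  interpret H: finite_measure_subalgebra M "hist r t"
    using hist_subalgebra[of t r] it by unfold_locales auto
  have "AE \<omega> in M. \<forall>b\<in>Basis. inner (k (V \<omega>)) b = 0"
  proof (rule AE_ball_countable'[OF _ countable_finite])
    fix b :: 'a assume b: "b \<in> Basis"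
    \<comment> \<open>The sign makes the test integral equal to the mean of
      \<open>\<bar>inner (k (V \<omega>)) b\<bar>\<close>. As a function of the current iterate it
      is measurable for the history, so the conditional mean assumption makes that integral
      vanish.\<close>
    define u where "u \<omega> = sgn (inner (k (V \<omega>)) b)" for \<omega>
    have u_hist[measurable]: "u \<in> borel_measurable (hist r t)" unfolding u_def[abs_def] by measurable
    have kV: "(\<lambda>\<omega>. k (V \<omega>)) \<in> borel_measurable (gen I)" using V by measurable
    have u_gen: "u \<in> borel_measurable (gen I)" unfolding u_def[abs_def] using kV by measurable
    have u_M[measurable]: "u \<in> borel_measurable M" by (rule measurable_gen_M[OF u_gen I(1)])
    have u_bd: "\<bar>u \<omega>\<bar> \<le> 1" for \<omega> by (simp add: u_def sgn_if)
    have U: "(\<lambda>\<omega>. u \<omega> *\<^sub>R b) \<in> borel_measurable (gen I)" using u_gen by measurable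
    have U_sqi: "sqi (\<lambda>\<omega>. u \<omega> *\<^sub>R b)"
    proof (rule sqi_bound[of _ "\<lambda>_. 1"])
      show "(norm (u \<omega> *\<^sub>R b))\<^sup>2 \<le> 1" for \<omega> using u_bd b by (simp add: abs_square_le_1)
    qed auto
    have bound_int: "integrable M (\<lambda>\<omega>. u \<omega> * inner (g \<omega>) b)" if "sqi g" for g :: "'w \<Rightarrow> 'a"
      using sqi_inner_integrable[OF that U_sqi] by simp
    have grad_sqi: "sqi (\<lambda>\<omega>. gradient (f i) (V \<omega>))"
      unfolding V_def using lip[OF it(1)] L_pos it
      by (intro sqi_lipschitz[where g = "gradient (f i)" and L = L] PH_sqi) auto
    define SG where "SG \<omega> = sample_grad F \<Xi> \<omega> i r t (V \<omega>)" for \<omega>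
    have SG: "SG = (\<lambda>\<omega>. noise r i t \<omega> + gradient (f i) (V \<omega>))"
      by (simp add: fun_eq_iff SG_def noise_def V_def)
    have SG_sqi: "sqi SG" unfolding SG by (intro sqi_add noise_variance grad_sqi it)
    have SG_M: "(\<lambda>\<omega>. inner (SG \<omega>) b) \<in> borel_measurable M"
      using sqi_measurable[OF SG_sqi] by measurable
    have ce: "AE \<omega> in M. real_cond_exp M (hist r t) (\<lambda>\<omega>. inner (SG \<omega>) b) \<omega> = inner (gradient (f i) (V \<omega>)) b"
    proof -
      have "AE \<omega> in M. \<forall>b\<in>Basis. real_cond_exp M (hist r t) (\<lambda>\<omega>. inner (SG \<omega>) b) \<omega> = inner (gradient (f i) (V \<omega>)) b"
        using run it unfolding led_run_def noise_assumption_def SG_def[abs_def] V_def PH_def[abs_def] by blast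
      then show ?thesis by eventually_elim (use b in auto)
    qed
    have "(\<integral>\<omega>. u \<omega> * inner (SG \<omega>) b \<partial>M) = (\<integral>\<omega>. u \<omega> * real_cond_exp M (hist r t) (\<lambda>\<omega>. inner (SG \<omega>) b) \<omega> \<partial>M)"
      by (rule H.real_cond_exp_intg(2)[symmetric, OF bound_int[OF SG_sqi] u_hist SG_M])
    also have "\<dots> = (\<integral>\<omega>. u \<omega> * inner (gradient (f i) (V \<omega>)) b \<partial>M)"
    proof (rule integral_cong_AE)
      show "AE \<omega> in M. u \<omega> * real_cond_exp M (hist r t) (\<lambda>\<omega>. inner (SG \<omega>) b) \<omega> = u \<omega> * inner (gradient (f i) (V \<omega>)) b"
        using ce by eventually_elim simp
      show "(\<lambda>\<omega>. u \<omega> * inner (gradient (f i) (V \<omega>)) b) \<in> borel_measurable M"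
        using bound_int[OF grad_sqi] by (rule borel_measurable_integrable)
    qed measurable
    finally have "(\<integral>\<omega>. u \<omega> * inner (SG \<omega>) b - u \<omega> * inner (gradient (f i) (V \<omega>)) b \<partial>M) = 0"
      using bound_int[OF SG_sqi] bound_int[OF grad_sqi] by (simp add: Bochner_Integration.integral_diff)
    then have "(\<integral>\<omega>. inner (noise r i t \<omega>) (u \<omega> *\<^sub>R b) \<partial>M) = 0"
      by (simp add: SG inner_add_left distrib_left)
    then have zero: "(\<integral>\<omega>. inner (k (V \<omega>)) (u \<omega> *\<^sub>R b) \<partial>M) = 0"
      using main(2)[OF U U_sqi] by simp
    have abs: "inner (k (V \<omega>)) (u \<omega> *\<^sub>R b) = \<bar>inner (k (V \<omega>)) b\<bar>" for \<omega>
      by (simp add: u_def mult.commute flip: abs_sgn)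
    have "AE \<omega> in M. \<bar>inner (k (V \<omega>)) b\<bar> = 0"
      using zero main(1)[OF U U_sqi] unfolding abs
      by (subst (asm) integral_nonneg_eq_0_iff_AE) auto
    then show "AE \<omega> in M. inner (k (V \<omega>)) b = 0" by eventually_elim simp
  qed simp
  then have "AE \<omega> in M. k (V \<omega>) = 0"
    by eventually_elim (simp add: euclidean_all_zero_iff)
  then have "AE \<omega> in M. inner (k (V \<omega>)) (Z \<omega>) = 0" by eventually_elim simp
  then have "(\<integral>\<omega>. inner (k (V \<omega>)) (Z \<omega>) \<partial>M) = 0" by (rule integral_eq_zero_AE)
  then show ?thesis using main(2)[OF Z] by simp
qed

end

section \<open>Second moments of the noise accumulated in a round\<close>

context led_process
begin

text \<open>Square-integrable vectors known at the start of round \<open>r\<close>; they are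
  orthogonal to all noise of that round.\<close>

definition psq :: "nat \<Rightarrow> ('w \<Rightarrow> 'b::euclidean_space) \<Rightarrow> bool" where
  "psq r Z \<longleftrightarrow> Z \<in> borel_measurable (gen (past r 0)) \<and> sqi Z"

lemma psq_const: "psq r (\<lambda>_. c)" by (simp add: psq_def sqi_const)

lemma psq_add: "psq r Z \<Longrightarrow> psq r Z' \<Longrightarrow> psq r (\<lambda>\<omega>. Z \<omega> + Z' \<omega>)"
  by (auto simp: psq_def intro: sqi_add)

lemma psq_diff: "psq r Z \<Longrightarrow> psq r Z' \<Longrightarrow> psq r (\<lambda>\<omega>. Z \<omega> - Z' \<omega>)"
  by (auto simp: psq_def intro: sqi_diff)

lemma psq_scaleR: "psq r Z \<Longrightarrow> psq r (\<lambda>\<omega>. c *\<^sub>R Z \<omega>)"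
  by (auto simp: psq_def intro!: sqi_scaleR borel_measurable_scaleR)

lemma psq_sum: "(\<And>i. i \<in> I \<Longrightarrow> psq r (Z i)) \<Longrightarrow> psq r (\<lambda>\<omega>. \<Sum>i\<in>I. Z i \<omega>)"
  by (auto simp: psq_def intro!: sqi_sum borel_measurable_sum)

lemma psq_lipschitz:
  assumes "psq r Z" "\<And>u v. norm (g u - g v) \<le> c * norm (u - v)" "0 \<le> c"
  shows "psq r (\<lambda>\<omega>. g (Z \<omega>))"
  using assms borel_measurable_of_lipschitz[OF assms(2,3)]
  by (auto simp: psq_def intro: sqi_lipschitz[OF _ assms(2,3)])

lemma psq_sqi: "psq r Z \<Longrightarrow> sqi Z" by (simp add: psq_def)

lemma psq_Wop: "(\<And>i. i < N \<Longrightarrow> psq r (\<lambda>\<omega>. u \<omega> i)) \<Longrightarrow> psq r (\<lambda>\<omega>. Wop (u \<omega>) i)"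
  unfolding Wop_def by (intro psq_sum psq_scaleR) auto

lemma psq_mean: "(\<And>i. i < N \<Longrightarrow> psq r (\<lambda>\<omega>. u \<omega> i)) \<Longrightarrow> psq r (\<lambda>\<omega>. node_mean N (u \<omega>))"
  unfolding node_mean_def by (intro psq_sum psq_scaleR) auto

lemma psq_T: "(\<And>i. i < N \<Longrightarrow> psq r (\<lambda>\<omega>. u \<omega> i)) \<Longrightarrow> psq r (\<lambda>\<omega>. T (u \<omega>) i)"
  unfolding T_def by (intro psq_diff psq_Wop psq_mean) auto

lemma psq_K: "(\<And>i. i < N \<Longrightarrow> psq r (\<lambda>\<omega>. u \<omega> i)) \<Longrightarrow> i < N \<Longrightarrow> psq r (\<lambda>\<omega>. K (u \<omega>) i)"
  unfolding K_def by (intro psq_diff psq_Wop) auto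

lemma psq_mat_op: "(\<And>i. i < N \<Longrightarrow> psq r (\<lambda>\<omega>. u \<omega> i)) \<Longrightarrow> psq r (\<lambda>\<omega>. mat_op N b (u \<omega>) i)"
  unfolding mat_op_def by (intro psq_sum psq_scaleR) auto

lemma psq_XX: "i < N \<Longrightarrow> psq r (XX r i)"
  using XX_measurable XX_sqi by (simp add: psq_def)

lemma psq_next: "psq r Z \<Longrightarrow> psq (Suc r) Z"
  unfolding psq_def by (auto intro!: measurable_gen_mono[of Z "past r 0"]) (auto simp: past_def)

lemma psq_PH: "i < N \<Longrightarrow> psq (Suc r) (PH r i \<tau>)"
  unfolding psq_def using PH_sqi
  by (auto intro!: measurable_gen_mono[OF PH_measurable[of i \<tau> r]]) (auto simp: past_def)

definition "xbar r \<omega> = node_mean N (\<lambda>i. XX r i \<omega>)"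

lemma xbar_Suc: "xbar (Suc r) \<omega> = node_mean N (\<lambda>j. PH r j \<tau> \<omega>)"
proof -
  have "xbar (Suc r) \<omega> = node_mean N (Wop (\<lambda>j. PH r j \<tau> \<omega>))"
    unfolding xbar_def by (intro node_mean_cong) (simp add: XX_Suc)
  then show ?thesis by (simp add: node_mean_Wop)
qed

lemma psq_xbar: "psq r (xbar r)"
  unfolding xbar_def[abs_def] by (intro psq_mean psq_XX)

lemma psq_dev: assumes "i < N" shows "psq r (\<lambda>\<omega>. dev (xbar r \<omega>) i)"
proof -
  have g: "psq r (\<lambda>\<omega>. gradient (f j) (xbar r \<omega>))" if "j < N" for j
    using lip[OF that] L_pos by (intro psq_lipschitz[OF psq_xbar, of "gradient (f j)" L]) auto
  show ?thesis unfolding dev_def gbar_def by (intro psq_diff psq_mean g assms)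
qed

lemma ip_integrable:
  assumes "\<And>i. i < N \<Longrightarrow> sqi (\<lambda>\<omega>. u \<omega> i)" "\<And>i. i < N \<Longrightarrow> sqi (\<lambda>\<omega>. v \<omega> i)"
  shows "integrable M (\<lambda>\<omega>. ip N (u \<omega>) (v \<omega>))"
  unfolding ip_def using assms by (intro Bochner_Integration.integrable_sum sqi_inner_integrable) auto

lemma energy_integrable:
  assumes "\<And>i. i < N \<Longrightarrow> psq r (\<lambda>\<omega>. p \<omega> i)" "\<And>i. i < N \<Longrightarrow> psq r (\<lambda>\<omega>. z \<omega> i)"
  shows "integrable M (\<lambda>\<omega>. energy (p \<omega>) (z \<omega>))"
  unfolding energy_def using assms
  by (intro Bochner_Integration.integrable_add ip_integrable) (auto intro!: psq_sqi psq_T psq_K)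

lemma gap_integrable:
  assumes "sqi Z" shows "integrable M (\<lambda>\<omega>. gap (Z \<omega>))"
proof (rule Bochner_Integration.integrable_bound)
  have "sqi (\<lambda>\<omega>. Z \<omega> - xs)" by (intro sqi_diff assms sqi_const)
  then show "integrable M (\<lambda>\<omega>. L / 2 * (norm (Z \<omega> - xs))\<^sup>2)" by (simp add: sqi_def)
  show "AE \<omega> in M. norm (gap (Z \<omega>)) \<le> norm (L / 2 * (norm (Z \<omega> - xs))\<^sup>2)"
    using gap_nonneg gap_le L_pos by (intro AE_I2) simp
  have "continuous_on UNIV (f i)" if "i < N" for i
    using diff[OF that] by (simp add: continuous_on_eq_continuous_at differentiable_imp_continuous_within)
  then have "continuous_on UNIV gap"
    unfolding gap_def[abs_def] avg_fun_def[abs_def] by (intro continuous_intros) auto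
  then have "gap \<in> borel_measurable borel" by (rule borel_measurable_continuous_onI)
  then show "(\<lambda>\<omega>. gap (Z \<omega>)) \<in> borel_measurable M"
    using sqi_measurable[OF assms] by measurable
qed

text \<open>By symmetry the noise of the later step is the one that is averaged out. The slot of the
  other one is adjoined to \<open>past r t\<close>, which is a real enlargement exactly when both
  belong to the same step at different nodes.\<close>

lemma noise_pair_orthogonal:
  assumes "i < N" "t < \<tau>" "j < N" "s < \<tau>" "(i, t) \<noteq> (j, s)"
  shows "(\<integral>\<omega>. inner (noise r i t \<omega>) (noise r j s \<omega>) \<partial>M) = 0"
proof -
  have *: "(\<integral>\<omega>. inner (noise r i t \<omega>) (noise r j s \<omega>) \<partial>M) = 0"
    if "i < N" "t < \<tau>" "j < N" "s < \<tau>" "(i, t) \<noteq> (j, s)" "s \<le> t" for i j s t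
  proof (rule noise_orthogonal)
    let ?I = "insert (j, r, s) (past r t)"
    show "?I \<subseteq> slots" using that past_slots[of r t] by (auto simp: slots_def)
    show "(i, r, t) \<notin> ?I" using that by (auto simp: past_def)
    have "past r s \<subseteq> ?I" using that by (auto simp: past_def)
    then have "PH r j s \<in> borel_measurable (gen ?I)"
      using that by (intro measurable_gen_mono[OF PH_measurable]) auto
    then show "noise r j s \<in> borel_measurable (gen ?I)"
      using that \<open>?I \<subseteq> slots\<close> by (intro noise_measurable_gen) auto
  qed (use that noise_variance in auto)
  show ?thesis
  proof (cases "s \<le> t")
    case True
    then show ?thesis using * assms by blast
  next
    case False
    then have "(\<integral>\<omega>. inner (noise r j s \<omega>) (noise r i t \<omega>) \<partial>M) = 0" using * assms by auto
    then show ?thesis by (simp add: inner_commute)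
  qed
qed

lemma past_noise_orthogonal:
  assumes "i < N" "t < \<tau>" "psq r Z"
  shows "(\<integral>\<omega>. inner (Z \<omega>) (noise r i t \<omega>) \<partial>M) = 0"
proof -
  have "past r 0 \<subseteq> past r t" by (auto simp: past_def)
  then have "Z \<in> borel_measurable (gen (past r t))"
    using assms(3) by (auto simp: psq_def intro: measurable_gen_mono)
  then have "(\<integral>\<omega>. inner (noise r i t \<omega>) (Z \<omega>) \<partial>M) = 0"
    using assms by (intro noise_orthogonal[of i t "past r t"] past_slots) (auto simp: psq_def past_def)
  then show ?thesis by (simp add: inner_commute)
qed

lemma integral_double_sum:
  fixes g :: "nat \<Rightarrow> nat \<Rightarrow> 'w \<Rightarrow> real"
  assumes "\<And>i t. i < n \<Longrightarrow> t < m \<Longrightarrow> integrable M (g i t)"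
  shows "(\<integral>\<omega>. (\<Sum>i<n. \<Sum>t<m. g i t \<omega>) \<partial>M) = (\<Sum>i<n. \<Sum>t<m. \<integral>\<omega>. g i t \<omega> \<partial>M)"
proof -
  have "(\<integral>\<omega>. (\<Sum>i<n. \<Sum>t<m. g i t \<omega>) \<partial>M) = (\<Sum>i<n. \<integral>\<omega>. (\<Sum>t<m. g i t \<omega>) \<partial>M)"
    using assms by (intro Bochner_Integration.integral_sum Bochner_Integration.integrable_sum) auto
  also have "\<dots> = (\<Sum>i<n. \<Sum>t<m. \<integral>\<omega>. g i t \<omega> \<partial>M)"
    using assms by (intro sum.cong refl Bochner_Integration.integral_sum) auto
  finally show ?thesis .
qed

lemma noise_sum_time:
  assumes "i < N" "t \<le> \<tau>"
  shows "(\<integral>\<omega>. (norm (\<Sum>s<t. noise r i s \<omega>))\<^sup>2 \<partial>M) \<le> real t * \<sigma>\<^sup>2"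
  using orthogonal_sum_second_moment[of "{..<t}" "noise r i" "\<sigma>\<^sup>2"] assms
  by (simp add: noise_variance noise_pair_orthogonal)

lemma noise_sum_sqi: "i < N \<Longrightarrow> t \<le> \<tau> \<Longrightarrow> sqi (\<lambda>\<omega>. \<Sum>s<t. noise r i s \<omega>)"
  by (intro sqi_sum noise_variance) auto

definition "nbar r \<omega> = node_mean N (\<lambda>i. \<Sum>t<\<tau>. noise r i t \<omega>)"

lemma nbar_sqi: "sqi (nbar r)"
  unfolding nbar_def[abs_def] node_mean_def by (intro sqi_scaleR sqi_sum noise_sum_sqi noise_variance) auto

text \<open>\<open>N * \<tau>\<close> orthogonal vectors are divided by \<open>N\<close>, which is
  the origin of the factor \<open>1 / N\<close> in the leading noise term.\<close>

lemma nbar_variance: "(\<integral>\<omega>. (norm (nbar r \<omega>))\<^sup>2 \<partial>M) \<le> real \<tau> * \<sigma>\<^sup>2 / real N"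
proof -
  let ?A = "{..<N} \<times> {..<\<tau>}"
  let ?S = "\<lambda>\<omega>. \<Sum>k\<in>?A. noise r (fst k) (snd k) \<omega>"
  have le: "(\<integral>\<omega>. (norm (?S \<omega>))\<^sup>2 \<partial>M) \<le> real (card ?A) * \<sigma>\<^sup>2"
    by (intro orthogonal_sum_second_moment noise_pair_orthogonal) (auto simp: noise_variance)
  have "nbar r \<omega> = (1 / real N) *\<^sub>R ?S \<omega>" for \<omega>
    by (simp add: nbar_def node_mean_def sum.cartesian_product split_beta)
  then have eq: "(\<integral>\<omega>. (norm (nbar r \<omega>))\<^sup>2 \<partial>M) = (1 / real N)\<^sup>2 * (\<integral>\<omega>. (norm (?S \<omega>))\<^sup>2 \<partial>M)"
    by (simp add: power_mult_distrib power_divide)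
  have "(\<integral>\<omega>. (norm (nbar r \<omega>))\<^sup>2 \<partial>M) \<le> (1 / real N)\<^sup>2 * (real (card ?A) * \<sigma>\<^sup>2)"
    unfolding eq by (intro mult_left_mono le) simp
  also have "\<dots> = real \<tau> * \<sigma>\<^sup>2 / real N"
    using N_pos by (simp add: card_cartesian_product power2_eq_square)
  finally show ?thesis .
qed

lemma past_nbar_orthogonal:
  assumes "psq r Z" shows "(\<integral>\<omega>. inner (Z \<omega>) (nbar r \<omega>) \<partial>M) = 0"
proof -
  have "(\<integral>\<omega>. inner (Z \<omega>) (nbar r \<omega>) \<partial>M)
      = (1 / real N) * (\<integral>\<omega>. (\<Sum>i<N. \<Sum>t<\<tau>. inner (Z \<omega>) (noise r i t \<omega>)) \<partial>M)"
    by (simp add: nbar_def node_mean_def inner_sum_right)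
  also have "\<dots> = (1 / real N) * (\<Sum>i<N. \<Sum>t<\<tau>. \<integral>\<omega>. inner (Z \<omega>) (noise r i t \<omega>) \<partial>M)"
    using assms by (subst integral_double_sum) (auto intro!: sqi_inner_integrable[OF psq_sqi noise_variance(1)])
  finally show ?thesis using assms by (simp add: past_noise_orthogonal)
qed

definition "nn r \<omega> i = \<alpha> *\<^sub>R (\<Sum>t<\<tau>. noise r i t \<omega>)"

lemma nn_sqi: "i < N \<Longrightarrow> sqi (\<lambda>\<omega>. nn r \<omega> i)"
  unfolding nn_def by (intro sqi_scaleR noise_sum_sqi) auto

lemma nn_second_moment: "(\<integral>\<omega>. ip N (nn r \<omega>) (nn r \<omega>) \<partial>M) \<le> real N * (\<alpha>\<^sup>2 * real \<tau> * \<sigma>\<^sup>2)"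
proof -
  have "(\<integral>\<omega>. ip N (nn r \<omega>) (nn r \<omega>) \<partial>M) = (\<Sum>i<N. \<alpha>\<^sup>2 * (\<integral>\<omega>. (norm (\<Sum>t<\<tau>. noise r i t \<omega>))\<^sup>2 \<partial>M))"
    unfolding ip_self nn_def using noise_sum_sqi
    by (simp add: Bochner_Integration.integral_sum power_mult_distrib sqi_integrable)
  also have "\<dots> \<le> (\<Sum>i<N. \<alpha>\<^sup>2 * (real \<tau> * \<sigma>\<^sup>2))"
    by (intro sum_mono mult_left_mono noise_sum_time) auto
  finally show ?thesis by (simp add: mult.assoc)
qed

lemma past_nn_orthogonal:
  assumes "\<And>i. i < N \<Longrightarrow> psq r (\<lambda>\<omega>. V \<omega> i)"
  shows "(\<integral>\<omega>. ip N (V \<omega>) (nn r \<omega>) \<partial>M) = 0"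
proof -
  have "(\<integral>\<omega>. ip N (V \<omega>) (nn r \<omega>) \<partial>M)
      = (\<integral>\<omega>. (\<Sum>i<N. \<Sum>t<\<tau>. \<alpha> * inner (V \<omega> i) (noise r i t \<omega>)) \<partial>M)"
    by (simp add: ip_def nn_def inner_sum_right sum_distrib_left)
  also have "\<dots> = (\<Sum>i<N. \<Sum>t<\<tau>. \<integral>\<omega>. \<alpha> * inner (V \<omega> i) (noise r i t \<omega>) \<partial>M)"
    using assms by (intro integral_double_sum)
      (auto intro!: integrable_mult_right sqi_inner_integrable[OF psq_sqi noise_variance(1)])
  finally show ?thesis using assms by (simp add: past_noise_orthogonal)
qed

definition "NN r \<omega> = (\<Sum>i<N. \<Sum>t<\<tau>. (norm (\<Sum>s<t. noise r i s \<omega>))\<^sup>2)"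

lemma NN_integrable: "integrable M (NN r)"
  unfolding NN_def[abs_def]
  by (intro Bochner_Integration.integrable_sum sqi_integrable noise_sum_sqi) auto

lemma NN_expectation: "(\<integral>\<omega>. NN r \<omega> \<partial>M) \<le> real N * real \<tau> * (real \<tau> * \<sigma>\<^sup>2)"
proof -
  have "(\<integral>\<omega>. NN r \<omega> \<partial>M) = (\<Sum>i<N. \<Sum>t<\<tau>. \<integral>\<omega>. (norm (\<Sum>s<t. noise r i s \<omega>))\<^sup>2 \<partial>M)"
    unfolding NN_def by (intro integral_double_sum sqi_integrable noise_sum_sqi) auto
  also have "\<dots> \<le> (\<Sum>i<N. \<Sum>t<\<tau>. real \<tau> * \<sigma>\<^sup>2)"
  proof (intro sum_mono)
    fix i t assume "i \<in> {..<N}" "t \<in> {..<\<tau>}"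
    then have "(\<integral>\<omega>. (norm (\<Sum>s<t. noise r i s \<omega>))\<^sup>2 \<partial>M) \<le> real t * \<sigma>\<^sup>2" by (intro noise_sum_time) auto
    also have "\<dots> \<le> real \<tau> * \<sigma>\<^sup>2" using \<open>t \<in> {..<\<tau>}\<close> by (intro mult_right_mono) auto
    finally show "(\<integral>\<omega>. (norm (\<Sum>s<t. noise r i s \<omega>))\<^sup>2 \<partial>M) \<le> real \<tau> * \<sigma>\<^sup>2" .
  qed
  finally show ?thesis by simp
qed

end

section \<open>Expected recursions\<close>

text \<open>\<open>tp\<close> and \<open>tz\<close> are the part of the consensus error that propagates deterministically from the start;
  it is kept apart because it has to enter the descent inequality linearly.\<close>

locale led_energy = led_process N W f L \<mu> xs M nb \<tau> \<alpha> \<sigma> S F \<xi> \<Xi> x0 y0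
  for N W and f :: "nat \<Rightarrow> 'a::euclidean_space \<Rightarrow> real" and L \<mu> xs and M :: "'w measure"
    and nb \<tau> \<alpha> \<sigma> and S :: "nat \<Rightarrow> 's measure" and F \<xi> \<Xi> x0 y0 +
  fixes b :: "nat \<Rightarrow> nat \<Rightarrow> real" and \<kappa> :: real and p0 z0 :: "nat \<Rightarrow> 'a"
    and tp tz :: "nat \<Rightarrow> nat \<Rightarrow> 'a"
  assumes small: "\<alpha> * real \<tau> * L \<le> 1 / 16"
    and kappa_nonneg: "0 \<le> \<kappa>"
    and b_inverse: "\<And>(h :: nat \<Rightarrow> 'a) i. node_mean N h = 0 \<Longrightarrow> i < N \<Longrightarrow> K (mat_op N b h) i = h i"
    and b_bounded: "\<And>h :: nat \<Rightarrow> 'a. ip N (mat_op N b h) (mat_op N b h) \<le> \<kappa> * ip N h h"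
    and p0: "\<And>i. i < N \<Longrightarrow> T p0 i = x0 i - node_mean N x0"
    and z0: "\<And>i. i < N \<Longrightarrow> K z0 i = y0 i"
    and tp_Suc: "\<And>r i. tp (Suc r) i = T (tp r) i - K (tz r) i"
    and tz_Suc: "\<And>r i. tz (Suc r) i = tz r i + tp (Suc r) i"
begin

abbreviation "a \<equiv> \<alpha> * real \<tau>"
abbreviation "l \<equiv> \<alpha> * real \<tau> * L"

text \<open>After a round \<open>x\<close> is the mixture of the local iterates, so these are a
  preimage of the consensus error under \<open>T\<close>; only the start \<open>p0\<close> has to be
  found separately.\<close>

primrec pp :: "nat \<Rightarrow> 'w \<Rightarrow> nat \<Rightarrow> 'a" where
  "pp 0 \<omega> = p0"
| "pp (Suc r) \<omega> = (\<lambda>i. PH r i \<tau> \<omega>)"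

text \<open>\<open>y\<close> accumulates \<open>K\<close> of the local iterates, so their running
  sum is a preimage of \<open>y\<close> under \<open>K\<close>.\<close>

primrec zz :: "nat \<Rightarrow> 'w \<Rightarrow> nat \<Rightarrow> 'a" where
  "zz 0 \<omega> = z0"
| "zz (Suc r) \<omega> = (\<lambda>i. zz r \<omega> i + PH r i \<tau> \<omega>)"

text \<open>A preimage of the gradient deviation under \<open>K\<close>; it turns the shift of
  \<open>y\<close> by \<open>a * dev\<close> into a shift of \<open>z\<close>.\<close>

definition "eta r \<omega> = mat_op N b (dev (xbar r \<omega>))"
definition "qp r \<omega> i = pp r \<omega> i - tp r i"
definition "qz r \<omega> i = zz r \<omega> i + a *\<^sub>R eta r \<omega> i - tz r i"

lemma T_pp: "i < N \<Longrightarrow> T (pp r \<omega>) i = XX r i \<omega> - xbar r \<omega>"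
proof (cases r)
  case 0
  assume "i < N"
  then show ?thesis using p0 0 by (simp add: XX_0 xbar_def)
next
  case (Suc r')
  assume i: "i < N"
  then show ?thesis unfolding Suc by (simp add: T_def XX_Suc[OF i] xbar_Suc)
qed

lemma K_zz: "i < N \<Longrightarrow> K (zz r \<omega>) i = YY r i \<omega>"
proof (induction r)
  case 0
  then show ?case using z0 by (simp add: YY_0)
next
  case (Suc r)
  then show ?case by (simp add: K_add YY_Suc)
qed

lemma K_eta: "i < N \<Longrightarrow> K (eta r \<omega>) i = dev (xbar r \<omega>) i"
  unfolding eta_def by (rule b_inverse[OF node_mean_dev])

lemma split_XX: "i < N \<Longrightarrow> XX r i \<omega> - xbar r \<omega> = T (tp r) i + T (qp r \<omega>) i"
  unfolding qp_def[abs_def] T_diff by (simp add: T_pp)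

lemma split_YY: "i < N \<Longrightarrow> YY r i \<omega> + a *\<^sub>R dev (xbar r \<omega>) i = K (tz r) i + K (qz r \<omega>) i"
  unfolding qz_def[abs_def] K_diff K_add K_scaleR by (simp add: K_zz K_eta)

lemma round: "led_round N (\<lambda>i j. W $$ (i, j)) (mixing_rate N W) f L \<mu> xs \<alpha> \<tau> (\<lambda>i. XX r i \<omega>) (\<lambda>i. YY r i \<omega>)
    (\<lambda>i t. PH r i t \<omega>) (\<lambda>i t. noise r i t \<omega>) (T (tp r)) (K (tz r)) (T (qp r \<omega>)) (K (qz r \<omega>))"
  by unfold_locales
    (use alpha_pos tau_pos small mean_YY split_XX[unfolded xbar_def] split_YY[unfolded xbar_def] in
      \<open>auto simp: PH_0 PH_Suc\<close>)

lemma psq_pp: "i < N \<Longrightarrow> psq r (\<lambda>\<omega>. pp r \<omega> i)"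
  by (cases r) (auto intro: psq_const psq_PH)

lemma psq_zz: "i < N \<Longrightarrow> psq r (\<lambda>\<omega>. zz r \<omega> i)"
proof (induction r)
  case (Suc r)
  then show ?case by (simp, intro psq_add psq_next[of r "\<lambda>\<omega>. zz r \<omega> i"] psq_PH) auto
qed (simp add: psq_const)

lemma psq_eta: "psq r (\<lambda>\<omega>. eta r \<omega> i)"
  unfolding eta_def by (intro psq_mat_op psq_dev)

lemma psq_qp: "i < N \<Longrightarrow> psq r (\<lambda>\<omega>. qp r \<omega> i)"
  unfolding qp_def by (intro psq_diff psq_pp psq_const)

lemma psq_qz: "i < N \<Longrightarrow> psq r (\<lambda>\<omega>. qz r \<omega> i)"
  unfolding qz_def by (intro psq_diff psq_add psq_scaleR psq_zz psq_eta psq_const)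

definition "dist2 r = (\<integral>\<omega>. (norm (xbar r \<omega> - xs))\<^sup>2 \<partial>M)"
definition "Egap r = (\<integral>\<omega>. gap (xbar r \<omega>) \<partial>M)"
definition "Q r = (\<integral>\<omega>. energy (qp r \<omega>) (qz r \<omega>) \<partial>M) / real N"
definition "h r = energy (tp r) (tz r) / real N"
definition "s2 = \<alpha>\<^sup>2 * (real \<tau> * \<sigma>\<^sup>2)"

lemma N_real_pos: "0 < real N" using N_pos by simp

lemma tau_real_pos: "0 < real \<tau>" using tau_pos by simp

lemma l_pos: "0 < l" using alpha_pos tau_real_pos L_pos by simp

lemma dist2_integrable: "integrable M (\<lambda>\<omega>. (norm (xbar r \<omega> - xs))\<^sup>2)"
  by (intro sqi_integrable sqi_diff psq_sqi[OF psq_xbar] sqi_const)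

lemma gap_xbar_integrable: "integrable M (\<lambda>\<omega>. gap (xbar r \<omega>))"
  by (intro gap_integrable psq_sqi[OF psq_xbar])

lemma energy_q_integrable: "integrable M (\<lambda>\<omega>. energy (qp r \<omega>) (qz r \<omega>))"
  by (intro energy_integrable[of r] psq_qp psq_qz)

lemma Egap_nonneg: "0 \<le> Egap r"
  unfolding Egap_def by (intro Bochner_Integration.integral_nonneg gap_nonneg)

lemma dist2_nonneg: "0 \<le> dist2 r"
  unfolding dist2_def by (intro Bochner_Integration.integral_nonneg) simp

lemma Q_nonneg: "0 \<le> Q r"
  unfolding Q_def by (intro divide_nonneg_nonneg Bochner_Integration.integral_nonneg energy_nonneg) simp

lemma h_nonneg: "0 \<le> h r"
  unfolding h_def by (simp add: energy_nonneg)

lemma s2_nonneg: "0 \<le> s2" unfolding s2_def by simp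

lemma NN_bound: "\<alpha>\<^sup>2 * ((\<integral>\<omega>. NN r \<omega> \<partial>M) / (real N * real \<tau>)) \<le> s2"
proof -
  have "(\<integral>\<omega>. NN r \<omega> \<partial>M) / (real N * real \<tau>) \<le> real \<tau> * \<sigma>\<^sup>2"
    using NN_expectation[of r] N_real_pos tau_real_pos by (simp add: pos_divide_le_eq mult.commute)
  then show ?thesis unfolding s2_def by (intro mult_left_mono) auto
qed

lemma nbar_bound: "\<alpha>\<^sup>2 * (\<integral>\<omega>. (norm (nbar r \<omega>))\<^sup>2 \<partial>M) \<le> s2 / real N"
  using mult_left_mono[OF nbar_variance, of "\<alpha>\<^sup>2" r] by (simp add: s2_def)

lemma nn_bound: "(\<integral>\<omega>. ip N (nn r \<omega>) (nn r \<omega>) \<partial>M) / real N \<le> s2"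
  using nn_second_moment[of r] N_real_pos by (simp add: s2_def pos_divide_le_eq mult_ac)

text \<open>The pathwise estimate \<open>descent\<close> is integrated. Its term linear in the noise
  pairs \<open>nbar\<close> with a vector known at the start of the round and has mean zero.\<close>

lemma dist2_step:
  assumes "0 \<le> c" "0 \<le> v" "2 * h r \<le> c * v"
  shows "dist2 (Suc r) \<le> (1 - a * \<mu> / 2 + c) * dist2 r - a * Egap r + 30 * l * Q r + l\<^sup>2 * (v + 31 * h r)
    + 30 * l * s2 + 2 * (s2 / real N)"
proof -
  have pw: "(norm (xbar (Suc r) \<omega> - xs))\<^sup>2 \<le> (1 - a * \<mu> / 2 + c) * (norm (xbar r \<omega> - xs))\<^sup>2
      - a * gap (xbar r \<omega>) + 30 * l / real N * energy (qp r \<omega>) (qz r \<omega>) + l\<^sup>2 * (v + 31 * h r)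
      + 30 * l * \<alpha>\<^sup>2 / (real N * real \<tau>) * NN r \<omega> + 2 * \<alpha>\<^sup>2 * (norm (nbar r \<omega>))\<^sup>2
      - 2 * \<alpha> * inner (xbar r \<omega> - xs) (nbar r \<omega>)" for \<omega>
  proof -
    interpret R: led_round N "\<lambda>i j. W $$ (i, j)" "mixing_rate N W" f L \<mu> xs \<alpha> \<tau> "\<lambda>i. XX r i \<omega>" "\<lambda>i. YY r i \<omega>"
      "\<lambda>i t. PH r i t \<omega>" "\<lambda>i t. noise r i t \<omega>" "T (tp r)" "K (tz r)" "T (qp r \<omega>)" "K (qz r \<omega>)"
      by (rule round)
    have xb: "R.xb = xbar r \<omega>" by (simp add: R.xb_def xbar_def)
    have xb': "R.xb' = xbar (Suc r) \<omega>" by (simp add: R.xb'_def xbar_Suc)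
    have nb: "R.nbar = nbar r \<omega>" by (simp add: R.nbar_def nbar_def)
    have NN: "R.NN = NN r \<omega>" by (simp add: R.NN_def NN_def)
    have hT: "R.hT / real N \<le> h r"
      unfolding h_def R.hT_def by (intro divide_right_mono energy_ge) simp
    have qq: "R.qq / real N \<le> energy (qp r \<omega>) (qz r \<omega>) / real N"
      unfolding R.qq_def by (intro divide_right_mono energy_ge) simp
    have hT': "2 * R.hT / real N \<le> c * v" using hT assms(3) by simp
    have "30 * l * (R.qq / real N) \<le> 30 * l * (energy (qp r \<omega>) (qz r \<omega>) / real N)"
      using l_pos by (intro mult_left_mono qq) simp
    moreover have "l\<^sup>2 * (v + 31 * (R.hT / real N)) \<le> l\<^sup>2 * (v + 31 * h r)"
      using hT by (intro mult_left_mono) auto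
    moreover have "30 * l * (\<alpha>\<^sup>2 * (NN r \<omega> / (real N * real \<tau>))) = 30 * l * \<alpha>\<^sup>2 / (real N * real \<tau>) * NN r \<omega>"
      by simp
    moreover have "30 * l * (energy (qp r \<omega>) (qz r \<omega>) / real N) = 30 * l / real N * energy (qp r \<omega>) (qz r \<omega>)"
      by simp
    ultimately show ?thesis
      using R.descent[OF assms(1,2) hT'] unfolding xb xb' nb NN by linarith
  qed
  let ?R = "\<lambda>\<omega>. (1 - a * \<mu> / 2 + c) * (norm (xbar r \<omega> - xs))\<^sup>2
      - a * gap (xbar r \<omega>) + 30 * l / real N * energy (qp r \<omega>) (qz r \<omega>) + l\<^sup>2 * (v + 31 * h r)
      + 30 * l * \<alpha>\<^sup>2 / (real N * real \<tau>) * NN r \<omega> + 2 * \<alpha>\<^sup>2 * (norm (nbar r \<omega>))\<^sup>2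
      - 2 * \<alpha> * inner (xbar r \<omega> - xs) (nbar r \<omega>)"
  have U: "psq r (\<lambda>\<omega>. xbar r \<omega> - xs)" by (intro psq_diff psq_xbar psq_const)
  note ints = dist2_integrable gap_xbar_integrable energy_q_integrable NN_integrable
    sqi_integrable[OF nbar_sqi] sqi_inner_integrable[OF psq_sqi[OF U] nbar_sqi]
  have "dist2 (Suc r) \<le> (\<integral>\<omega>. ?R \<omega> \<partial>M)"
    unfolding dist2_def using ints by (intro integral_mono pw) auto
  also have "\<dots> = (1 - a * \<mu> / 2 + c) * dist2 r - a * Egap r
      + 30 * l / real N * (\<integral>\<omega>. energy (qp r \<omega>) (qz r \<omega>) \<partial>M) + l\<^sup>2 * (v + 31 * h r)
      + 30 * l * \<alpha>\<^sup>2 / (real N * real \<tau>) * (\<integral>\<omega>. NN r \<omega> \<partial>M) + 2 * \<alpha>\<^sup>2 * (\<integral>\<omega>. (norm (nbar r \<omega>))\<^sup>2 \<partial>M)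
      - 2 * \<alpha> * (\<integral>\<omega>. inner (xbar r \<omega> - xs) (nbar r \<omega>) \<partial>M)"
    unfolding dist2_def Egap_def using ints by (simp add: prob_space del: add_divide_distrib)
  also have "(\<integral>\<omega>. inner (xbar r \<omega> - xs) (nbar r \<omega>) \<partial>M) = 0" by (rule past_nbar_orthogonal[OF U])
  also have "30 * l / real N * (\<integral>\<omega>. energy (qp r \<omega>) (qz r \<omega>) \<partial>M) = 30 * l * Q r" by (simp add: Q_def)
  also have "30 * l * \<alpha>\<^sup>2 / (real N * real \<tau>) * (\<integral>\<omega>. NN r \<omega> \<partial>M)
      = 30 * l * (\<alpha>\<^sup>2 * ((\<integral>\<omega>. NN r \<omega> \<partial>M) / (real N * real \<tau>)))" by simp
  finally have 1: "dist2 (Suc r) \<le> (1 - a * \<mu> / 2 + c) * dist2 r - a * Egap r + 30 * l * Q r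
      + l\<^sup>2 * (v + 31 * h r) + 30 * l * (\<alpha>\<^sup>2 * ((\<integral>\<omega>. NN r \<omega> \<partial>M) / (real N * real \<tau>)))
      + 2 * (\<alpha>\<^sup>2 * (\<integral>\<omega>. (norm (nbar r \<omega>))\<^sup>2 \<partial>M))" by (simp add: mult.assoc)
  have "30 * l * (\<alpha>\<^sup>2 * ((\<integral>\<omega>. NN r \<omega> \<partial>M) / (real N * real \<tau>))) \<le> 30 * l * s2"
    using l_pos by (intro mult_left_mono NN_bound) simp
  then show ?thesis using 1 nbar_bound[of r] by linarith
qed

lemma Q_step:
  assumes "0 < \<epsilon>"
  shows "Q (Suc r) \<le> (1 + \<epsilon>) * (mixing_rate N W * Q r + s2)
    + (1 + 1 / \<epsilon>) * (l\<^sup>2 * (1 + \<kappa>) * (160 * Q r + 336 * (a * l) * Egap r + 96 * h r + 164 * s2))"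
proof -
  \<comment> \<open>The stack that \<open>consensus\<close> pairs with the noise. It is built from
    \<open>qp r\<close> and \<open>qz r\<close>, hence known at the start of the round, and the
    pairing has mean zero.\<close>
  define V where "V \<omega> i = T (\<lambda>i. T (qp r \<omega>) i - K (qz r \<omega>) i) i
      + K (\<lambda>i. qz r \<omega> i + (T (qp r \<omega>) i - K (qz r \<omega>) i)) i" for \<omega> i
  let ?B = "\<lambda>\<omega>. 160 * (energy (qp r \<omega>) (qz r \<omega>) / real N) + 336 * (a * l) * gap (xbar r \<omega>)
      + 96 * h r + 160 * (\<alpha>\<^sup>2 * (NN r \<omega> / (real N * real \<tau>))) + 4 * (\<alpha>\<^sup>2 * (norm (nbar r \<omega>))\<^sup>2)"
  let ?R = "\<lambda>\<omega>. (1 + \<epsilon>) * (mixing_rate N W * energy (qp r \<omega>) (qz r \<omega>) - 2 * ip N (V \<omega>) (nn r \<omega>)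
        + ip N (nn r \<omega>) (nn r \<omega>))
      + (1 + 1 / \<epsilon>) * (real N * (l\<^sup>2 * (1 + \<kappa>) * ?B \<omega>))"
  have pw: "energy (qp (Suc r) \<omega>) (qz (Suc r) \<omega>) \<le> ?R \<omega>" for \<omega>
  proof -
    interpret R: led_round N "\<lambda>i j. W $$ (i, j)" "mixing_rate N W" f L \<mu> xs \<alpha> \<tau> "\<lambda>i. XX r i \<omega>" "\<lambda>i. YY r i \<omega>"
      "\<lambda>i t. PH r i t \<omega>" "\<lambda>i t. noise r i t \<omega>" "T (tp r)" "K (tz r)" "T (qp r \<omega>)" "K (qz r \<omega>)"
      by (rule round)
    have xb: "R.xb = xbar r \<omega>" by (simp add: R.xb_def xbar_def)
    have xb': "R.xb' = xbar (Suc r) \<omega>" by (simp add: R.xb'_def xbar_Suc)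
    have nb: "R.nbar = nbar r \<omega>" by (simp add: R.nbar_def nbar_def)
    have NN: "R.NN = NN r \<omega>" by (simp add: R.NN_def NN_def)
    define d where "d i = eta (Suc r) \<omega> i - eta r \<omega> i" for i
    have "d = mat_op N b (\<lambda>i. dev (xbar (Suc r) \<omega>) i - dev (xbar r \<omega>) i)"
      by (simp add: d_def eta_def mat_op_diff fun_eq_iff)
    then have "ip N d d \<le> \<kappa> * ip N (\<lambda>i. dev (xbar (Suc r) \<omega>) i - dev (xbar r \<omega>) i)
        (\<lambda>i. dev (xbar (Suc r) \<omega>) i - dev (xbar r \<omega>) i)" using b_bounded by simp
    also have "\<dots> \<le> \<kappa> * (real N * L\<^sup>2 * (norm (R.xb' - R.xb))\<^sup>2)"
      unfolding xb xb' by (intro mult_left_mono dev_diff_le kappa_nonneg)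
    finally have d: "ip N d d \<le> \<kappa> * (real N * L\<^sup>2 * (norm (R.xb' - R.xb))\<^sup>2)" .
    have qp: "qp (Suc r) \<omega> = (\<lambda>i. PH r i \<tau> \<omega> - (T (tp r) i - K (tz r) i))"
      by (simp add: qp_def fun_eq_iff tp_Suc)
    have qz: "qz (Suc r) \<omega> = (\<lambda>i. qz r \<omega> i + (PH r i \<tau> \<omega> - (T (tp r) i - K (tz r) i)) + a *\<^sub>R d i)"
      by (simp add: qz_def fun_eq_iff tp_Suc tz_Suc d_def algebra_simps)
    show ?thesis
      using R.consensus[OF refl refl refl refl kappa_nonneg assms d]
      unfolding xb nb NN h_def V_def[abs_def] nn_def[abs_def] qp[symmetric] unfolding qz qp .
  qed
  have V: "psq r (\<lambda>\<omega>. V \<omega> i)" if "i < N" for i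
    unfolding V_def using that by (intro psq_add psq_T psq_K psq_diff psq_qp psq_qz)
  have Vint: "integrable M (\<lambda>\<omega>. ip N (V \<omega>) (nn r \<omega>))"
    by (intro ip_integrable nn_sqi psq_sqi[OF V])
  have nint: "integrable M (\<lambda>\<omega>. ip N (nn r \<omega>) (nn r \<omega>))" by (intro ip_integrable nn_sqi)
  note ints = gap_xbar_integrable energy_q_integrable NN_integrable sqi_integrable[OF nbar_sqi] Vint nint
  define e where "e = (\<integral>\<omega>. energy (qp r \<omega>) (qz r \<omega>) \<partial>M)"
  define B where "B = 160 * (e / real N) + 336 * (a * l) * Egap r + 96 * h r
      + 160 * (\<alpha>\<^sup>2 * ((\<integral>\<omega>. NN r \<omega> \<partial>M) / (real N * real \<tau>)))
      + 4 * (\<alpha>\<^sup>2 * (\<integral>\<omega>. (norm (nbar r \<omega>))\<^sup>2 \<partial>M))"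
  have Bint: "integrable M ?B" using ints by auto
  have BE: "(\<integral>\<omega>. ?B \<omega> \<partial>M) = B"
    unfolding B_def e_def Egap_def using ints by (simp add: prob_space)
  have Aint: "integrable M (\<lambda>\<omega>. mixing_rate N W * energy (qp r \<omega>) (qz r \<omega>) - 2 * ip N (V \<omega>) (nn r \<omega>)
        + ip N (nn r \<omega>) (nn r \<omega>))" using ints by auto
  have AE: "(\<integral>\<omega>. mixing_rate N W * energy (qp r \<omega>) (qz r \<omega>) - 2 * ip N (V \<omega>) (nn r \<omega>)
        + ip N (nn r \<omega>) (nn r \<omega>) \<partial>M) = mixing_rate N W * e + (\<integral>\<omega>. ip N (nn r \<omega>) (nn r \<omega>) \<partial>M)"
    unfolding e_def using ints past_nn_orthogonal[of r V, OF V] by simp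
  have scaled: "integrable M (\<lambda>\<omega>. c * g \<omega>)" if "integrable M g" for c and g :: "'w \<Rightarrow> real"
    using that by simp
  have Rint: "integrable M ?R"
    by (rule Bochner_Integration.integrable_add[OF scaled[OF Aint] scaled[OF scaled[OF scaled[OF Bint]]]])
  have "(\<integral>\<omega>. energy (qp (Suc r) \<omega>) (qz (Suc r) \<omega>) \<partial>M) \<le> (\<integral>\<omega>. ?R \<omega> \<partial>M)"
    by (rule integral_mono[OF energy_q_integrable Rint pw])
  also have "\<dots> = (1 + \<epsilon>) * (mixing_rate N W * e + (\<integral>\<omega>. ip N (nn r \<omega>) (nn r \<omega>) \<partial>M))
      + (1 + 1 / \<epsilon>) * (real N * (l\<^sup>2 * (1 + \<kappa>) * B))"
    unfolding AE[symmetric] BE[symmetric] integral_mult_right_zero[symmetric]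
    by (rule Bochner_Integration.integral_add[OF scaled[OF Aint] scaled[OF scaled[OF scaled[OF Bint]]]])
  finally have "(\<integral>\<omega>. energy (qp (Suc r) \<omega>) (qz (Suc r) \<omega>) \<partial>M) / real N
      \<le> ((1 + \<epsilon>) * (mixing_rate N W * e + (\<integral>\<omega>. ip N (nn r \<omega>) (nn r \<omega>) \<partial>M))
      + (1 + 1 / \<epsilon>) * (real N * (l\<^sup>2 * (1 + \<kappa>) * B))) / real N"
    by (intro divide_right_mono) auto
  also have "\<dots> = (1 + \<epsilon>) * (mixing_rate N W * Q r + (\<integral>\<omega>. ip N (nn r \<omega>) (nn r \<omega>) \<partial>M) / real N)
      + (1 + 1 / \<epsilon>) * (l\<^sup>2 * (1 + \<kappa>) * B)"
  proof -
    have "(x * (y * e + z) + u * (real N * B')) / real N = x * (y * (e / real N) + z / real N) + u * B'"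
      for x y z u B' using N_real_pos by (simp add: field_simps)
    then show ?thesis by (simp add: Q_def e_def)
  qed
  also have "\<dots> \<le> (1 + \<epsilon>) * (mixing_rate N W * Q r + s2)
    + (1 + 1 / \<epsilon>) * (l\<^sup>2 * (1 + \<kappa>) * (160 * Q r + 336 * (a * l) * Egap r + 96 * h r + 164 * s2))"
  proof (intro add_mono mult_left_mono order_refl nn_bound)
    \<comment> \<open>The variance of the averaged noise is bounded crudely by \<open>s2\<close>,
      which merges 160 and 4 into 164.\<close>
    have "s2 / real N \<le> s2" using mult_left_mono[of 1 "real N" s2] N_pos s2_nonneg by (simp add: divide_le_eq)
    then have "B \<le> 160 * (e / real N) + 336 * (a * l) * Egap r + 96 * h r + 160 * s2 + 4 * s2"
      unfolding B_def using NN_bound[of r] nbar_bound[of r] by linarith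
    then show "B \<le> 160 * Q r + 336 * (a * l) * Egap r + 96 * h r + 164 * s2"
      by (simp add: Q_def e_def)
  qed (use assms kappa_nonneg lam_nonneg in auto)
  finally show ?thesis by (simp add: Q_def)
qed

end

text \<open>The weight \<open>120 * l / \<delta>\<close> with \<open>\<delta> = 1 - lam\<close> is
  chosen so that the contraction of \<open>q\<close> by \<open>3 / 8 * \<delta>\<close> yields
  \<open>45 * (l * q)\<close>: 30 of them pay the \<open>q\<close> term of the descent, 15 the
  factor \<open>1 - a * \<mu> / 4\<close> on the weighted \<open>q\<close>. The smallness of
  \<open>l\<close> keeps the weighted feedback below half of the gap term and one
  \<open>l\<^sup>2 * h\<close>.\<close>

lemma potential_recursion:
  fixes lam \<kappa> l a \<mu> c d d' q q' g h v s2 sN :: real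
  assumes lam: "0 \<le> lam" "lam < 1" and kappa: "0 \<le> \<kappa>" and l: "0 < l" and a: "0 < a"
    and mu: "0 \<le> \<mu>" "a * \<mu> \<le> l"
    and small: "(1 + \<kappa>) * l \<le> (1 - lam) ^ 3 / 250000"
    and nonneg: "0 \<le> d" "0 \<le> q" "0 \<le> g" "0 \<le> h" "0 \<le> s2" "0 \<le> c"
    and D: "d' \<le> (1 - a * \<mu> / 2 + c) * d - a * g + 30 * l * q + l\<^sup>2 * (v + 31 * h) + 30 * l * s2 + 2 * sN"
    and Q: "q' \<le> (1 + (1 - lam) / 2) * (lam * q + s2)
      + (1 + 1 / ((1 - lam) / 2)) * (l\<^sup>2 * (1 + \<kappa>) * (160 * q + 336 * (a * l) * g + 96 * h + 164 * s2))"
  shows "d' + 120 * l / (1 - lam) * q' \<le> (1 - a * \<mu> / 4 + c) * (d + 120 * l / (1 - lam) * q) - a / 2 * g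
    + l\<^sup>2 * (v + 32 * h) + (2 * sN + 390 * l * s2 / (1 - lam))"
proof -
  define \<delta> where "\<delta> = 1 - lam"
  define m where "m = 3 / \<delta> * (l\<^sup>2 * (1 + \<kappa>))"
  define C where "C = 120 * l / \<delta>"
  have \<delta>: "0 < \<delta>" "\<delta> \<le> 1" using lam by (auto simp: \<delta>_def)
  have C0: "0 < C" using l \<delta> by (simp add: C_def)
  have m0: "0 \<le> m" using kappa \<delta> by (simp add: m_def)
  have \<delta>3: "\<delta> ^ 3 \<le> \<delta>" using \<delta> power_decreasing[of 1 3 \<delta>] by simp
  have l_le: "l \<le> \<delta> / 250000"
  proof -
    have "l \<le> (1 + \<kappa>) * l" using kappa l by (simp add: algebra_simps)
    also have "\<dots> \<le> \<delta> ^ 3 / 250000" using small by (simp add: \<delta>_def)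
    also have "\<dots> \<le> \<delta> / 250000" using \<delta>3 by simp
    finally show ?thesis .
  qed
  have l1: "l \<le> 1" using l_le \<delta> by simp
  have m_le: "m \<le> 3 / 250000 * (l * \<delta>\<^sup>2)"
  proof -
    have "m = 3 / \<delta> * l * ((1 + \<kappa>) * l)" by (simp add: m_def power2_eq_square)
    also have "\<dots> \<le> 3 / \<delta> * l * (\<delta> ^ 3 / 250000)"
      using small l \<delta> by (intro mult_left_mono) (auto simp: \<delta>_def)
    also have "\<dots> = 3 / 250000 * (l * \<delta>\<^sup>2)" using \<delta> by (simp add: power2_eq_square power3_eq_cube)
    finally show ?thesis .
  qed
  have \<delta>2: "\<delta>\<^sup>2 \<le> \<delta>" using \<delta> by (simp add: power2_eq_square mult_left_le)
  have l\<delta>2: "l * \<delta>\<^sup>2 \<le> \<delta>"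
    using mult_mono[OF l1 \<delta>2] \<delta> l by simp
  have m1: "160 * m \<le> \<delta> / 8" using m_le l\<delta>2 \<delta> by linarith
  have m2: "164 * m \<le> 1" using m_le l\<delta>2 \<delta> by linarith
  have "C * m \<le> C * (3 / 250000 * (l * \<delta>\<^sup>2))" using C0 m_le by (intro mult_left_mono) auto
  also have "\<dots> = 360 / 250000 * (l\<^sup>2 * \<delta>)" using \<delta> by (simp add: C_def power2_eq_square)
  also have "\<dots> \<le> 360 / 250000 * (l\<^sup>2 * 1)" using \<delta> by (intro mult_left_mono) auto
  finally have Cm: "C * m \<le> 360 / 250000 * l\<^sup>2" by simp
  have l3: "l\<^sup>2 * l \<le> 1" using l l1 by (simp add: power2_eq_square mult_le_one)
  have Cml: "C * m * l * 336 \<le> 1 / 2"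
  proof -
    have "C * m * l \<le> 360 / 250000 * l\<^sup>2 * l" using Cm l by (intro mult_right_mono) auto
    also have "\<dots> \<le> 360 / 250000" using l3 by (simp add: mult.commute)
    finally show ?thesis by simp
  qed
  \<comment> \<open>Half of the spectral gap is spent on Young's inequality:
    \<open>(1 + \<delta> / 2) * (1 - \<delta>)\<close> is at most
    \<open>1 - \<delta> / 2\<close>.\<close>
  have e1: "(1 + \<delta> / 2) * lam \<le> 1 - \<delta> / 2"
    unfolding \<delta>_def using zero_le_power2[of "1 - lam"] by (simp add: field_simps power2_eq_square)
  have e2: "1 + 1 / (\<delta> / 2) \<le> 3 / \<delta>" using \<delta> by (simp add: field_simps)
  have q'_le: "q' \<le> (1 - \<delta> / 2) * q + 3 / 2 * s2 + m * (160 * q + 336 * (a * l) * g + 96 * h + 164 * s2)"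
  proof -
    have "(1 + \<delta> / 2) * (lam * q + s2) \<le> (1 - \<delta> / 2) * q + 3 / 2 * s2"
    proof -
      have "(1 + \<delta> / 2) * lam * q \<le> (1 - \<delta> / 2) * q" using e1 nonneg by (intro mult_right_mono) auto
      moreover have "(1 + \<delta> / 2) * s2 \<le> 3 / 2 * s2" using \<delta> nonneg by (intro mult_right_mono) auto
      ultimately show ?thesis by (simp add: distrib_left mult.assoc)
    qed
    moreover have "(1 + 1 / (\<delta> / 2)) * (l\<^sup>2 * (1 + \<kappa>) * (160 * q + 336 * (a * l) * g + 96 * h + 164 * s2))
        \<le> 3 / \<delta> * (l\<^sup>2 * (1 + \<kappa>) * (160 * q + 336 * (a * l) * g + 96 * h + 164 * s2))"
      using e2 nonneg kappa l a by (intro mult_right_mono) auto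
    moreover have "3 / \<delta> * (l\<^sup>2 * (1 + \<kappa>) * (160 * q + 336 * (a * l) * g + 96 * h + 164 * s2))
        = m * (160 * q + 336 * (a * l) * g + 96 * h + 164 * s2)" by (simp only: m_def mult.assoc)
    ultimately show ?thesis using Q unfolding \<delta>_def[symmetric] by linarith
  qed
  have "m * (160 * q + 336 * (a * l) * g + 96 * h + 164 * s2)
      = 160 * m * q + m * 336 * (a * l) * g + 96 * m * h + 164 * m * s2" by (simp add: algebra_simps)
  moreover have "160 * m * q \<le> \<delta> / 8 * q" "164 * m * s2 \<le> 1 * s2"
    using mult_right_mono[OF m1 nonneg(2)] mult_right_mono[OF m2 nonneg(5)] by simp_all
  ultimately have "q' \<le> (1 - \<delta> / 2) * q + \<delta> / 8 * q + 3 / 2 * s2 + s2 + (m * 336 * (a * l) * g + 96 * m * h)"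
    using q'_le by linarith
  then have "C * q' \<le> C * ((1 - \<delta> / 2) * q + \<delta> / 8 * q + 3 / 2 * s2 + s2 + (m * 336 * (a * l) * g + 96 * m * h))"
    using C0 by (intro mult_left_mono) auto
  also have "\<dots> = C * q - 3 / 8 * (C * \<delta>) * q + 5 / 2 * (C * s2) + C * m * l * 336 * (a * g) + 96 * (C * m) * h"
    by (simp add: algebra_simps)
  also have "C * \<delta> = 120 * l" using \<delta> by (simp add: C_def)
  also have "C * q - 3 / 8 * (120 * l) * q + 5 / 2 * (C * s2) + C * m * l * 336 * (a * g) + 96 * (C * m) * h
      \<le> C * q - 45 * (l * q) + 300 * (l * s2 / \<delta>) + 1 / 2 * (a * g) + l\<^sup>2 * h"
  proof -
    have "C * m * l * 336 * (a * g) \<le> 1 / 2 * (a * g)" using Cml a nonneg by (intro mult_right_mono) auto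
    moreover have "96 * (C * m) * h \<le> l\<^sup>2 * h"
      using Cm zero_le_power2[of l] nonneg(4) by (intro mult_right_mono) linarith+
    moreover have "5 / 2 * (C * s2) = 300 * (l * s2 / \<delta>)" by (simp add: C_def)
    ultimately show ?thesis by simp
  qed
  finally have Cq: "C * q' \<le> C * q - 45 * (l * q) + 300 * (l * s2 / \<delta>) + 1 / 2 * (a * g) + l\<^sup>2 * h" .
  have ls: "l * s2 \<le> l * s2 / \<delta>"
    using \<delta> l nonneg by (simp add: pos_le_divide_eq mult_left_le)
  have mu_q: "a * \<mu> / 4 * (C * q) \<le> 15 * (l * q)"
  proof -
    have "a * \<mu> \<le> \<delta> / 2" using mu l_le \<delta> by linarith
    then have "a * \<mu> * (30 * (l * q) / \<delta>) \<le> \<delta> / 2 * (30 * (l * q) / \<delta>)"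
      using l nonneg \<delta> by (intro mult_right_mono) auto
    then show ?thesis using \<delta> by (simp add: C_def mult_ac)
  qed
  have mu_d: "(1 - a * \<mu> / 2 + c) * d \<le> (1 - a * \<mu> / 4 + c) * d"
    using a mu nonneg by (intro mult_right_mono) auto
  have cq: "0 \<le> c * (C * q)" using C0 nonneg by simp
  have Dx: "d' \<le> (1 - a * \<mu> / 2 + c) * d - a * g + 30 * (l * q) + (l\<^sup>2 * v + 31 * (l\<^sup>2 * h)) + 30 * (l * s2) + 2 * sN"
    using D by (simp add: distrib_left mult.assoc)
  have ls0: "0 \<le> l * s2 / \<delta>" using l nonneg \<delta> by simp
  \<comment> \<open>Of the 390, the descent takes 30 and the weighted energy 300.\<close>
  have "d' + C * q' \<le> (1 - a * \<mu> / 4 + c) * d + (C * q - a * \<mu> / 4 * (C * q) + c * (C * q)) - 1 / 2 * (a * g)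
      + (l\<^sup>2 * v + 32 * (l\<^sup>2 * h)) + 2 * sN + 390 * (l * s2 / \<delta>)"
    using Dx Cq ls mu_q mu_d cq ls0 by linarith
  also have "\<dots> = (1 - a * \<mu> / 4 + c) * (d + C * q) - a / 2 * g + l\<^sup>2 * (v + 32 * h) + (2 * sN + 390 * l * s2 / \<delta>)"
    by (simp add: algebra_simps)
  finally show ?thesis unfolding C_def \<delta>_def .
qed

lemma linear_recursion_bound:
  fixes \<Phi> :: "nat \<Rightarrow> real"
  assumes "0 \<le> \<rho>" "\<rho> < 1" "0 \<le> n" and step: "\<And>r. \<Phi> (Suc r) \<le> \<rho> * \<Phi> r + n"
  shows "\<Phi> r \<le> \<rho> ^ r * \<Phi> 0 + n / (1 - \<rho>)"
proof (induction r)
  case 0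
  then show ?case using assms by simp
next
  case (Suc r)
  have "\<Phi> (Suc r) \<le> \<rho> * (\<rho> ^ r * \<Phi> 0 + n / (1 - \<rho>)) + n"
    using step[of r] mult_left_mono[OF Suc assms(1)] by linarith
  also have "\<dots> = \<rho> ^ Suc r * \<Phi> 0 + n / (1 - \<rho>)" using assms(2) by (simp add: field_simps)
  finally show ?case .
qed

text \<open>The growth factors \<open>1 + (1 - \<theta>) * \<theta> ^ r\<close> have a product of at most \<open>exp 1 \<le> 3\<close>.\<close>

lemma summed_recursion_bound:
  fixes \<Phi> g :: "nat \<Rightarrow> real"
  assumes \<theta>: "0 \<le> \<theta>" "\<theta> < 1" and "0 \<le> n" "0 \<le> B" and \<Phi>: "\<And>r. 0 \<le> \<Phi> r" and g: "\<And>r. 0 \<le> g r"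
    and step: "\<And>r. \<Phi> (Suc r) \<le> (1 + (1 - \<theta>) * \<theta> ^ r) * \<Phi> r - g r + B * \<theta> ^ r + n"
  shows "(\<Sum>r<R. g r) \<le> 3 * (\<Phi> 0 + real R * n + B / (1 - \<theta>))"
proof -
  define P where "P R = (\<Prod>r<R. 1 + (1 - \<theta>) * \<theta> ^ r)" for R
  define X where "X R = \<Phi> 0 + real R * n + B * (\<Sum>r<R. \<theta> ^ r)" for R
  have c: "0 \<le> (1 - \<theta>) * \<theta> ^ r" for r using \<theta> by simp
  have P1: "1 \<le> P R" for R
    unfolding P_def using c by (intro prod_ge_1) simp
  have X0: "0 \<le> X R" for R
    unfolding X_def using assms \<Phi>[of 0] \<theta> by (simp add: sum_nonneg)
  have "\<Phi> R + (\<Sum>r<R. g r) \<le> P R * X R"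
  proof (induction R)
    case 0
    then show ?case by (simp add: P_def X_def)
  next
    case (Suc R)
    let ?c = "(1 - \<theta>) * \<theta> ^ R"
    have s: "0 \<le> ?c * (\<Sum>r<R. g r)" using g by (intro mult_nonneg_nonneg[OF c] sum_nonneg) auto
    have "\<Phi> (Suc R) + (\<Sum>r<Suc R. g r) \<le> (1 + ?c) * \<Phi> R + (\<Sum>r<R. g r) + (B * \<theta> ^ R + n)"
      using step[of R] by simp
    also have "\<dots> \<le> (1 + ?c) * (\<Phi> R + (\<Sum>r<R. g r)) + (B * \<theta> ^ R + n)"
      using s by (simp add: algebra_simps)
    also have "\<dots> \<le> (1 + ?c) * (P R * X R) + P (Suc R) * (B * \<theta> ^ R + n)"
    proof (intro add_mono mult_left_mono Suc)
      have "0 \<le> B * \<theta> ^ R + n" using assms \<theta> by simp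
      then show "B * \<theta> ^ R + n \<le> P (Suc R) * (B * \<theta> ^ R + n)"
        using mult_right_mono[OF P1[of "Suc R"]] by fastforce
    qed (use c[of R] in simp)
    also have "(1 + ?c) * (P R * X R) = P (Suc R) * X R" by (simp add: P_def mult_ac)
    also have "P (Suc R) * X R + P (Suc R) * (B * \<theta> ^ R + n) = P (Suc R) * X (Suc R)"
      by (simp add: X_def algebra_simps)
    finally show ?case .
  qed
  then have "(\<Sum>r<R. g r) \<le> P R * X R" using \<Phi>[of R] by simp
  also have "\<dots> \<le> 3 * X R"
  proof (intro mult_right_mono X0)
    have "P R \<le> (\<Prod>r<R. exp ((1 - \<theta>) * \<theta> ^ r))"
      unfolding P_def using c by (intro prod_mono) (auto simp: add_nonneg_nonneg)
    also have "\<dots> = exp (\<Sum>r<R. (1 - \<theta>) * \<theta> ^ r)" by (simp add: exp_sum)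
    also have "(\<Sum>r<R. (1 - \<theta>) * \<theta> ^ r) = 1 - \<theta> ^ R"
      by (simp add: sum_distrib_left[symmetric] one_diff_power_eq)
    also have "exp (1 - \<theta> ^ R) \<le> exp 1" using \<theta> by simp
    also have "\<dots> \<le> 3" by (rule exp_le)
    finally show "P R \<le> 3" .
  qed
  also have "X R \<le> \<Phi> 0 + real R * n + B / (1 - \<theta>)"
  proof -
    have "(1 - \<theta>) * (\<Sum>r<R. \<theta> ^ r) \<le> 1" using \<theta> by (simp add: one_diff_power_eq[symmetric])
    then have "(\<Sum>r<R. \<theta> ^ r) \<le> 1 / (1 - \<theta>)" using \<theta> by (simp add: pos_le_divide_eq mult.commute)
    then show ?thesis using mult_left_mono[of _ "1 / (1 - \<theta>)" B] assms by (simp add: X_def)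
  qed
  finally show ?thesis by simp
qed

section \<open>The Lyapunov function and the two resulting bounds\<close>

context led_energy
begin

definition "lam = mixing_rate N W"
definition "\<Phi> r = dist2 r + 120 * l / (1 - lam) * Q r"

lemma lam_bounds: "0 \<le> lam" "lam < 1"
  unfolding lam_def by (fact lam_nonneg lam_less)+

lemma Phi_nonneg: "0 \<le> \<Phi> r"
  unfolding \<Phi>_def using lam_bounds alpha_pos L_pos
  by (intro add_nonneg_nonneg dist2_nonneg mult_nonneg_nonneg Q_nonneg divide_nonneg_nonneg) auto

lemma dist2_le_Phi: "dist2 r \<le> \<Phi> r"
  unfolding \<Phi>_def using lam_bounds l_pos Q_nonneg by simp

lemma Phi_step:
  assumes "0 \<le> c" "0 \<le> v" "2 * h r \<le> c * v" and "(1 + \<kappa>) * l \<le> (1 - lam) ^ 3 / 250000"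
  shows "\<Phi> (Suc r) \<le> (1 - a * \<mu> / 4 + c) * \<Phi> r - a / 2 * Egap r + l\<^sup>2 * (v + 32 * h r)
    + (2 * (s2 / real N) + 390 * l * s2 / (1 - lam))"
  unfolding \<Phi>_def
proof (rule potential_recursion)
  show "dist2 (Suc r) \<le> (1 - a * \<mu> / 2 + c) * dist2 r - a * Egap r + 30 * l * Q r + l\<^sup>2 * (v + 31 * h r)
    + 30 * l * s2 + 2 * (s2 / real N)" by (rule dist2_step[OF assms(1-3)])
  show "Q (Suc r) \<le> (1 + (1 - lam) / 2) * (lam * Q r + s2)
    + (1 + 1 / ((1 - lam) / 2)) * (l\<^sup>2 * (1 + \<kappa>) * (160 * Q r + 336 * (a * l) * Egap r + 96 * h r + 164 * s2))"
    unfolding lam_def by (rule Q_step) (use lam_less in simp)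
  show "a * \<mu> \<le> l" using mu_le alpha_pos by (simp add: mult_left_mono)
qed (use lam_bounds kappa_nonneg l_pos alpha_pos tau_real_pos mu_nonneg assms Egap_nonneg h_nonneg
    s2_nonneg dist2_nonneg Q_nonneg in auto)

lemma stochastic_term:
  "(2 * (s2 / real N) + 390 * l * s2 / (1 - lam)) / a
    = 2 * (\<alpha> * \<sigma>\<^sup>2 / real N) + 390 * (\<alpha>\<^sup>2 * real \<tau> * L * \<sigma>\<^sup>2 / (1 - lam))"
  using alpha_pos tau_real_pos lam_bounds N_real_pos
  by (simp add: s2_def add_divide_distrib power2_eq_square)

lemma xbar_0: "xbar 0 \<omega> = node_mean N x0"
  by (simp add: xbar_def XX_0)

lemma dist2_0: "dist2 0 = (norm (node_mean N x0 - xs))\<^sup>2"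
  by (simp add: dist2_def xbar_0 prob_space)

text \<open>With nothing split off, \<open>c = v = 0\<close> in every round. The initial value must
  be bounded independently of the step size; for this \<open>a \<le> 1\<close> removes
  \<open>a\<^sup>2\<close> in front of the deviation term, and the weight of the energy is at most
  1.\<close>

lemma strongly_convex_bound:
  assumes mu: "0 < \<mu>" and no_transient: "\<And>r i. tp r i = 0" "\<And>r i. tz r i = 0"
    and small': "(1 + \<kappa>) * l \<le> (1 - lam) ^ 3 / 250000" and a1: "a \<le> 1"
  shows "dist2 r \<le> (1 - a * \<mu> / 4) ^ r * ((norm (node_mean N x0 - xs))\<^sup>2 + 2 * energy p0 z0
      + 2 * ip N (mat_op N b (dev (node_mean N x0))) (mat_op N b (dev (node_mean N x0))))
    + 1560 * (\<alpha> * \<sigma>\<^sup>2 / (\<mu> * real N) + \<alpha>\<^sup>2 * real \<tau> * L * \<sigma>\<^sup>2 / (\<mu> * (1 - lam)))"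
proof -
  define n where "n = 2 * (s2 / real N) + 390 * l * s2 / (1 - lam)"
  define \<rho> where "\<rho> = 1 - a * \<mu> / 4"
  define \<eta> where "\<eta> = mat_op N b (dev (node_mean N x0))"
  have a0: "0 < a" using alpha_pos tau_real_pos by simp
  have n0: "0 \<le> n" unfolding n_def using s2_nonneg l_pos lam_bounds N_real_pos by simp
  have "a * \<mu> \<le> l" using mu_le alpha_pos by (simp add: mult_left_mono)
  then have \<rho>: "0 \<le> \<rho>" "\<rho> < 1" unfolding \<rho>_def using small a0 mu by auto
  have h0: "h r = 0" for r
    unfolding h_def energy_def by (simp add: ip_def no_transient)
  have "\<Phi> (Suc r) \<le> \<rho> * \<Phi> r + n" for r
  proof -
    have "\<Phi> (Suc r) \<le> \<rho> * \<Phi> r - a / 2 * Egap r + n"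
      using Phi_step[of 0 0 r] h0 small' by (simp add: \<rho>_def n_def)
    moreover have "0 \<le> a / 2 * Egap r" using a0 Egap_nonneg by simp
    ultimately show ?thesis by linarith
  qed
  then have "\<Phi> r \<le> \<rho> ^ r * \<Phi> 0 + n / (1 - \<rho>)" by (rule linear_recursion_bound[OF \<rho> n0])
  moreover have "n / (1 - \<rho>) \<le> 1560 * (\<alpha> * \<sigma>\<^sup>2 / (\<mu> * real N) + \<alpha>\<^sup>2 * real \<tau> * L * \<sigma>\<^sup>2 / (\<mu> * (1 - lam)))"
  proof -
    have "n / (1 - \<rho>) = 4 / \<mu> * (n / a)" by (simp add: \<rho>_def mult_ac)
    also have "n / a = 2 * (\<alpha> * \<sigma>\<^sup>2 / real N) + 390 * (\<alpha>\<^sup>2 * real \<tau> * L * \<sigma>\<^sup>2 / (1 - lam))"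
      unfolding n_def by (rule stochastic_term)
    also have "4 / \<mu> * \<dots> = 8 * (\<alpha> * \<sigma>\<^sup>2 / (\<mu> * real N)) + 1560 * (\<alpha>\<^sup>2 * real \<tau> * L * \<sigma>\<^sup>2 / (\<mu> * (1 - lam)))"
      by (simp add: distrib_left)
    also have "\<dots> \<le> 1560 * (\<alpha> * \<sigma>\<^sup>2 / (\<mu> * real N)) + 1560 * (\<alpha>\<^sup>2 * real \<tau> * L * \<sigma>\<^sup>2 / (\<mu> * (1 - lam)))"
      using alpha_pos mu by (intro add_right_mono mult_right_mono) auto
    finally show ?thesis by (simp add: distrib_left)
  qed
  moreover have "\<Phi> 0 \<le> (norm (node_mean N x0 - xs))\<^sup>2 + 2 * energy p0 z0 + 2 * ip N \<eta> \<eta>"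
  proof -
    have "energy (\<lambda>i. p0 i - 0) (\<lambda>i. z0 i - (- a) *\<^sub>R \<eta> i)
        \<le> (1 + 1) * energy p0 z0 + (1 + 1 / 1) * energy (\<lambda>_. 0) (\<lambda>i. (- a) *\<^sub>R \<eta> i)"
      by (rule energy_diff_le) simp
    moreover have "energy (\<lambda>_. 0) (\<lambda>i. (- a) *\<^sub>R \<eta> i) \<le> ip N \<eta> \<eta>"
    proof -
      have "energy (\<lambda>_. 0) (\<lambda>i. (- a) *\<^sub>R \<eta> i) \<le> ip N (\<lambda>i. (- a) *\<^sub>R \<eta> i) (\<lambda>i. (- a) *\<^sub>R \<eta> i)"
        using ip_K_le[of "\<lambda>i. (- a) *\<^sub>R \<eta> i"] by (simp add: energy_def ip_def[of N "\<lambda>_. 0"])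
      also have "\<dots> = a\<^sup>2 * ip N \<eta> \<eta>" unfolding ip_scaleR_left ip_scaleR_right by (simp add: power2_eq_square)
      also have "\<dots> \<le> 1 * ip N \<eta> \<eta>"
        using a1 a0 by (intro mult_right_mono) (auto simp: power_le_one)
      finally show ?thesis by simp
    qed
    ultimately have E: "energy p0 (\<lambda>i. z0 i + a *\<^sub>R \<eta> i) \<le> 2 * energy p0 z0 + 2 * ip N \<eta> \<eta>" by simp
    have "Q 0 = energy p0 (\<lambda>i. z0 i + a *\<^sub>R \<eta> i) / real N"
      unfolding Q_def qp_def[abs_def] qz_def[abs_def] by (simp add: no_transient eta_def xbar_0 \<eta>_def prob_space)
    also have "\<dots> \<le> energy p0 (\<lambda>i. z0 i + a *\<^sub>R \<eta> i)"
      using energy_nonneg[of p0 "\<lambda>i. z0 i + a *\<^sub>R \<eta> i"] N_pos mult_left_mono[of 1 "real N" "energy p0 (\<lambda>i. z0 i + a *\<^sub>R \<eta> i)"]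
      by (simp add: divide_le_eq)
    finally have Q0: "Q 0 \<le> 2 * energy p0 z0 + 2 * ip N \<eta> \<eta>" using E by linarith
    have "120 * l / (1 - lam) \<le> 1"
    proof -
      have "l \<le> (1 + \<kappa>) * l" using kappa_nonneg l_pos by (simp add: distrib_right)
      also have "\<dots> \<le> (1 - lam) ^ 3 / 250000" by (rule small')
      also have "\<dots> \<le> (1 - lam) / 250000"
        using power_decreasing[of 1 3 "1 - lam"] lam_bounds by simp
      finally show ?thesis using lam_bounds by (simp add: divide_le_eq)
    qed
    then have "120 * l / (1 - lam) * Q 0 \<le> 1 * Q 0" by (intro mult_right_mono Q_nonneg)
    then show ?thesis unfolding \<Phi>_def dist2_0 using Q0 by linarith
  qed
  then have "\<rho> ^ r * \<Phi> 0 \<le> \<rho> ^ r * ((norm (node_mean N x0 - xs))\<^sup>2 + 2 * energy p0 z0 + 2 * ip N \<eta> \<eta>)"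
    using \<rho> by (intro mult_left_mono) auto
  ultimately show ?thesis using dist2_le_Phi[of r] unfolding \<rho>_def \<eta>_def by linarith
qed

lemma transient_decay: "h r \<le> lam ^ r * h 0"
proof (induction r)
  case (Suc r)
  have "energy (tp (Suc r)) (tz (Suc r))
      = energy (\<lambda>i. T (tp r) i - K (tz r) i) (\<lambda>i. tz r i + (T (tp r) i - K (tz r) i))"
    by (rule energy_cong) (simp_all add: tp_Suc tz_Suc)
  also have "\<dots> \<le> lam * energy (tp r) (tz r)" unfolding lam_def by (rule energy_contraction)
  finally have "h (Suc r) \<le> lam * h r" by (simp add: h_def divide_right_mono)
  also have "\<dots> \<le> lam * (lam ^ r * h 0)" by (intro mult_left_mono Suc lam_bounds)
  finally show ?case by simp
qed simp

text \<open>\<open>tz 0\<close> equals the shift \<open>a * eta\<close>, so the two cancel in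
  \<open>qz 0\<close> and \<open>Q 0 = 0\<close>: the initial heterogeneity is carried entirely by
  the split-off part.\<close>

lemma convex_bound:
  assumes mu: "\<mu> = 0" and p0_zero: "\<And>i. p0 i = 0" and z0_zero: "\<And>i. z0 i = 0"
    and tp_0: "\<And>i. tp 0 i = 0" and tz_0: "\<And>i. tz 0 i = a *\<^sub>R mat_op N b (dev (node_mean N x0)) i"
    and small': "(1 + \<kappa>) * l \<le> (1 - lam) ^ 3 / 250000" and a_small: "816 * \<kappa> * a \<le> 1" and R: "1 \<le> R"
  shows "(1 / real R) * (\<Sum>r<R. Egap r)
    \<le> 6 * ((norm (node_mean N x0 - xs))\<^sup>2 / (\<alpha> * real \<tau> * real R)
         + \<alpha>\<^sup>2 * (real \<tau>)\<^sup>2 * L\<^sup>2 * (ip N (dev (node_mean N x0)) (dev (node_mean N x0)) / real N) / ((1 - lam)\<^sup>2 * real R))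
      + 2340 * (\<alpha> * \<sigma>\<^sup>2 / real N + \<alpha>\<^sup>2 * real \<tau> * L * \<sigma>\<^sup>2 / (1 - lam))"
proof -
  define n where "n = 2 * (s2 / real N) + 390 * l * s2 / (1 - lam)"
  \<comment> \<open>The decay \<open>lam ^ r\<close> is written as a product of two summable factors
    \<open>\<theta> ^ r\<close>, one for the growth rate \<open>c\<close> and one for the source
    \<open>v\<close>.\<close>
  define \<theta> where "\<theta> = sqrt lam"
  define \<delta> where "\<delta> = 1 - \<theta>"
  define \<zeta> where "\<zeta> = ip N (dev (node_mean N x0)) (dev (node_mean N x0)) / real N"
  define B where "B = l\<^sup>2 * (34 * h 0 / \<delta>)"
  have a0: "0 < a" using alpha_pos tau_real_pos by simp
  have n0: "0 \<le> n" unfolding n_def using s2_nonneg l_pos lam_bounds N_real_pos by simp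
  have \<theta>: "0 \<le> \<theta>" "\<theta> < 1" unfolding \<theta>_def using lam_bounds by auto
  have \<theta>2: "\<theta>\<^sup>2 = lam" unfolding \<theta>_def using lam_bounds by simp
  have \<delta>: "0 < \<delta>" "\<delta> \<le> 1" using \<theta> by (auto simp: \<delta>_def)
  have \<delta>_ge: "(1 - lam) / 2 \<le> \<delta>"
  proof -
    have "1 - lam = \<delta> * (1 + \<theta>)" unfolding \<theta>2[symmetric] \<delta>_def by (simp add: power2_eq_square algebra_simps)
    also have "\<dots> \<le> \<delta> * 2" using \<theta> \<delta> by (intro mult_left_mono) auto
    finally show ?thesis by simp
  qed
  have B0: "0 \<le> B" unfolding B_def using h_nonneg \<delta> by simp
  have Q0: "Q 0 = 0"
    unfolding Q_def qp_def[abs_def] qz_def[abs_def]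
    by (simp add: p0_zero z0_zero tp_0 tz_0 eta_def xbar_0 energy_def ip_def)
  have \<Phi>0: "\<Phi> 0 = (norm (node_mean N x0 - xs))\<^sup>2" by (simp add: \<Phi>_def Q0 dist2_0)
  have step: "\<Phi> (Suc r) \<le> (1 + (1 - \<theta>) * \<theta> ^ r) * \<Phi> r - a / 2 * Egap r + B * \<theta> ^ r + n" for r
  proof -
    \<comment> \<open>The factor \<delta> makes the growth rates sum to at most 1. Its inverse in
      \<open>?v\<close>, together with the sum of the geometric series, produces
      \<open>1 / \<delta>\<^sup>2\<close>, which becomes the \<open>(1 - lam)\<^sup>2\<close> of the
      bound.\<close>
    let ?c = "\<delta> * \<theta> ^ r" and ?v = "2 * h 0 * \<theta> ^ r / \<delta>"
    have lam_r: "lam ^ r = \<theta> ^ r * \<theta> ^ r" unfolding \<theta>2[symmetric] by (simp add: power2_eq_square power_mult_distrib)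
    have "2 * h r \<le> 2 * (lam ^ r * h 0)" using transient_decay[of r] by simp
    also have "\<dots> = ?c * ?v" using \<delta> by (simp add: lam_r)
    finally have "2 * h r \<le> ?c * ?v" .
    then have 1: "\<Phi> (Suc r) \<le> (1 + ?c) * \<Phi> r - a / 2 * Egap r + l\<^sup>2 * (?v + 32 * h r) + n"
      using Phi_step[of ?c ?v r] small' \<theta> \<delta> h_nonneg by (simp add: mu n_def)
    define e where "e = \<theta> ^ r * h 0 / \<delta>"
    have e: "h r \<le> e"
    proof -
      have "h r \<le> \<theta> ^ r * \<theta> ^ r * h 0" using transient_decay[of r] by (simp add: lam_r)
      also have "\<dots> \<le> \<theta> ^ r * 1 * h 0"
        using \<theta> h_nonneg by (intro mult_right_mono mult_left_mono) (auto simp: power_le_one)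
      also have "\<dots> \<le> e"
        using \<delta> \<theta> h_nonneg[of 0] by (simp add: e_def pos_le_divide_eq mult_left_le)
      finally show ?thesis .
    qed
    have v: "?v = 2 * e" and w: "34 * h 0 / \<delta> * \<theta> ^ r = 34 * e" by (simp_all add: e_def)
    have "?v + 32 * h r \<le> 34 * h 0 / \<delta> * \<theta> ^ r" unfolding v w using e by simp
    then have "l\<^sup>2 * (?v + 32 * h r) \<le> l\<^sup>2 * (34 * h 0 / \<delta> * \<theta> ^ r)" by (intro mult_left_mono) auto
    also have "\<dots> = B * \<theta> ^ r" by (simp add: B_def)
    finally show ?thesis using 1 by (simp add: \<delta>_def)
  qed
  have "(\<Sum>r<R. a / 2 * Egap r) \<le> 3 * (\<Phi> 0 + real R * n + B / (1 - \<theta>))"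
    using step a0 Egap_nonneg
    by (intro summed_recursion_bound[OF \<theta> n0 B0 Phi_nonneg]) auto
  then have "a / 2 * (\<Sum>r<R. Egap r) \<le> 3 * (\<Phi> 0 + real R * n + B / \<delta>)"
    by (simp add: sum_distrib_left \<delta>_def)
  then have f1: "(2 / (a * real R)) * (a / 2 * (\<Sum>r<R. Egap r)) \<le> (2 / (a * real R)) * (3 * (\<Phi> 0 + real R * n + B / \<delta>))"
    using a0 by (intro mult_left_mono) auto
  have f2: "(2 / (a * real R)) * (a / 2 * (\<Sum>r<R. Egap r)) = (1 / real R) * (\<Sum>r<R. Egap r)"
    using alpha_pos tau_pos by simp
  have f3: "(2 / (a * real R)) * (3 * (\<Phi> 0 + real R * n + B / \<delta>))
      = 6 * (\<Phi> 0 / (a * real R)) + 6 * (n / a) + 6 * (B / \<delta> / (a * real R))"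
    using alpha_pos tau_pos R by (simp add: distrib_left)
  have f4: "6 * (n / a) \<le> 2340 * (\<alpha> * \<sigma>\<^sup>2 / real N + \<alpha>\<^sup>2 * real \<tau> * L * \<sigma>\<^sup>2 / (1 - lam))"
  proof -
    have "6 * (n / a) = 12 * (\<alpha> * \<sigma>\<^sup>2 / real N) + 2340 * (\<alpha>\<^sup>2 * real \<tau> * L * \<sigma>\<^sup>2 / (1 - lam))"
      unfolding n_def stochastic_term by simp
    also have "\<dots> \<le> 2340 * (\<alpha> * \<sigma>\<^sup>2 / real N) + 2340 * (\<alpha>\<^sup>2 * real \<tau> * L * \<sigma>\<^sup>2 / (1 - lam))"
      using alpha_pos by (intro add_right_mono mult_right_mono) auto
    finally show ?thesis by (simp add: distrib_left)
  qed
  have f5: "B / \<delta> / (a * real R) \<le> \<alpha>\<^sup>2 * (real \<tau>)\<^sup>2 * L\<^sup>2 * \<zeta> / ((1 - lam)\<^sup>2 * real R)"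
  proof -
    have \<zeta>0: "0 \<le> \<zeta>" unfolding \<zeta>_def by simp
    have h0: "h 0 \<le> a\<^sup>2 * (\<kappa> * \<zeta>)"
    proof -
      let ?\<eta> = "mat_op N b (dev (node_mean N x0))"
      have "energy (tp 0) (tz 0) = ip N (\<lambda>i. a *\<^sub>R ?\<eta> i) (K (\<lambda>i. a *\<^sub>R ?\<eta> i))"
        unfolding energy_def by (simp add: ip_def[of N "tp 0"] tp_0 tz_0[abs_def])
      also have "\<dots> \<le> ip N (\<lambda>i. a *\<^sub>R ?\<eta> i) (\<lambda>i. a *\<^sub>R ?\<eta> i)" by (rule ip_K_le)
      also have "\<dots> = a\<^sup>2 * ip N ?\<eta> ?\<eta>" unfolding ip_scaleR_left ip_scaleR_right by (simp add: power2_eq_square)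
      also have "\<dots> \<le> a\<^sup>2 * (\<kappa> * ip N (dev (node_mean N x0)) (dev (node_mean N x0)))"
        by (intro mult_left_mono b_bounded) simp
      finally have "h 0 \<le> a\<^sup>2 * (\<kappa> * ip N (dev (node_mean N x0)) (dev (node_mean N x0))) / real N"
        unfolding h_def by (intro divide_right_mono) auto
      then show ?thesis by (simp add: \<zeta>_def)
    qed
    have "B / \<delta> / (a * real R) = 34 * l\<^sup>2 / (\<delta>\<^sup>2 * a * real R) * h 0"
      by (simp add: B_def power2_eq_square)
    also have "\<dots> \<le> 34 * l\<^sup>2 / (\<delta>\<^sup>2 * a * real R) * (a\<^sup>2 * (\<kappa> * \<zeta>))"
      using h0 a0 by (intro mult_left_mono) auto
    also have "\<dots> = (34 * \<kappa> * a) * (l\<^sup>2 * \<zeta> / (\<delta>\<^sup>2 * real R))"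
    proof -
      have scale: "34 * X / (Y * x * Z) * (x\<^sup>2 * (\<kappa> * \<zeta>)) = 34 * \<kappa> * x * (X * \<zeta> / (Y * Z))" if "x \<noteq> 0"
        for X Y Z x :: real using that by (simp add: power2_eq_square)
      show ?thesis by (rule scale) (use alpha_pos tau_pos in simp)
    qed
    \<comment> \<open>Here the extra power of the step size is used: \<open>\<kappa> * a\<close> is
      small. The remaining 1/4 compensates the replacement of \<open>2 * \<delta>\<close> by the
      smaller \<open>1 - lam\<close>.\<close>
    also have "\<dots> \<le> 1 / 4 * (l\<^sup>2 * \<zeta> / (\<delta>\<^sup>2 * real R))"
    proof (rule mult_right_mono)
      have "0 \<le> \<kappa> * a" using kappa_nonneg a0 by simp
      then show "34 * \<kappa> * a \<le> 1 / 4" using a_small by linarith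
    qed (use \<zeta>0 in simp)
    also have "\<dots> = l\<^sup>2 * \<zeta> / ((2 * \<delta>)\<^sup>2 * real R)" by (simp add: power_mult_distrib)
    also have "\<dots> \<le> l\<^sup>2 * \<zeta> / ((1 - lam)\<^sup>2 * real R)"
    proof (rule divide_left_mono)
      show "(1 - lam)\<^sup>2 * real R \<le> (2 * \<delta>)\<^sup>2 * real R"
        using \<delta>_ge lam_bounds by (intro mult_right_mono power_mono) auto
    qed (use \<zeta>0 \<delta> lam_bounds R in auto)
    finally show ?thesis by (simp add: power_mult_distrib)
  qed
  have "(1 / real R) * (\<Sum>r<R. Egap r) \<le> 6 * (\<Phi> 0 / (a * real R)) + 6 * (n / a) + 6 * (B / \<delta> / (a * real R))"
    using f1 unfolding f2 f3 .
  also have "\<dots> \<le> 6 * (\<Phi> 0 / (a * real R)) + 2340 * (\<alpha> * \<sigma>\<^sup>2 / real N + \<alpha>\<^sup>2 * real \<tau> * L * \<sigma>\<^sup>2 / (1 - lam))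
      + 6 * (\<alpha>\<^sup>2 * (real \<tau>)\<^sup>2 * L\<^sup>2 * \<zeta> / ((1 - lam)\<^sup>2 * real R))"
    by (rule add_mono[OF add_mono[OF order_refl f4] mult_left_mono[OF f5]]) simp
  also have "\<dots> = 6 * (\<Phi> 0 / (a * real R) + \<alpha>\<^sup>2 * (real \<tau>)\<^sup>2 * L\<^sup>2 * \<zeta> / ((1 - lam)\<^sup>2 * real R))
      + 2340 * (\<alpha> * \<sigma>\<^sup>2 / real N + \<alpha>\<^sup>2 * real \<tau> * L * \<sigma>\<^sup>2 / (1 - lam))"
    by argo
  finally show ?thesis unfolding \<Phi>0 \<zeta>_def .
qed

end

lemma led_process_intro:
  fixes f :: "nat \<Rightarrow> 'a::euclidean_space \<Rightarrow> real" and M :: "'w measure"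
  assumes net: "network_assumption N nb W" and tau: "1 \<le> \<tau>" and alpha: "0 < \<alpha>"
    and mu: "0 \<le> \<mu>" "\<mu> \<le> L" and smooth: "smooth_problem N L f"
    and sc: "\<forall>i<N. strongly_convex \<mu> (f i)" and min: "is_minimizer (avg_fun N f) xs"
    and init: "led_init N nb W x0 y0"
    and run: "led_run M N nb W \<tau> \<alpha> (1 / real \<tau>) S F \<xi> \<Xi> f x0 y0 \<sigma>"
  shows "led_process N W f L \<mu> xs M nb \<tau> \<alpha> \<sigma> S F \<xi> \<Xi> x0 y0"
proof -
  interpret gossip N "\<lambda>i j. W $$ (i, j)" "mixing_rate N W" by (rule gossip_of_network_assumption[OF net])
  interpret prob_space M using run by (simp add: led_run_def stochastic_costs_def)
  have "node_mean N y0 = 0"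
    using init unfolding led_init_def
  proof
    assume "\<forall>i<N. y0 i = x0 i - mix nb W x0 i"
    then have "node_mean N y0 = node_mean N (K x0)"
      by (intro node_mean_cong) (simp add: K_def Wop_def mix_eq_sum[OF net])
    then show ?thesis by (simp add: node_mean_K)
  qed (simp add: node_mean_def)
  then show ?thesis
    using assms by unfold_locales (auto simp: smooth_problem_def)
qed

section \<open>The theorem\<close>

text \<open>The linear part of the consensus recursion alone, free of noise and gradient drift, for
  both coupled coordinates.\<close>

primrec (in gossip) transient ::
  "(nat \<Rightarrow> 'a::euclidean_space) \<Rightarrow> nat \<Rightarrow> (nat \<Rightarrow> 'a) \<times> (nat \<Rightarrow> 'a)" where
  "transient z 0 = (\<lambda>_. 0, z)"
| "transient z (Suc r) = (let (p, q) = transient z r; p' = (\<lambda>i. T p i - K q i) in (p', \<lambda>i. q i + p' i))"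

lemma (in gossip) T_zero: "T (\<lambda>_. 0) i = 0" and K_zero: "K (\<lambda>_. 0) i = 0"
  by (simp_all add: T_def K_def Wop_def node_mean_def)

lemma stepsize_exists:
  fixes lam \<kappa> L :: real and \<tau> :: nat
  assumes "0 \<le> lam" "lam < 1" "0 \<le> \<kappa>" "0 < L" "1 \<le> \<tau>"
  shows "\<exists>\<alpha>0>0. \<forall>\<alpha>. 0 < \<alpha> \<longrightarrow> \<alpha> \<le> \<alpha>0 \<longrightarrow>
    (1 + \<kappa>) * (\<alpha> * real \<tau> * L) \<le> (1 - lam) ^ 3 / 250000 \<and> 816 * \<kappa> * (\<alpha> * real \<tau>) \<le> 1 \<and>
    \<alpha> * real \<tau> \<le> 1 \<and> \<alpha> * real \<tau> * L \<le> 1 / 16"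
proof -
  define A where "A = (1 - lam) ^ 3 / 250000"
  \<comment> \<open>Dividing by \<open>1 + \<kappa>\<close> keeps the threshold positive for
    \<open>\<kappa> = 0\<close>, and it makes the second entry imply
    \<open>\<alpha> * real \<tau> \<le> 1\<close> as well.\<close>
  define \<alpha>0 where "\<alpha>0 = min (A / ((1 + \<kappa>) * real \<tau> * L)) (1 / (816 * (1 + \<kappa>) * real \<tau>))"
  have A: "0 < A" "A \<le> 1 / 250000" using assms by (auto simp: A_def power_le_one)
  have pos: "0 < (1 + \<kappa>) * real \<tau> * L" "0 < 816 * (1 + \<kappa>) * real \<tau>" using assms by auto
  then have "0 < \<alpha>0" using A by (simp add: \<alpha>0_def)
  moreover have "(1 + \<kappa>) * (\<alpha> * real \<tau> * L) \<le> (1 - lam) ^ 3 / 250000 \<and> 816 * \<kappa> * (\<alpha> * real \<tau>) \<le> 1 \<and>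
    \<alpha> * real \<tau> \<le> 1 \<and> \<alpha> * real \<tau> * L \<le> 1 / 16" if \<alpha>: "0 < \<alpha>" "\<alpha> \<le> \<alpha>0" for \<alpha>
  proof (intro conjI)
  from \<alpha> have "\<alpha> \<le> A / ((1 + \<kappa>) * real \<tau> * L)" "\<alpha> \<le> 1 / (816 * (1 + \<kappa>) * real \<tau>)" by (auto simp: \<alpha>0_def)
  then have 1: "(1 + \<kappa>) * (\<alpha> * real \<tau> * L) \<le> A" and 2: "816 * ((1 + \<kappa>) * (\<alpha> * real \<tau>)) \<le> 1"
    using pos by (simp_all add: pos_le_divide_eq mult_ac)
  have n: "0 \<le> \<kappa> * (\<alpha> * real \<tau>)" "0 \<le> \<kappa> * (\<alpha> * real \<tau> * L)" "0 \<le> \<alpha> * real \<tau>" using assms \<alpha> by auto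
  show "(1 + \<kappa>) * (\<alpha> * real \<tau> * L) \<le> (1 - lam) ^ 3 / 250000" using 1 by (simp add: A_def)
  have 3: "(1 + \<kappa>) * (\<alpha> * real \<tau>) = \<alpha> * real \<tau> + \<kappa> * (\<alpha> * real \<tau>)" by (simp add: distrib_right)
  have 4: "(1 + \<kappa>) * (\<alpha> * real \<tau> * L) = \<alpha> * real \<tau> * L + \<kappa> * (\<alpha> * real \<tau> * L)" by (simp only: distrib_right mult_1)
  show "816 * \<kappa> * (\<alpha> * real \<tau>) \<le> 1" using 2 n unfolding 3 by simp
  show "\<alpha> * real \<tau> \<le> 1" using 2 n unfolding 3 by simp
  show "\<alpha> * real \<tau> * L \<le> 1 / 16" using 1 A n unfolding 4 by linarith
  qed
  ultimately show ?thesis by blast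
qed

text \<open>A common start has no consensus error, and it gives \<open>y0 = 0\<close> under either
  initialization. Hence both lifted variables start at zero, and the gradient deviation at the
  common point is the only initial error.\<close>

lemma convex_case:
  assumes net: "network_assumption N nb W" and tau: "\<tau> \<ge> 1" and L: "L > 0"
  shows "\<exists>\<alpha>0>0. \<forall>(f :: nat \<Rightarrow> 'a::euclidean_space \<Rightarrow> real) x0 y0 xs.
       smooth_problem N L f \<and> (\<forall>i<N. strongly_convex 0 (f i)) \<and>
       is_minimizer (avg_fun N f) xs \<and> led_init N nb W x0 y0 \<and>
       (\<forall>i<N. \<forall>j<N. x0 i = x0 j) \<longrightarrow>
       (\<forall>\<alpha> \<beta> \<sigma> (M :: 'w measure) (S :: nat \<Rightarrow> 's measure) F \<xi> \<Xi>.
          0 < \<alpha> \<and> \<alpha> \<le> \<alpha>0 \<and> \<beta> = 1 / real \<tau> \<and>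
          led_run M N nb W \<tau> \<alpha> \<beta> S F \<xi> \<Xi> f x0 y0 \<sigma> \<longrightarrow>
          (\<forall>r. integrable M (\<lambda>\<omega>. avg_fun N f (led_mean N nb W \<tau> \<alpha> \<beta> F \<Xi> x0 y0 r \<omega>) - avg_fun N f xs)) \<and>
          (\<forall>R\<ge>1.
             (1 / real R) *
               (\<Sum>r<R. \<integral>\<omega>. avg_fun N f (led_mean N nb W \<tau> \<alpha> \<beta> F \<Xi> x0 y0 r \<omega>) - avg_fun N f xs \<partial>M)
             \<le> 6 * ((norm (node_mean N x0 - xs))\<^sup>2 / (\<alpha> * real \<tau> * real R)
                     + \<alpha>\<^sup>2 * (real \<tau>)\<^sup>2 * L\<^sup>2 * heterogeneity N f (node_mean N x0)
                         / ((1 - mixing_rate N W)\<^sup>2 * real R))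
               + 2340 * (\<alpha> * \<sigma>\<^sup>2 / real N
                     + \<alpha>\<^sup>2 * real \<tau> * L * \<sigma>\<^sup>2 / (1 - mixing_rate N W))))"
proof -
  interpret gossip N "\<lambda>i j. W $$ (i, j)" "mixing_rate N W" by (rule gossip_of_network_assumption[OF net])
  obtain b where b: "\<And>(h :: nat \<Rightarrow> 'a) i. node_mean N h = 0 \<Longrightarrow> i < N \<Longrightarrow> K (mat_op N b h) i = h i"
    using K_right_inverse[where 'a = 'a] by blast
  define \<kappa> where "\<kappa> = (\<Sum>i<N. \<Sum>j<N. (b i j)\<^sup>2)"
  have \<kappa>: "0 \<le> \<kappa>" unfolding \<kappa>_def by (intro sum_nonneg) simp
  have "\<exists>\<alpha>0>0. \<forall>\<alpha>. 0 < \<alpha> \<longrightarrow> \<alpha> \<le> \<alpha>0 \<longrightarrow>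
    (1 + \<kappa>) * (\<alpha> * real \<tau> * L) \<le> (1 - mixing_rate N W) ^ 3 / 250000 \<and> 816 * \<kappa> * (\<alpha> * real \<tau>) \<le> 1 \<and>
    \<alpha> * real \<tau> \<le> 1 \<and> \<alpha> * real \<tau> * L \<le> 1 / 16"
    by (rule stepsize_exists) (rule lam_nonneg lam_less \<kappa> L tau)+
  then obtain \<alpha>0 where "0 < \<alpha>0 \<and> (\<forall>\<alpha>. 0 < \<alpha> \<longrightarrow> \<alpha> \<le> \<alpha>0 \<longrightarrow>
    (1 + \<kappa>) * (\<alpha> * real \<tau> * L) \<le> (1 - mixing_rate N W) ^ 3 / 250000 \<and> 816 * \<kappa> * (\<alpha> * real \<tau>) \<le> 1 \<and>
    \<alpha> * real \<tau> \<le> 1 \<and> \<alpha> * real \<tau> * L \<le> 1 / 16)" ..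
  note \<alpha>0 = this[THEN conjunct1] and stepsize = this[THEN conjunct2]
  note small = stepsize[THEN spec, THEN mp, THEN mp, THEN conjunct1] stepsize[THEN spec, THEN mp, THEN mp, THEN conjunct2, THEN conjunct1]
    stepsize[THEN spec, THEN mp, THEN mp, THEN conjunct2, THEN conjunct2, THEN conjunct1]
    stepsize[THEN spec, THEN mp, THEN mp, THEN conjunct2, THEN conjunct2, THEN conjunct2]
  show ?thesis
  proof (rule exI[of _ \<alpha>0], rule conjI[OF \<alpha>0], intro allI impI, elim conjE)
    fix f :: "nat \<Rightarrow> 'a \<Rightarrow> real" and x0 y0 :: "nat \<Rightarrow> 'a" and xs :: 'a and \<alpha> \<beta> \<sigma> and M :: "'w measure" and S :: "nat \<Rightarrow> 's measure" and F \<xi> \<Xi>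
    assume f: "smooth_problem N L f" "\<forall>i<N. strongly_convex 0 (f i)" "is_minimizer (avg_fun N f) xs"
      and init: "led_init N nb W x0 y0" and cons: "\<forall>i<N. \<forall>j<N. x0 i = x0 j"
      and \<alpha>: "0 < \<alpha>" "\<alpha> \<le> \<alpha>0" and \<beta>: "\<beta> = 1 / real \<tau>"
      and run: "led_run M N nb W \<tau> \<alpha> \<beta> S F \<xi> \<Xi> f x0 y0 \<sigma>"
    interpret P: led_process N W f L 0 xs M nb \<tau> \<alpha> \<sigma> S F \<xi> \<Xi> x0 y0
      by (rule led_process_intro, rule net, rule tau, rule \<alpha>(1), simp, use L in simp, rule f(1), rule f(2),
          rule f(3), rule init, use run \<beta> in blast)
    define tz0 where "tz0 i = (\<alpha> * real \<tau>) *\<^sub>R mat_op N b (P.dev (node_mean N x0)) i" for i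
    define tp where "tp r = fst (transient tz0 r)" for r
    define tz where "tz r = snd (transient tz0 r)" for r
    have x0: "x0 i = node_mean N x0" if "i < N" for i
    proof -
      have "node_mean N x0 = node_mean N (\<lambda>_. x0 i)" using cons that by (intro node_mean_cong) blast
      then show ?thesis by (simp add: node_mean_const[OF N_pos])
    qed
    have y0: "y0 i = 0" if "i < N" for i
      using init unfolding led_init_def
    proof
      assume y0: "\<forall>i<N. y0 i = x0 i - mix nb W x0 i"
      have "mix nb W x0 i = Wop x0 i" by (simp only: mix_eq_sum[OF net that] Wop_def)
      also have "\<dots> = Wop (\<lambda>_. node_mean N x0) i" by (rule Wop_cong) (rule x0)
      also have "\<dots> = x0 i" by (simp only: Wop_const[OF that] x0[OF that])
      finally show ?thesis using y0 that by simp
    qed (use that in simp)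
    interpret E: led_energy N W f L 0 xs M nb \<tau> \<alpha> \<sigma> S F \<xi> \<Xi> x0 y0 b \<kappa> "\<lambda>_. 0" "\<lambda>_. 0" tp tz
    proof unfold_locales
      show "\<alpha> * real \<tau> * L \<le> 1 / 16" by (rule small(4)[OF \<alpha>])
      show "0 \<le> \<kappa>" by (rule \<kappa>)
      show "K (mat_op N b h) i = h i" if "node_mean N h = 0" "i < N" for h :: "nat \<Rightarrow> 'a" and i
        by (rule b[OF that])
      show "ip N (mat_op N b h) (mat_op N b h) \<le> \<kappa> * ip N h h" for h :: "nat \<Rightarrow> 'a"
        unfolding \<kappa>_def by (rule mat_op_bounded)
      show "T (\<lambda>_. 0) i = x0 i - node_mean N x0" if "i < N" for i
        using x0[OF that] by (simp add: T_zero)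
      show "K (\<lambda>_. 0) i = y0 i" if "i < N" for i
        using y0[OF that] by (simp add: K_zero)
      show "tp (Suc r) i = T (tp r) i - K (tz r) i" for r i
        by (simp add: tp_def tz_def Let_def split_beta)
      show "tz (Suc r) i = tz r i + tp (Suc r) i" for r i
        by (simp add: tp_def tz_def Let_def split_beta)
    qed
    have mean: "led_mean N nb W \<tau> \<alpha> \<beta> F \<Xi> x0 y0 r \<omega> = P.xbar r \<omega>" for r \<omega>
      unfolding \<beta> P.led_mean_eq P.xbar_def ..
    have het: "heterogeneity N f (node_mean N x0) = ip N (P.dev (node_mean N x0)) (P.dev (node_mean N x0)) / real N"
      using P.diff by (simp add: heterogeneity_def ip_self P.dev_def P.gbar_def gradient_avg_fun)
    have integrable: "integrable M (\<lambda>\<omega>. avg_fun N f (led_mean N nb W \<tau> \<alpha> \<beta> F \<Xi> x0 y0 r \<omega>) - avg_fun N f xs)" for r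
      unfolding mean using E.gap_xbar_integrable[of r] unfolding P.gap_def .
    have "(1 / real R) * (\<Sum>r<R. E.Egap r)
      \<le> 6 * ((norm (node_mean N x0 - xs))\<^sup>2 / (\<alpha> * real \<tau> * real R)
         + \<alpha>\<^sup>2 * (real \<tau>)\<^sup>2 * L\<^sup>2 * (ip N (P.dev (node_mean N x0)) (P.dev (node_mean N x0)) / real N)
           / ((1 - E.lam)\<^sup>2 * real R))
      + 2340 * (\<alpha> * \<sigma>\<^sup>2 / real N + \<alpha>\<^sup>2 * real \<tau> * L * \<sigma>\<^sup>2 / (1 - E.lam))" if "1 \<le> R" for R
    proof (rule E.convex_bound[OF refl refl refl _ _ _ _ that])
      show "tp 0 i = 0" for i by (simp add: tp_def)
      show "tz 0 i = (\<alpha> * real \<tau>) *\<^sub>R mat_op N b (P.dev (node_mean N x0)) i" for i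
        by (simp add: tz_def tz0_def)
      show "(1 + \<kappa>) * (\<alpha> * real \<tau> * L) \<le> (1 - E.lam) ^ 3 / 250000"
        unfolding E.lam_def by (rule small(1)[OF \<alpha>])
      show "816 * \<kappa> * (\<alpha> * real \<tau>) \<le> 1" by (rule small(2)[OF \<alpha>])
    qed
    note bound = this[folded het, unfolded E.Egap_def P.gap_def E.lam_def, folded mean]
    show "(\<forall>r. integrable M (\<lambda>\<omega>. avg_fun N f (led_mean N nb W \<tau> \<alpha> \<beta> F \<Xi> x0 y0 r \<omega>) - avg_fun N f xs)) \<and>
          (\<forall>R\<ge>1.
             (1 / real R) *
               (\<Sum>r<R. \<integral>\<omega>. avg_fun N f (led_mean N nb W \<tau> \<alpha> \<beta> F \<Xi> x0 y0 r \<omega>) - avg_fun N f xs \<partial>M)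
             \<le> 6 * ((norm (node_mean N x0 - xs))\<^sup>2 / (\<alpha> * real \<tau> * real R)
                     + \<alpha>\<^sup>2 * (real \<tau>)\<^sup>2 * L\<^sup>2 * heterogeneity N f (node_mean N x0)
                         / ((1 - mixing_rate N W)\<^sup>2 * real R))
               + 2340 * (\<alpha> * \<sigma>\<^sup>2 / real N
                     + \<alpha>\<^sup>2 * real \<tau> * L * \<sigma>\<^sup>2 / (1 - mixing_rate N W)))"
      by (rule conjI[OF allI[OF integrable]], intro allI impI, rule bound)
  qed
qed

lemma strongly_convex_case:
  assumes net: "network_assumption N nb W" and tau: "\<tau> \<ge> 1" and L: "L > 0" and \<mu>: "0 < \<mu>" "\<mu> \<le> L"
  shows "\<exists>\<alpha>0>0. \<forall>(f :: nat \<Rightarrow> 'a::euclidean_space \<Rightarrow> real) x0 y0 xs.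
       smooth_problem N L f \<and> (\<forall>i<N. strongly_convex \<mu> (f i)) \<and>
       is_minimizer (avg_fun N f) xs \<and> led_init N nb W x0 y0 \<longrightarrow>
       (\<exists>a0. \<forall>\<alpha> \<beta> \<sigma> (M :: 'w measure) (S :: nat \<Rightarrow> 's measure) F \<xi> \<Xi>.
          0 < \<alpha> \<and> \<alpha> \<le> \<alpha>0 \<and> \<beta> = 1 / real \<tau> \<and>
          led_run M N nb W \<tau> \<alpha> \<beta> S F \<xi> \<Xi> f x0 y0 \<sigma> \<longrightarrow>
          (\<forall>r. integrable M (\<lambda>\<omega>. (norm (led_mean N nb W \<tau> \<alpha> \<beta> F \<Xi> x0 y0 r \<omega> - xs))\<^sup>2) \<and>
             (\<integral>\<omega>. (norm (led_mean N nb W \<tau> \<alpha> \<beta> F \<Xi> x0 y0 r \<omega> - xs))\<^sup>2 \<partial>M)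
             \<le> (1 - \<alpha> * real \<tau> * \<mu> / 4) ^ r * a0
               + 1560 * (\<alpha> * \<sigma>\<^sup>2 / (\<mu> * real N)
                     + \<alpha>\<^sup>2 * real \<tau> * L * \<sigma>\<^sup>2 / (\<mu> * (1 - mixing_rate N W)))))"
proof -
  interpret gossip N "\<lambda>i j. W $$ (i, j)" "mixing_rate N W" by (rule gossip_of_network_assumption[OF net])
  obtain b where b: "\<And>(h :: nat \<Rightarrow> 'a) i. node_mean N h = 0 \<Longrightarrow> i < N \<Longrightarrow> K (mat_op N b h) i = h i"
    using K_right_inverse[where 'a = 'a] by blast
  define \<kappa> where "\<kappa> = (\<Sum>i<N. \<Sum>j<N. (b i j)\<^sup>2)"
  have \<kappa>: "0 \<le> \<kappa>" unfolding \<kappa>_def by (intro sum_nonneg) simp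
  have "\<exists>\<alpha>0>0. \<forall>\<alpha>. 0 < \<alpha> \<longrightarrow> \<alpha> \<le> \<alpha>0 \<longrightarrow>
    (1 + \<kappa>) * (\<alpha> * real \<tau> * L) \<le> (1 - mixing_rate N W) ^ 3 / 250000 \<and> 816 * \<kappa> * (\<alpha> * real \<tau>) \<le> 1 \<and>
    \<alpha> * real \<tau> \<le> 1 \<and> \<alpha> * real \<tau> * L \<le> 1 / 16"
    by (rule stepsize_exists) (rule lam_nonneg lam_less \<kappa> L tau)+
  then obtain \<alpha>0 where "0 < \<alpha>0 \<and> (\<forall>\<alpha>. 0 < \<alpha> \<longrightarrow> \<alpha> \<le> \<alpha>0 \<longrightarrow>
    (1 + \<kappa>) * (\<alpha> * real \<tau> * L) \<le> (1 - mixing_rate N W) ^ 3 / 250000 \<and> 816 * \<kappa> * (\<alpha> * real \<tau>) \<le> 1 \<and>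
    \<alpha> * real \<tau> \<le> 1 \<and> \<alpha> * real \<tau> * L \<le> 1 / 16)" ..
  note \<alpha>0 = this[THEN conjunct1] and stepsize = this[THEN conjunct2]
  note small = stepsize[THEN spec, THEN mp, THEN mp, THEN conjunct1] stepsize[THEN spec, THEN mp, THEN mp, THEN conjunct2, THEN conjunct1]
    stepsize[THEN spec, THEN mp, THEN mp, THEN conjunct2, THEN conjunct2, THEN conjunct1]
    stepsize[THEN spec, THEN mp, THEN mp, THEN conjunct2, THEN conjunct2, THEN conjunct2]
  show ?thesis
  proof (rule exI[of _ \<alpha>0], rule conjI[OF \<alpha>0], intro allI impI, elim conjE)
    fix f :: "nat \<Rightarrow> 'a \<Rightarrow> real" and x0 y0 :: "nat \<Rightarrow> 'a" and xs :: 'a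
    assume f: "smooth_problem N L f" "\<forall>i<N. strongly_convex \<mu> (f i)" "is_minimizer (avg_fun N f) xs"
      and init: "led_init N nb W x0 y0"
    \<comment> \<open>The starts of the nodes may differ here, so preimages of the initial errors
      have to be produced: \<open>p0\<close> by inverting \<open>W\<close>, and \<open>z0\<close> as
      \<open>x0\<close> or 0 according to the initialization.\<close>
    obtain p0 :: "nat \<Rightarrow> 'a" where p0: "\<And>i. i < N \<Longrightarrow> mix nb W p0 i = x0 i"
      using network_assumption_mix_surj[OF net] by blast
    have Wp0: "Wop p0 i = x0 i" if "i < N" for i
      using p0[OF that] by (simp add: mix_eq_sum[OF net that] Wop_def)
    have "node_mean N p0 = node_mean N x0"
      using node_mean_Wop[of p0] node_mean_cong[of N "Wop p0" x0] Wp0 by simp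
    then have Tp0: "T p0 i = x0 i - node_mean N x0" if "i < N" for i
      using Wp0[OF that] by (simp add: T_def)
    obtain z0 :: "nat \<Rightarrow> 'a" where Kz0: "\<And>i. i < N \<Longrightarrow> K z0 i = y0 i"
    proof -
      from init consider "\<forall>i<N. y0 i = x0 i - mix nb W x0 i" | "\<forall>i<N. y0 i = 0"
        unfolding led_init_def by blast
      then show thesis
      proof cases
        case 1
        then show thesis by (intro that[of x0]) (simp add: K_def Wop_def mix_eq_sum[OF net])
      next
        case 2
        then show thesis by (intro that[of "\<lambda>_. 0"]) (simp add: K_zero)
      qed
    qed
    \<comment> \<open>\<open>a0\<close> is chosen before \<alpha> and the probability space, so the
      deviation is written out here instead of using \<open>dev\<close> of an instance that depends
      on them.\<close>
    define \<eta> where "\<eta> = mat_op N b (\<lambda>i. gradient (f i) (node_mean N x0)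
        - node_mean N (\<lambda>i. gradient (f i) (node_mean N x0)))"
    define a0 where "a0 = (norm (node_mean N x0 - xs))\<^sup>2 + 2 * energy p0 z0 + 2 * ip N \<eta> \<eta>"
    show "\<exists>a0. \<forall>\<alpha> \<beta> \<sigma> (M :: 'w measure) (S :: nat \<Rightarrow> 's measure) F \<xi> \<Xi>.
          0 < \<alpha> \<and> \<alpha> \<le> \<alpha>0 \<and> \<beta> = 1 / real \<tau> \<and>
          led_run M N nb W \<tau> \<alpha> \<beta> S F \<xi> \<Xi> f x0 y0 \<sigma> \<longrightarrow>
          (\<forall>r. integrable M (\<lambda>\<omega>. (norm (led_mean N nb W \<tau> \<alpha> \<beta> F \<Xi> x0 y0 r \<omega> - xs))\<^sup>2) \<and>
             (\<integral>\<omega>. (norm (led_mean N nb W \<tau> \<alpha> \<beta> F \<Xi> x0 y0 r \<omega> - xs))\<^sup>2 \<partial>M)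
             \<le> (1 - \<alpha> * real \<tau> * \<mu> / 4) ^ r * a0
               + 1560 * (\<alpha> * \<sigma>\<^sup>2 / (\<mu> * real N)
                     + \<alpha>\<^sup>2 * real \<tau> * L * \<sigma>\<^sup>2 / (\<mu> * (1 - mixing_rate N W))))"
    proof (rule exI[of _ a0], intro allI impI; elim conjE)
      fix \<alpha> \<beta> \<sigma> and M :: "'w measure" and S :: "nat \<Rightarrow> 's measure" and F \<xi> \<Xi> r
      assume \<alpha>: "0 < \<alpha>" "\<alpha> \<le> \<alpha>0" and \<beta>: "\<beta> = 1 / real \<tau>"
        and run: "led_run M N nb W \<tau> \<alpha> \<beta> S F \<xi> \<Xi> f x0 y0 \<sigma>"
      interpret P: led_process N W f L \<mu> xs M nb \<tau> \<alpha> \<sigma> S F \<xi> \<Xi> x0 y0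
        by (rule led_process_intro, rule net, rule tau, rule \<alpha>(1), use \<mu> in simp, rule \<mu>(2), rule f(1), rule f(2),
            rule f(3), rule init, use run \<beta> in blast)
      interpret E: led_energy N W f L \<mu> xs M nb \<tau> \<alpha> \<sigma> S F \<xi> \<Xi> x0 y0 b \<kappa> p0 z0 "\<lambda>_ _. 0" "\<lambda>_ _. 0"
      proof unfold_locales
        show "\<alpha> * real \<tau> * L \<le> 1 / 16" by (rule small(4)[OF \<alpha>])
        show "0 \<le> \<kappa>" by (rule \<kappa>)
        show "K (mat_op N b h) i = h i" if "node_mean N h = 0" "i < N" for h :: "nat \<Rightarrow> 'a" and i
          by (rule b[OF that])
        show "ip N (mat_op N b h) (mat_op N b h) \<le> \<kappa> * ip N h h" for h :: "nat \<Rightarrow> 'a"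
          unfolding \<kappa>_def by (rule mat_op_bounded)
        show "T p0 i = x0 i - node_mean N x0" if "i < N" for i by (rule Tp0[OF that])
        show "K z0 i = y0 i" if "i < N" for i by (rule Kz0[OF that])
      qed (simp_all add: T_zero K_zero)
      have mean: "led_mean N nb W \<tau> \<alpha> \<beta> F \<Xi> x0 y0 r \<omega> = P.xbar r \<omega>" for r \<omega>
        unfolding \<beta> P.led_mean_eq P.xbar_def ..
      have \<eta>: "\<eta> = mat_op N b (P.dev (node_mean N x0))"
        by (simp add: \<eta>_def P.dev_def[abs_def] P.gbar_def)
      have "E.dist2 r \<le> (1 - \<alpha> * real \<tau> * \<mu> / 4) ^ r * a0
          + 1560 * (\<alpha> * \<sigma>\<^sup>2 / (\<mu> * real N) + \<alpha>\<^sup>2 * real \<tau> * L * \<sigma>\<^sup>2 / (\<mu> * (1 - E.lam)))"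
        unfolding a0_def \<eta>
        by (rule E.strongly_convex_bound[OF \<mu>(1) refl refl small(1)[OF \<alpha>, folded E.lam_def] small(3)[OF \<alpha>]])
      then show "integrable M (\<lambda>\<omega>. (norm (led_mean N nb W \<tau> \<alpha> \<beta> F \<Xi> x0 y0 r \<omega> - xs))\<^sup>2) \<and>
             (\<integral>\<omega>. (norm (led_mean N nb W \<tau> \<alpha> \<beta> F \<Xi> x0 y0 r \<omega> - xs))\<^sup>2 \<partial>M)
             \<le> (1 - \<alpha> * real \<tau> * \<mu> / 4) ^ r * a0
               + 1560 * (\<alpha> * \<sigma>\<^sup>2 / (\<mu> * real N)
                     + \<alpha>\<^sup>2 * real \<tau> * L * \<sigma>\<^sup>2 / (\<mu> * (1 - mixing_rate N W)))"
        unfolding mean E.dist2_def E.lam_def by (rule conjI[OF E.dist2_integrable])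
    qed
  qed
qed

theorem theorem2:
  shows "\<exists>C1>0. \<exists>C2>0. \<exists>C3>0. \<forall>N nb W \<tau> L. network_assumption N nb W \<and> \<tau> \<ge> 1 \<and> L > 0 \<longrightarrow>
    (\<exists>\<alpha>0>0. \<forall>(f :: nat \<Rightarrow> 'a::euclidean_space \<Rightarrow> real) x0 y0 xs.
       smooth_problem N L f \<and> (\<forall>i<N. strongly_convex 0 (f i)) \<and>
       is_minimizer (avg_fun N f) xs \<and> led_init N nb W x0 y0 \<and>
       (\<forall>i<N. \<forall>j<N. x0 i = x0 j) \<longrightarrow>
       (\<forall>\<alpha> \<beta> \<sigma> (M :: 'w measure) (S :: nat \<Rightarrow> 's measure) F \<xi> \<Xi>.
          0 < \<alpha> \<and> \<alpha> \<le> \<alpha>0 \<and> \<beta> = 1 / real \<tau> \<and>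
          led_run M N nb W \<tau> \<alpha> \<beta> S F \<xi> \<Xi> f x0 y0 \<sigma> \<longrightarrow>
          (\<forall>r. integrable M (\<lambda>\<omega>. avg_fun N f (led_mean N nb W \<tau> \<alpha> \<beta> F \<Xi> x0 y0 r \<omega>) - avg_fun N f xs)) \<and>
          (\<forall>R\<ge>1.
             (1 / real R) *
               (\<Sum>r<R. \<integral>\<omega>. avg_fun N f (led_mean N nb W \<tau> \<alpha> \<beta> F \<Xi> x0 y0 r \<omega>) - avg_fun N f xs \<partial>M)
             \<le> C1 * ((norm (node_mean N x0 - xs))\<^sup>2 / (\<alpha> * real \<tau> * real R)
                     + \<alpha>\<^sup>2 * (real \<tau>)\<^sup>2 * L\<^sup>2 * heterogeneity N f (node_mean N x0)
                         / ((1 - mixing_rate N W)\<^sup>2 * real R))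
               + C2 * (\<alpha> * \<sigma>\<^sup>2 / real N
                     + \<alpha>\<^sup>2 * real \<tau> * L * \<sigma>\<^sup>2 / (1 - mixing_rate N W)))))
    \<and>
    (\<forall>\<mu>. 0 < \<mu> \<and> \<mu> \<le> L \<longrightarrow>
    (\<exists>\<alpha>0>0. \<forall>(f :: nat \<Rightarrow> 'a \<Rightarrow> real) x0 y0 xs.
       smooth_problem N L f \<and> (\<forall>i<N. strongly_convex \<mu> (f i)) \<and>
       is_minimizer (avg_fun N f) xs \<and> led_init N nb W x0 y0 \<longrightarrow>
       (\<exists>a0. \<forall>\<alpha> \<beta> \<sigma> (M :: 'w measure) (S :: nat \<Rightarrow> 's measure) F \<xi> \<Xi>.
          0 < \<alpha> \<and> \<alpha> \<le> \<alpha>0 \<and> \<beta> = 1 / real \<tau> \<and>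
          led_run M N nb W \<tau> \<alpha> \<beta> S F \<xi> \<Xi> f x0 y0 \<sigma> \<longrightarrow>
          (\<forall>r. integrable M (\<lambda>\<omega>. (norm (led_mean N nb W \<tau> \<alpha> \<beta> F \<Xi> x0 y0 r \<omega> - xs))\<^sup>2) \<and>
             (\<integral>\<omega>. (norm (led_mean N nb W \<tau> \<alpha> \<beta> F \<Xi> x0 y0 r \<omega> - xs))\<^sup>2 \<partial>M)
             \<le> (1 - \<alpha> * real \<tau> * \<mu> / 4) ^ r * a0
               + C3 * (\<alpha> * \<sigma>\<^sup>2 / (\<mu> * real N)
                     + \<alpha>\<^sup>2 * real \<tau> * L * \<sigma>\<^sup>2 / (\<mu> * (1 - mixing_rate N W)))))))"
  \<comment> \<open>The 6 is 2, from dividing by \<open>a / 2\<close>, times the bound 3 on the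
    product of growth factors. The noise constants come from the 390 of the potential: 2340 is 6 *
    390, and 1560 is 4 * 390 because the contraction rate is \<open>a * \<mu> / 4\<close>.\<close>
  apply (rule exI[where x = 6], rule conjI, simp)
  apply (rule exI[where x = 2340], rule conjI, simp)
  apply (rule exI[where x = 1560], rule conjI, simp)
  apply (intro allI impI conjI; elim conjE)
   apply (rule convex_case; assumption)
  apply (rule strongly_convex_case; assumption)
  done

end
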